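(* In the setting and with the notation of the context (fixed teacher, partition and reference weights $\bar\pi$), there exists $\tau_0>0$ such that for every $\tau\in(0,\tau_0)$ there are a neighborhood $W$ of $\widetilde\mu$ and constants $q_{\mathrm{amb}}\in(0,1)$, $\eta_{\mathrm{ub}}>0$, $\kappa_0\ge1$, $\delta_\pi>0$ such that the following holds. Let $\pi$ be a student weight vector with reference weights $\bar\pi$ and $\Delta_\pi\le\delta_\pi$, let $\kappa\ge\kappa_0$, $0<\eta<\eta_{\mathrm{ub}}$ and $\mu\in W\cap\mathcal A_{\tau,\kappa}$. Let $$\mu^{(0)}:=\mu-\frac{\mathcal L(\mu,\pi)}{\|\nabla_\mu\mathcal L(\mu,\pi)\|^2}\nabla_\mu\mathcal L(\mu,\pi),\qquad \mu^{(j+1)}=\mu^{(j)}-\eta\nabla_\mu\mathcal L(\mu^{(j)},\pi)\quad(j\ge0),$$ and let $K:=\min\{j\ge0:\mu^{(j)}\in\mathcal T_\tau\cup\mathcal C_\kappa\}$ (assumed finite). If $\mu^{(j)}\in W$ for all $j=0,\dots,K$, then either $\mu^{(K)}\in\mathcal C_\kappa$, or $$\|\mu^{(K)}-\widetilde\mu\|\le q_{\mathrm{amb}}\,\|\mu-\widetilde\mu\|.$$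
   Context: $\phi(x\mid\mu)=(2\pi)^{-d/2}e^{-\|x-\mu\|^2/2}$ on $\mathbb R^d$. Teacher: $p^\star=\sum_{\ell=1}^m\pi^\star_\ell\phi(\cdot\mid\mu^\star_\ell)$, $\pi^\star$ positive, satisfying: (A1) $M^\star=\sum_{\ell}\pi^\star_\ell\mu_\ell^\star{\mu_\ell^\star}^{\top}$ has exactly $m$ nonzero eigenvalues, the largest being $\lambda_{\max}$ and the smallest $\lambda_{\min}>0$; (A2) $D_{\max}\ge\|\mu_\ell^\star\|\ge D_{\min}\ge 4\frac{\lambda_{\max}}{\lambda_{\min}}\sqrt{dn}$ for all $\ell$; (A3) with $\pi^\star_{\min}=\min_\ell\pi^\star_\ell$, $\min_{i\ne j}\|\mu_i^\star-\mu_j^\star\|\ge C_0\max\{\sqrt{D_{\max}}(dn)^{1/4},\sqrt{d/\pi^\star_{\min}},\sqrt{\log(D_{\max}dnm/(\lambda_{\min}\pi^\star_{\min}))}\}$ for a sufficiently large absolute constant $C_0>0$. For $\mu=(\mu_1,\dots,\mu_n)\in\mathbb R^{dn}$, $\pi\in\Delta^{n-1}$ (probability simplex): $p_{\mu,\pi}=\sum_{i=1}^n\pi_i\phi(\cdot\mid\mu_i)$ and $\mathcal L(\mu,\pi)=\mathbb E_{X\sim p^\star}[\log(p^\star(X)/p_{\mu,\pi}(X))]$ (minimal value $0$). Fix a partition $[n]=\bigsqcup_{\ell=1}^mS_\ell$ into nonempty sets, $\widetilde\mu\in\mathbb R^{dn}$ with $\widetilde\mu_i=\mu^\star_\ell$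 for $i\in S_\ell$, and strictly positive weights $\bar\pi\in\Delta^{n-1}$ with $\sum_{i\in S_\ell}\bar\pi_i=\pi^\star_\ell$ for all $\ell$. For strictly positive $\pi\in\Delta^{n-1}$ put $\widehat\pi_\ell=\sum_{i\in S_\ell}\pi_i$, $\Delta_\pi=\max_\ell|\widehat\pi_\ell-\pi^\star_\ell|/\pi^\star_\ell$; its reference weights are $i\mapsto\pi_i\pi^\star_\ell/\widehat\pi_\ell$ ($i\in S_\ell$), and we consider those $\pi$ whose reference weights equal $\bar\pi$. Ravine $\mathcal M$ of the reference objective $f(\mu)=\mathcal L(\mu,\bar\pi)$: let $H=\nabla^2f(\widetilde\mu)$; $\mathcal M$ is the set of $\mu$ near $\widetilde\mu$ for which the orthogonal projection of $\nabla f(\mu)$ onto $\operatorname{range}H$ vanishes. Near $\widetilde\mu$ it is a $C^\infty$ manifold through $\widetilde\mu$ with tangent space $\ker H$ there. $P_{\mathcal M}$ is the nearest-point projection (single-valued and smooth near $\widetilde\mu$), $\operatorname{dist}_{\mathcal M}(\mu)=\inf_{y\in\mathcal M}\|\mu-y\|$. With $\bar\mu_\ell=\frac1{\widehat\pi_\ell}\sum_{i\in S_\ell}\pi_i\mu_i$ let $\mathsf D(\mu)=\sum_{\ell}\sum_{i\in S_\ell}\pi_i\|\mu_i-\bar\mu_\ell\|^2$. For $\tau,\kappa>0$ and $y=P_{\mathcal M}(\mu)$ (for $\mu$ near $\widetilde\mu$): $\mathcal T_\tau=\{\mu:\operatorname{dist}_{\mathcal M}(\mu)\le\tau\mathsf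 D(y)^{3/2}\}$, $\mathcal C_\kappa=\{\mu:\mathsf D(y)\le\kappa\Delta_\pi^{2/3}\}$, $\mathcal A_{\tau,\kappa}=\mathcal T_\tau\setminus\mathcal C_\kappa$. *)

theory Defs
  imports "HOL-Analysis.Analysis" "Jordan_Normal_Form.Char_Poly"
begin

section \<open>Calculus on Euclidean space over a finite index set\<close>

text \<open>
  The separation constant of the teacher is absolute, i.e. it is chosen before the dimensions
  \<open>d\<close>, \<open>n\<close> and \<open>m\<close>.  Dimensions are therefore natural numbers rather than types, and
  Euclidean space over a finite index set \<open>I\<close> is the carrier \<open>I \<rightarrow>\<^sub>E UNIV\<close> with norm
  \<^const>\<open>L2_set\<close>: the space \<open>\<real>\<^sup>d\<close> has \<open>I = {..<d}\<close>, and the parameter space of dimension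
  \<open>dn\<close> has \<open>I = {..<n} \<times> {..<d}\<close>.  All indices start at \<open>0\<close>.
\<close>

definition euclid :: "'i set \<Rightarrow> ('i \<Rightarrow> real) set" where
  "euclid I = I \<rightarrow>\<^sub>E UNIV"

definition edist :: "'i set \<Rightarrow> ('i \<Rightarrow> real) \<Rightarrow> ('i \<Rightarrow> real) \<Rightarrow> real" where
  "edist I x y = L2_set (\<lambda>i. x i - y i) I"

definition nbhd :: "'i set \<Rightarrow> ('i \<Rightarrow> real) \<Rightarrow> ('i \<Rightarrow> real) set \<Rightarrow> bool" where
  "nbhd I x W \<longleftrightarrow> W \<subseteq> euclid I \<and> (\<exists>e>0. \<forall>y\<in>euclid I. edist I y x < e \<longrightarrow> y \<in> W)"

definition partial :: "'i \<Rightarrow> (('i \<Rightarrow> real) \<Rightarrow> real) \<Rightarrow> ('i \<Rightarrow> real) \<Rightarrow> real" where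
  "partial i f x = deriv (\<lambda>t. f (x(i := t))) (x i)"

definition grad :: "'i set \<Rightarrow> (('i \<Rightarrow> real) \<Rightarrow> real) \<Rightarrow> ('i \<Rightarrow> real) \<Rightarrow> ('i \<Rightarrow> real)" where
  "grad I f x = (\<lambda>i\<in>I. partial i f x)"

definition hess :: "'i set \<Rightarrow> (('i \<Rightarrow> real) \<Rightarrow> real) \<Rightarrow> ('i \<Rightarrow> real) \<Rightarrow> ('i \<Rightarrow> real) \<Rightarrow> ('i \<Rightarrow> real)" where
  "hess I f x v = (\<lambda>i\<in>I. \<Sum>j\<in>I. partial i (partial j f) x * v j)"

definition orth_proj :: "'i set \<Rightarrow> ('i \<Rightarrow> real) set \<Rightarrow> ('i \<Rightarrow> real) \<Rightarrow> ('i \<Rightarrow> real)" where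
  "orth_proj I V v = (THE w. w \<in> V \<and> (\<forall>u\<in>V. (\<Sum>i\<in>I. (v i - w i) * u i) = 0))"

definition dist_to :: "'i set \<Rightarrow> ('i \<Rightarrow> real) set \<Rightarrow> ('i \<Rightarrow> real) \<Rightarrow> real" where
  "dist_to I M x = (INF y\<in>M. edist I x y)"

definition nearest :: "'i set \<Rightarrow> ('i \<Rightarrow> real) set \<Rightarrow> ('i \<Rightarrow> real) \<Rightarrow> ('i \<Rightarrow> real)" where
  "nearest I M x = arg_min_on (edist I x) M"

text \<open>The radius \<open>r\<close> makes the ``near \<open>x0\<close>'' in the description of the ravine explicit.\<close>

definition ravine ::
  "'i set \<Rightarrow> (('i \<Rightarrow> real) \<Rightarrow> real) \<Rightarrow> ('i \<Rightarrow> real) \<Rightarrow> real \<Rightarrow> ('i \<Rightarrow> real) set" where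
  "ravine I f x0 r =
     {x \<in> euclid I. edist I x x0 < r \<and>
        orth_proj I (hess I f x0 ` euclid I) (grad I f x) = (\<lambda>i\<in>I. 0)}"

definition gd_step ::
  "'i set \<Rightarrow> (('i \<Rightarrow> real) \<Rightarrow> real) \<Rightarrow> real \<Rightarrow> ('i \<Rightarrow> real) \<Rightarrow> ('i \<Rightarrow> real)" where
  "gd_step I f s x = (\<lambda>i\<in>I. x i - s * grad I f x i)"

definition polyak_step ::
  "'i set \<Rightarrow> (('i \<Rightarrow> real) \<Rightarrow> real) \<Rightarrow> ('i \<Rightarrow> real) \<Rightarrow> ('i \<Rightarrow> real)" where
  "polyak_step I f x = gd_step I f (f x / (L2_set (grad I f x) I)\<^sup>2) x"

section \<open>Gaussian mixtures\<close>

definition gauss :: "nat \<Rightarrow> (nat \<Rightarrow> real) \<Rightarrow> (nat \<Rightarrow> real) \<Rightarrow> real" where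
  "gauss d \<mu> x = (2 * pi) powr (- real d / 2) * exp (- (edist {..<d} x \<mu>)\<^sup>2 / 2)"

definition mixture ::
  "nat \<Rightarrow> nat \<Rightarrow> (nat \<Rightarrow> real) \<Rightarrow> (nat \<Rightarrow> nat \<Rightarrow> real) \<Rightarrow> (nat \<Rightarrow> real) \<Rightarrow> real" where
  "mixture d n w c x = (\<Sum>i<n. w i * gauss d (c i) x)"

definition mixture_measure ::
  "nat \<Rightarrow> nat \<Rightarrow> (nat \<Rightarrow> real) \<Rightarrow> (nat \<Rightarrow> nat \<Rightarrow> real) \<Rightarrow> (nat \<Rightarrow> real) measure" where
  "mixture_measure d n w c =
     density (\<Pi>\<^sub>M k\<in>{..<d}. lborel) (\<lambda>x. ennreal (mixture d n w c x))"

definition simplex_pos :: "nat \<Rightarrow> (nat \<Rightarrow> real) \<Rightarrow> bool" where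
  "simplex_pos n w \<longleftrightarrow> (\<forall>i<n. 0 < w i) \<and> (\<Sum>i<n. w i) = 1"

abbreviation params :: "nat \<Rightarrow> nat \<Rightarrow> (nat \<times> nat) set" where
  "params d n \<equiv> {..<n} \<times> {..<d}"

text \<open>The teacher has weights \<open>\<pi>s\<close> and means \<open>\<mu>s\<close>, the student weights \<open>\<pi>\<close> and means \<open>curry \<mu> i\<close>.\<close>

definition loss ::
  "nat \<Rightarrow> nat \<Rightarrow> nat \<Rightarrow> (nat \<Rightarrow> real) \<Rightarrow> (nat \<Rightarrow> nat \<Rightarrow> real) \<Rightarrow> (nat \<Rightarrow> real) \<Rightarrow> (nat \<times> nat \<Rightarrow> real) \<Rightarrow> real" where
  "loss d n m \<pi>s \<mu>s \<pi> \<mu> =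
     (\<integral>x. ln (mixture d m \<pi>s \<mu>s x / mixture d n \<pi> (curry \<mu>) x) \<partial>mixture_measure d m \<pi>s \<mu>s)"

section \<open>Assumptions on the teacher\<close>

definition second_moment :: "nat \<Rightarrow> nat \<Rightarrow> (nat \<Rightarrow> real) \<Rightarrow> (nat \<Rightarrow> nat \<Rightarrow> real) \<Rightarrow> real mat" where
  "second_moment d m \<pi>s \<mu>s = mat d d (\<lambda>(a, b). \<Sum>l<m. \<pi>s l * \<mu>s l a * \<mu>s l b)"

text \<open>Eigenvalues are counted with multiplicity; the matrix is real symmetric, so all \<open>d\<close> roots of
  its characteristic polynomial are real.\<close>

definition num_nonzero_eigenvalues :: "real mat \<Rightarrow> nat" where
  "num_nonzero_eigenvalues A = size (filter_mset (\<lambda>k. k \<noteq> 0) (proots (char_poly A)))"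

definition lam_max :: "real mat \<Rightarrow> real" where
  "lam_max A = Max {k. eigenvalue A k \<and> k \<noteq> 0}"

definition lam_min :: "real mat \<Rightarrow> real" where
  "lam_min A = Min {k. eigenvalue A k \<and> k \<noteq> 0}"

text \<open>If the logarithm below is negative, its \<^const>\<open>sqrt\<close> is negative too and does not contribute to
  the maximum, whose other two entries are positive.\<close>

definition teacher ::
  "real \<Rightarrow> nat \<Rightarrow> nat \<Rightarrow> nat \<Rightarrow> (nat \<Rightarrow> real) \<Rightarrow> (nat \<Rightarrow> nat \<Rightarrow> real) \<Rightarrow> real \<Rightarrow> real \<Rightarrow> bool" where
  "teacher C0 d n m \<pi>s \<mu>s Dmax Dmin \<longleftrightarrow>
     (let A = second_moment d m \<pi>s \<mu>s; \<pi>min = Min (\<pi>s ` {..<m}) in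
       1 \<le> d \<and> 1 \<le> n \<and> 1 \<le> m \<and> simplex_pos m \<pi>s \<and> (\<forall>l<m. \<mu>s l \<in> euclid {..<d}) \<and>
       num_nonzero_eigenvalues A = m \<and> 0 < lam_min A \<and>
       (\<forall>l<m. L2_set (\<mu>s l) {..<d} \<le> Dmax \<and> Dmin \<le> L2_set (\<mu>s l) {..<d}) \<and>
       4 * (lam_max A / lam_min A) * sqrt (real d * real n) \<le> Dmin \<and>
       (\<forall>i<m. \<forall>j<m. i \<noteq> j \<longrightarrow>
          C0 * Max {sqrt Dmax * (real d * real n) powr (1/4),
                    sqrt (real d / \<pi>min),
                    sqrt (ln (Dmax * real d * real n * real m / (lam_min A * \<pi>min)))}
          \<le> edist {..<d} (\<mu>s i) (\<mu>s j)))"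

section \<open>Students, spread, tube and core\<close>

definition partitions :: "nat \<Rightarrow> nat \<Rightarrow> (nat \<Rightarrow> nat set) \<Rightarrow> bool" where
  "partitions n m S \<longleftrightarrow>
     (\<Union>l<m. S l) = {..<n} \<and> disjoint_family_on S {..<m} \<and> (\<forall>l<m. S l \<noteq> {})"

definition cluster_mass :: "(nat \<Rightarrow> nat set) \<Rightarrow> (nat \<Rightarrow> real) \<Rightarrow> nat \<Rightarrow> real" where
  "cluster_mass S \<pi> l = (\<Sum>i\<in>S l. \<pi> i)"

definition mismatch :: "nat \<Rightarrow> (nat \<Rightarrow> nat set) \<Rightarrow> (nat \<Rightarrow> real) \<Rightarrow> (nat \<Rightarrow> real) \<Rightarrow> real" where
  "mismatch m S \<pi>s \<pi> = Max ((\<lambda>l. \<bar>cluster_mass S \<pi> l - \<pi>s l\<bar> / \<pi>s l) ` {..<m})"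

definition has_ref_weights ::
  "nat \<Rightarrow> (nat \<Rightarrow> nat set) \<Rightarrow> (nat \<Rightarrow> real) \<Rightarrow> (nat \<Rightarrow> real) \<Rightarrow> (nat \<Rightarrow> real) \<Rightarrow> bool" where
  "has_ref_weights m S \<pi>s \<pi> \<pi>bar \<longleftrightarrow>
     (\<forall>l<m. \<forall>i\<in>S l. \<pi> i * \<pi>s l / cluster_mass S \<pi> l = \<pi>bar i)"

definition cluster_mean ::
  "(nat \<Rightarrow> nat set) \<Rightarrow> (nat \<Rightarrow> real) \<Rightarrow> (nat \<times> nat \<Rightarrow> real) \<Rightarrow> nat \<Rightarrow> nat \<Rightarrow> real" where
  "cluster_mean S \<pi> \<mu> l k = (\<Sum>i\<in>S l. \<pi> i * \<mu> (i, k)) / cluster_mass S \<pi> l"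

definition spread ::
  "nat \<Rightarrow> nat \<Rightarrow> (nat \<Rightarrow> nat set) \<Rightarrow> (nat \<Rightarrow> real) \<Rightarrow> (nat \<times> nat \<Rightarrow> real) \<Rightarrow> real" where
  "spread d m S \<pi> \<mu> =
     (\<Sum>l<m. \<Sum>i\<in>S l. \<pi> i * (edist {..<d} (curry \<mu> i) (cluster_mean S \<pi> \<mu> l))\<^sup>2)"

text \<open>In \<open>tube\<close> and \<open>core\<close>, \<open>M\<close> is the ravine and \<open>D\<close> the spread.\<close>

definition tube ::
  "'i set \<Rightarrow> ('i \<Rightarrow> real) set \<Rightarrow> (('i \<Rightarrow> real) \<Rightarrow> real) \<Rightarrow> real \<Rightarrow> ('i \<Rightarrow> real) set" where
  "tube I M D \<tau> = {x \<in> euclid I. dist_to I M x \<le> \<tau> * D (nearest I M x) powr (3/2)}"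

definition core ::
  "'i set \<Rightarrow> ('i \<Rightarrow> real) set \<Rightarrow> (('i \<Rightarrow> real) \<Rightarrow> real) \<Rightarrow> real \<Rightarrow> real \<Rightarrow> ('i \<Rightarrow> real) set" where
  "core I M D \<kappa> \<Delta> = {x \<in> euclid I. D (nearest I M x) \<le> \<kappa> * \<Delta> powr (2/3)}"

end

theory Submission
  imports Defs "HOL-Probability.Probability"
begin

text \<open>
  Write \<open>z = x - x0\<close> for the displacement from the exact fit \<open>x0\<close>, at which the reference loss \<open>f\<close> vanishes,
  and split it along the kernel and the range of the Hessian \<open>H\<close> as \<open>z = v + u\<close>. Since \<open>f \<ge> 0\<close>, along a
  parabola \<open>s \<mapsto> x0 + s v + s\<^sup>2 u\<close> the Taylor expansion of \<open>f\<close> starts with \<open>s\<^sup>4\<close>, so that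
  \<open>\<langle>\<nabla>f, v + 2 u\<rangle> = 4 f + O(s\<^sup>5)\<close> there. Testing the Kullback-Leibler divergence against a bounded function whose
  Gaussian smoothing has strict minima at the teacher means gives \<open>f \<ge> c |z|\<^sup>4\<close>. In the tube \<open>|u| = O(|z|\<^sup>2)\<close> and
  \<open>|\<nabla>f| = O(|z|\<^sup>3)\<close>, hence the Polyak step contracts \<open>|z|\<^sup>2\<close> by a fixed factor, while \<open>f\<close> after the step is at most
  a small multiple of \<open>|z|\<^sup>2\<close>. Everywhere near \<open>x0\<close> one has \<open>\<langle>\<nabla>f, z\<rangle> + A |\<nabla>f|\<^sup>2 \<ge> c |z|\<^sup>4\<close>; together with the descent
  lemma this makes \<open>|z|\<^sup>2 + 16 A f\<close> a Lyapunov function of gradient descent with small steps. Outside the core the weight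
  mismatch is at most \<open>\<epsilon> |z|\<^sup>3\<close>, so it perturbs both estimates by lower order terms.
\<close>

section \<open>Vectors over a finite index set\<close>

text \<open>The obstacle is that the Hessian at \<open>x0\<close> may be degenerate, so that no
  linearisation controls the dynamics, and that the iterates between the Polyak step and time
  \<open>K\<close> lie off the tube. There the distance to \<open>x0\<close> alone need not
  decrease, because \<langle>\<nabla>f, z\<rangle> can be negative. Its deficit is at most A
  |\<nabla>f|^2, the order at which gradient descent lowers f, and this is why a multiple of f joins
  the Lyapunov function. The price is that f must be small against |z|^2 directly after the Polyak
  step. The size of that step is of order |z|^-2, so a range component of \<nabla>f of order
  \<epsilon> |z|^3 pushes the point by order \<epsilon> |z| in range directions and creates a loss
  of order \<epsilon>^2 |z|^2, up to cubic terms; small \<tau> and large \<kappa> make this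
  affordable. The ravine enters as the set where the gradient lies in the kernel of
  \<open>H\<close>, with nearest points supplied by compactness. Parabolas give kernel directions
  weight one and range directions weight two, the scaling under which f is quartic. The exponent
  four in the growth bound is the square of a quadratic gap between two expectations of the test
  function.\<close>

definition ip :: "'i set \<Rightarrow> ('i \<Rightarrow> real) \<Rightarrow> ('i \<Rightarrow> real) \<Rightarrow> real" where
  "ip I x y = (\<Sum>i\<in>I. x i * y i)"

lemma ip_commute: "ip I x y = ip I y x"
  by (simp add: ip_def mult.commute)

lemma ip_add_left: "ip I (\<lambda>i. x i + y i) z = ip I x z + ip I y z"
  by (simp add: ip_def distrib_right sum.distrib)

lemma ip_diff_left: "ip I (\<lambda>i. x i - y i) z = ip I x z - ip I y z"
  by (simp add: ip_def left_diff_distrib sum_subtractf)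

lemma ip_scale_left: "ip I (\<lambda>i. c * x i) z = c * ip I x z"
  by (simp add: ip_def sum_distrib_left mult.assoc)

lemma ip_add_right: "ip I z (\<lambda>i. x i + y i) = ip I z x + ip I z y"
  by (simp add: ip_def distrib_left sum.distrib)

lemma ip_diff_right: "ip I z (\<lambda>i. x i - y i) = ip I z x - ip I z y"
  by (simp add: ip_def right_diff_distrib sum_subtractf)

lemma ip_scale_right: "ip I z (\<lambda>i. c * x i) = c * ip I z x"
  by (metis ip_commute ip_scale_left)

lemma ip_cong: "(\<And>i. i \<in> I \<Longrightarrow> x i = x' i) \<Longrightarrow> (\<And>i. i \<in> I \<Longrightarrow> y i = y' i) \<Longrightarrow> ip I x y = ip I x' y'"
  by (simp add: ip_def)

lemmas ip_linear = ip_add_left ip_diff_left ip_scale_left ip_add_right ip_diff_right ip_scale_right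

lemma ip_self: "ip I x x = (L2_set x I)\<^sup>2"
  by (simp add: ip_def L2_set_def power2_eq_square[symmetric] sum_nonneg)

lemma abs_ip_le: "\<bar>ip I x y\<bar> \<le> L2_set x I * L2_set y I"
proof -
  have "\<bar>ip I x y\<bar> \<le> (\<Sum>i\<in>I. \<bar>x i\<bar> * \<bar>y i\<bar>)"
    unfolding ip_def by (rule order_trans[OF sum_abs]) (simp add: abs_mult)
  then show ?thesis using L2_set_mult_ineq[of x y I] by linarith
qed

lemma L2_set_scale: "L2_set (\<lambda>i. c * x i) I = \<bar>c\<bar> * L2_set x I"
  by (simp add: L2_set_def power_mult_distrib sum_distrib_left[symmetric] real_sqrt_mult)

lemma L2_set_minus: "L2_set (\<lambda>i. - x i) I = L2_set x I"
  by (simp add: L2_set_def)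

lemma L2_set_diff_le: "L2_set (\<lambda>i. x i - y i) I \<le> L2_set x I + L2_set y I"
  using L2_set_triangle_ineq[of x "\<lambda>i. - y i" I] by (simp add: L2_set_minus)

lemma L2_set_diff_commute: "L2_set (\<lambda>i. x i - y i) I = L2_set (\<lambda>i. y i - x i) I"
  by (simp add: L2_set_def power2_commute)

lemma L2_set_diff_triangle:
  "L2_set (\<lambda>i. x i - z i) I \<le> L2_set (\<lambda>i. x i - y i) I + L2_set (\<lambda>i. y i - z i) I"
  using L2_set_triangle_ineq[of "\<lambda>i. x i - y i" "\<lambda>i. y i - z i" I] by simp

lemma L2_set_orth:
  assumes "ip I v u = 0"
  shows "(L2_set (\<lambda>i. v i + u i) I)\<^sup>2 = (L2_set v I)\<^sup>2 + (L2_set u I)\<^sup>2"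
  using assms ip_commute[of I u v] by (simp add: ip_self[symmetric] ip_linear)

text \<open>Gram-Schmidt that tolerates linear dependence: remove from \<open>x\<close> and from the
  new vector their projections onto the old ones, then remove from the first residual its component
  along the second. Applied to the columns of the Hessian it yields the splitting into kernel and
  range.\<close>

lemma projection_coefficients:
  fixes a :: "'j \<Rightarrow> 'i \<Rightarrow> real"
  assumes "finite J"
  shows "\<exists>c. \<forall>j\<in>J. ip I (\<lambda>i. x i - (\<Sum>k\<in>J. c k * a k i)) (a j) = 0"
  using assms
proof (induction J arbitrary: x rule: finite_induct)
  case empty
  then show ?case by simp
next
  case (insert j0 J)
  obtain c1 where c1: "\<forall>j\<in>J. ip I (\<lambda>i. x i - (\<Sum>k\<in>J. c1 k * a k i)) (a j) = 0"
    using insert.IH[of x] by auto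
  obtain c2 where c2: "\<forall>j\<in>J. ip I (\<lambda>i. a j0 i - (\<Sum>k\<in>J. c2 k * a k i)) (a j) = 0"
    using insert.IH[of "a j0"] by auto
  define X where "X = (\<lambda>i. x i - (\<Sum>k\<in>J. c1 k * a k i))"
  define Y where "Y = (\<lambda>i. a j0 i - (\<Sum>k\<in>J. c2 k * a k i))"
  \<comment> \<open>If \<open>ip I Y Y = 0\<close> the quotient is 0, which is harmless because
    \<open>Y\<close> is then orthogonal to everything.\<close>
  define t where "t = ip I X Y / ip I Y Y"
  define c where "c = (\<lambda>k. if k = j0 then t else c1 k - t * c2 k)"
  have eq: "x i - (\<Sum>k\<in>insert j0 J. c k * a k i) = X i - t * Y i" for i
  proof -
    have "(\<Sum>k\<in>insert j0 J. c k * a k i) = t * a j0 i + (\<Sum>k\<in>J. c k * a k i)"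
      using insert.hyps by (simp add: c_def)
    also have "(\<Sum>k\<in>J. c k * a k i) = (\<Sum>k\<in>J. c1 k * a k i - t * (c2 k * a k i))"
      using insert.hyps by (intro sum.cong) (auto simp: c_def algebra_simps)
    finally show ?thesis
      by (simp add: X_def Y_def sum_subtractf sum_distrib_left algebra_simps)
  qed
  have XJ: "ip I X (a j) = 0" and YJ: "ip I Y (a j) = 0" if "j \<in> J" for j
    using c1 c2 that by (auto simp: X_def Y_def)
  have XY: "ip I (\<lambda>i. X i - t * Y i) Y = 0"
  proof (cases "ip I Y Y = 0")
    case True
    then have "L2_set Y I = 0" by (simp add: ip_self)
    then have "ip I X Y = 0" using abs_ip_le[of I X Y] by simp
    then show ?thesis using True by (simp add: ip_linear)
  next
    case False
    then show ?thesis by (simp only: ip_diff_left ip_scale_left) (simp add: t_def)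
  qed
  have dec: "ip I Z (a j0) = ip I Z Y + (\<Sum>k\<in>J. c2 k * ip I Z (a k))" for Z
  proof -
    have "a j0 i = Y i + (\<Sum>k\<in>J. c2 k * a k i)" for i by (simp add: Y_def)
    then have "ip I Z (a j0) = ip I Z (\<lambda>i. Y i + (\<Sum>k\<in>J. c2 k * a k i))"
      by (intro ip_cong) auto
    also have "\<dots> = ip I Z Y + ip I Z (\<lambda>i. \<Sum>k\<in>J. c2 k * a k i)" by (simp add: ip_linear)
    also have "ip I Z (\<lambda>i. \<Sum>k\<in>J. c2 k * a k i) = (\<Sum>k\<in>J. c2 k * ip I Z (a k))"
      unfolding ip_def sum_distrib_left by (subst sum.swap) (simp add: algebra_simps)
    finally show ?thesis .
  qed
  have "ip I (\<lambda>i. X i - t * Y i) (a j) = 0" if "j \<in> insert j0 J" for j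
  proof -
    have J: "ip I (\<lambda>i. X i - t * Y i) (a j) = 0" if "j \<in> J" for j
      using XJ[OF that] YJ[OF that] by (simp add: ip_linear)
    with that XY show ?thesis by (auto simp: dec)
  qed
  then show ?case by (intro exI[of _ c]) (simp add: eq)
qed

section \<open>Taylor expansions with bounded derivatives\<close>

text \<open>The derivatives are carried as a family with one common bound, so that Taylor remainders
  are uniform over all curves sharing \<open>C\<close>. Differentiability is two-sided also at the
  endpoints of [-1, 1].\<close>

definition tower :: "real \<Rightarrow> nat \<Rightarrow> (nat \<Rightarrow> real \<Rightarrow> real) \<Rightarrow> bool" where
  "tower C n D \<longleftrightarrow>
     (\<forall>k<n. \<forall>s. \<bar>s\<bar> \<le> 1 \<longrightarrow> (D k has_real_derivative D (Suc k) s) (at s)) \<and>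
     (\<forall>k\<le>n. \<forall>s. \<bar>s\<bar> \<le> 1 \<longrightarrow> \<bar>D k s\<bar> \<le> C)"

lemma tower_taylor:
  assumes "tower C n D" "j + k \<le> n" "\<bar>s\<bar> \<le> 1"
  obtains t where "\<bar>t\<bar> \<le> 1" "D j s = (\<Sum>m<k. D (j + m) 0 / fact m * s ^ m) + D (j + k) t / fact k * s ^ k"
proof -
  have "\<exists>t. \<bar>t\<bar> \<le> \<bar>s\<bar> \<and> D j s = (\<Sum>m<k. D (j + m) 0 / fact m * s ^ m) + D (j + k) t / fact k * s ^ k"
    using assms by (intro Maclaurin_bi_le[where diff = "\<lambda>m. D (j + m)"]) (auto simp: tower_def)
  with that assms(3) show ?thesis by (meson order_trans)
qed

text \<open>A cubic term changes sign at 0 and dominates the quartic remainder, so nonnegativity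
  forces its coefficient to vanish. What remains is homogeneous of degree four up to order five, and
  Euler's identity for such a function gives the second claim.\<close>

lemma nonneg_tower_quartic:
  assumes T: "tower C 5 D" and pos: "\<And>s. \<bar>s\<bar> \<le> 1 \<Longrightarrow> 0 \<le> D 0 s"
    and z: "D 0 0 = 0" "D 1 0 = 0" "D 2 0 = 0" and s: "\<bar>s\<bar> \<le> 1"
  shows "D 0 s \<le> C * s ^ 4" "\<bar>s * D 1 s - 4 * D 0 s\<bar> \<le> C * \<bar>s\<bar> ^ 5"
proof -
  have b: "\<bar>D k t\<bar> \<le> C" if "k \<le> 5" "\<bar>t\<bar> \<le> 1" for k t
    using T that by (auto simp: tower_def)
  have C0: "0 \<le> C" using b[of 0 0] by auto
  have t4: "\<exists>t. \<bar>t\<bar> \<le> 1 \<and> D 0 s = D 3 0 / 6 * s ^ 3 + D 4 t / 24 * s ^ 4" if s: "\<bar>s\<bar> \<le> 1" for s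
  proof -
    obtain t where t: "\<bar>t\<bar> \<le> 1" "D 0 s = (\<Sum>m<4. D (0 + m) 0 / fact m * s ^ m) + D (0 + 4) t / fact 4 * s ^ 4"
      by (rule tower_taylor[of C 5 D 0 4 s]) (use T s in auto)
    then show ?thesis using z by (auto simp: eval_nat_numeral fact_numeral)
  qed
  have D3: "D 3 0 = 0"
  proof (rule ccontr)
    assume n: "D 3 0 \<noteq> 0"
    define a where "a = \<bar>D 3 0\<bar> / 6"
    have a: "0 < a" using n by (simp add: a_def)
    \<comment> \<open>Small enough that \<open>C * t < a\<close>: with its sign chosen negative, the
      cubic term then beats the quartic remainder.\<close>
    define t where "t = min 1 (a / (C + 1))"
    have t: "0 < t" "t \<le> 1" "t \<le> a / (C + 1)"
      using a C0 by (auto simp: t_def)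
    then have tC: "t * (C + 1) \<le> a" using C0 by (simp add: pos_le_divide_eq)
    define s where "s = - sgn (D 3 0) * t"
    have s: "\<bar>s\<bar> \<le> 1" using t by (simp add: s_def abs_mult abs_sgn_eq)
    obtain v where v: "\<bar>v\<bar> \<le> 1" "D 0 s = D 3 0 / 6 * s ^ 3 + D 4 v / 24 * s ^ 4"
      using t4[OF s] by auto
    have e1: "D 3 0 / 6 * s ^ 3 = - a * t ^ 3"
      using n by (simp add: s_def a_def power_mult_distrib sgn_if)
    have e2: "s ^ 4 = t ^ 4" using n by (simp add: s_def power_mult_distrib sgn_if)
    have "D 4 v / 24 * t ^ 4 \<le> C * t ^ 4"
      using b[of 4 v] v t C0 by (intro mult_right_mono) auto
    then have "0 \<le> - a * t ^ 3 + C * t ^ 4" using pos[OF s] v(2) unfolding e1 e2 by linarith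
    then have "a * t ^ 3 \<le> (C * t) * t ^ 3" by (simp add: eval_nat_numeral algebra_simps)
    then have "a \<le> C * t" using t by simp
    then show False using t tC by (simp add: algebra_simps)
  qed
  obtain t where t: "\<bar>t\<bar> \<le> 1" "D 0 s = D 4 t / 24 * s ^ 4" using t4[OF s] D3 by auto
  have "D 4 t / 24 * s ^ 4 \<le> C * s ^ 4"
    using b[of 4 t] t C0 by (intro mult_right_mono) auto
  then show "D 0 s \<le> C * s ^ 4" using t by simp
  obtain t0 where t0: "\<bar>t0\<bar> \<le> 1" "D 0 s = (\<Sum>m<5. D (0 + m) 0 / fact m * s ^ m) + D (0 + 5) t0 / fact 5 * s ^ 5"
    by (rule tower_taylor[of C 5 D 0 5 s]) (use T s in auto)
  obtain t1 where t1: "\<bar>t1\<bar> \<le> 1" "D 1 s = (\<Sum>m<4. D (1 + m) 0 / fact m * s ^ m) + D (1 + 4) t1 / fact 4 * s ^ 4"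
    by (rule tower_taylor[of C 5 D 1 4 s]) (use T s in auto)
  have e0: "D 0 s = D 4 0 / 24 * s ^ 4 + D 5 t0 / 120 * s ^ 5"
    using t0 z D3 by (simp add: eval_nat_numeral fact_numeral)
  have e1: "D 1 s = D 4 0 / 6 * s ^ 3 + D 5 t1 / 24 * s ^ 4"
    using t1 z D3 by (simp add: eval_nat_numeral fact_numeral)
  \<comment> \<open>The contributions of \<open>D 4 0\<close>, with coefficients 1/6 and 4/24,
    cancel; only fifth derivatives survive.\<close>
  have "s * D 1 s - 4 * D 0 s = (D 5 t1 / 24 - D 5 t0 / 30) * s ^ 5"
    unfolding e0 e1 by (simp add: algebra_simps eval_nat_numeral)
  moreover have "\<bar>D 5 t1 / 24 - D 5 t0 / 30\<bar> \<le> C"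
    using b[of 5 t1] b[of 5 t0] t0 t1 C0 by (auto simp: abs_le_iff)
  ultimately show "\<bar>s * D 1 s - 4 * D 0 s\<bar> \<le> C * \<bar>s\<bar> ^ 5"
    by (simp add: abs_mult power_abs[symmetric] mult_right_mono)
qed

text \<open>The stencil \<open>8 (D(s/2) - D(-s/2)) - (D(s) - D(-s)) = 6 s D'(0)\<close> is exact on cubics.\<close>

lemma tower_stencil:
  assumes T: "tower C 5 D" and s: "0 < s" "s \<le> 1"
    and K: "\<And>h. \<bar>h\<bar> \<le> s \<Longrightarrow> \<bar>D 0 h\<bar> \<le> K"
  shows "\<bar>D 1 0\<bar> * s \<le> 3 * K + C * s ^ 4"
proof -
  have b: "\<bar>D k t\<bar> \<le> C" if "k \<le> 5" "\<bar>t\<bar> \<le> 1" for k t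
    using T that by (auto simp: tower_def)
  have t4: "\<exists>t. \<bar>t\<bar> \<le> C \<and> D 0 h = D 0 0 + D 1 0 * h + D 2 0 / 2 * h ^ 2 + D 3 0 / 6 * h ^ 3 + t / 24 * h ^ 4"
    if h: "\<bar>h\<bar> \<le> 1" for h
  proof -
    obtain t where t: "\<bar>t\<bar> \<le> 1" "D 0 h = (\<Sum>m<4. D (0 + m) 0 / fact m * h ^ m) + D (0 + 4) t / fact 4 * h ^ 4"
      by (rule tower_taylor[of C 5 D 0 4 h]) (use T h in auto)
    have "D 0 h = D 0 0 + D 1 0 * h + D 2 0 / 2 * h ^ 2 + D 3 0 / 6 * h ^ 3 + D 4 t / 24 * h ^ 4"
      unfolding t(2) by (simp add: eval_nat_numeral fact_numeral)
    then show ?thesis using b[of 4 t] t by auto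
  qed
  obtain a where a: "\<bar>a\<bar> \<le> C" "D 0 s = D 0 0 + D 1 0 * s + D 2 0 / 2 * s ^ 2 + D 3 0 / 6 * s ^ 3 + a / 24 * s ^ 4"
    using t4[of s] s by auto
  obtain b where b': "\<bar>b\<bar> \<le> C" "D 0 (-s) = D 0 0 + D 1 0 * (-s) + D 2 0 / 2 * (-s) ^ 2 + D 3 0 / 6 * (-s) ^ 3 + b / 24 * (-s) ^ 4"
    using t4[of "-s"] s by auto
  obtain c where c: "\<bar>c\<bar> \<le> C" "D 0 (s/2) = D 0 0 + D 1 0 * (s/2) + D 2 0 / 2 * (s/2) ^ 2 + D 3 0 / 6 * (s/2) ^ 3 + c / 24 * (s/2) ^ 4"
    using t4[of "s/2"] s by auto
  obtain d where d: "\<bar>d\<bar> \<le> C" "D 0 (-(s/2)) = D 0 0 + D 1 0 * (-(s/2)) + D 2 0 / 2 * (-(s/2)) ^ 2 + D 3 0 / 6 * (-(s/2)) ^ 3 + d / 24 * (-(s/2)) ^ 4"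
    using t4[of "-(s/2)"] s by auto
  define E where "E = ((c - d) / 48 - (a - b) / 24) * s ^ 4"
  have "8 * (D 0 (s/2) - D 0 (-(s/2))) - (D 0 s - D 0 (-s)) = 6 * (D 1 0 * s) + E"
    unfolding E_def a(2) b'(2) c(2) d(2) by (simp add: field_simps)
  moreover have "\<bar>E\<bar> \<le> C * s ^ 4"
      proof -
    have "\<bar>(c - d) / 48 - (a - b) / 24\<bar> \<le> C" using a(1) b'(1) c(1) d(1) unfolding abs_le_iff by (simp add: field_simps)
    then show ?thesis unfolding E_def abs_mult using s by (simp add: mult_right_mono)
  qed
  moreover have "\<bar>D 0 (s/2)\<bar> \<le> K" "\<bar>D 0 (-(s/2))\<bar> \<le> K" "\<bar>D 0 s\<bar> \<le> K" "\<bar>D 0 (-s)\<bar> \<le> K"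
    using s by (auto intro!: K)
  ultimately have "\<bar>6 * (D 1 0 * s)\<bar> \<le> 18 * K + C * s ^ 4" by (smt (verit))
  then have "6 * \<bar>D 1 0 * s\<bar> \<le> 18 * K + C * s ^ 4" by (simp add: abs_mult)
  moreover have "0 \<le> C * s ^ 4" using a(1) s by (intro mult_nonneg_nonneg) auto
  ultimately show ?thesis using s by (simp add: abs_mult)
qed

section \<open>Degenerate minima\<close>

text \<open>\<open>G\<close> stands for the gradient of \<open>f\<close> and \<open>H\<close> for
  its Hessian at \<open>x0\<close>. In \<open>curves\<close> the constant depends on
  \<open>R\<close> alone, which makes all later estimates uniform, and \<open>D 2 0\<close> is
  prescribed at \<open>x0\<close>, where its vanishing decides that an expansion starts at order
  four. \<open>growth\<close> makes the minimum strict whatever the kernel of \<open>H\<close>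
  is.\<close>

locale smooth_min =
  fixes I :: "'i set" and f :: "('i \<Rightarrow> real) \<Rightarrow> real" and x0 :: "'i \<Rightarrow> real"
    and G :: "('i \<Rightarrow> real) \<Rightarrow> 'i \<Rightarrow> real" and H :: "'i \<Rightarrow> 'i \<Rightarrow> real"
  assumes fin: "finite I"
    and nonneg: "0 \<le> f x"
    and f0: "f x0 = 0"
    and H_sym: "p \<in> I \<Longrightarrow> q \<in> I \<Longrightarrow> H p q = H q p"
    and curves: "\<exists>C>0. \<forall>c a b. L2_set (\<lambda>p. c p - x0 p) I \<le> R \<longrightarrow> L2_set a I \<le> R \<longrightarrow> L2_set b I \<le> R \<longrightarrow>
      (\<exists>D. tower C 5 D \<and> D 0 = (\<lambda>s. f (\<lambda>p. c p + s * a p + s\<^sup>2 * b p)) \<and>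
        D 1 = (\<lambda>s. ip I (\<lambda>p. a p + 2 * s * b p) (G (\<lambda>p. c p + s * a p + s\<^sup>2 * b p))) \<and>
        (c = x0 \<longrightarrow> D 2 0 = ip I a (\<lambda>p. \<Sum>q\<in>I. H p q * a q) + 2 * ip I b (G x0)))"
    and G_lip: "\<exists>C>0. \<forall>x y. L2_set (\<lambda>p. x p - x0 p) I \<le> 1 \<longrightarrow> L2_set (\<lambda>p. y p - x0 p) I \<le> 1 \<longrightarrow>
      L2_set (\<lambda>p. G x p - G y p) I \<le> C * L2_set (\<lambda>p. x p - y p) I"
    and G_taylor: "\<exists>C>0. \<forall>z. L2_set z I \<le> 1 \<longrightarrow>
      L2_set (\<lambda>p. G (\<lambda>p. x0 p + z p) p - (\<Sum>q\<in>I. H p q * z q)) I \<le> C * (L2_set z I)\<^sup>2"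
    and growth: "\<exists>c>0. \<exists>\<rho>>0. \<forall>z. L2_set z I \<le> \<rho> \<longrightarrow> c * L2_set z I ^ 4 \<le> f (\<lambda>p. x0 p + z p)"
begin

section \<open>Kernel and range of the Hessian\<close>

abbreviation N :: "('i \<Rightarrow> real) \<Rightarrow> real" where "N x \<equiv> L2_set x I"

definition Hm :: "('i \<Rightarrow> real) \<Rightarrow> 'i \<Rightarrow> real" where
  "Hm a = (\<lambda>p. \<Sum>q\<in>I. H p q * a q)"

text \<open>Like \<open>ran\<close>, this inspects coordinates in \<open>I\<close> only, so
  arbitrary functions serve as vectors and no restriction has to be carried along.\<close>

definition ker :: "('i \<Rightarrow> real) \<Rightarrow> bool" where
  "ker v \<longleftrightarrow> (\<forall>p\<in>I. Hm v p = 0)"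

definition ran :: "('i \<Rightarrow> real) \<Rightarrow> bool" where
  "ran u \<longleftrightarrow> (\<exists>\<xi>. \<forall>p\<in>I. u p = Hm \<xi> p)"

lemma Hm_add: "Hm (\<lambda>p. a p + b p) p = Hm a p + Hm b p"
  by (simp add: Hm_def distrib_left sum.distrib)

lemma Hm_scale: "Hm (\<lambda>p. c * a p) p = c * Hm a p"
  by (simp add: Hm_def sum_distrib_left algebra_simps)

lemma Hm_cong: "(\<And>p. p \<in> I \<Longrightarrow> a p = b p) \<Longrightarrow> Hm a = Hm b"
  by (simp add: Hm_def)

lemma Hm_sym: "ip I a (Hm b) = ip I b (Hm a)"
proof -
  have "ip I a (Hm b) = (\<Sum>p\<in>I. \<Sum>q\<in>I. a p * (H p q * b q))"
    by (simp add: ip_def Hm_def sum_distrib_left)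
  also have "\<dots> = (\<Sum>q\<in>I. \<Sum>p\<in>I. a p * (H p q * b q))" by (rule sum.swap)
  also have "\<dots> = (\<Sum>q\<in>I. \<Sum>p\<in>I. b q * (H q p * a p))"
    by (intro sum.cong refl) (simp add: H_sym)
  finally show ?thesis by (simp add: ip_def Hm_def sum_distrib_left)
qed

lemma ker_add: "ker a \<Longrightarrow> ker b \<Longrightarrow> ker (\<lambda>p. a p + b p)"
  by (simp add: ker_def Hm_add)

lemma ker_scale: "ker a \<Longrightarrow> ker (\<lambda>p. c * a p)"
  by (simp add: ker_def Hm_scale)

lemma ran_add: "ran a \<Longrightarrow> ran b \<Longrightarrow> ran (\<lambda>p. a p + b p)"
  unfolding ran_def by (metis Hm_add)

lemma ran_scale: "ran a \<Longrightarrow> ran (\<lambda>p. c * a p)"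
  unfolding ran_def by (metis Hm_scale)

lemma ran_Hm: "ran (Hm a)"
  by (auto simp: ran_def)

lemma ker_ran: assumes "ker v" "ran u" shows "ip I v u = 0"
proof -
  obtain \<xi> where "\<forall>p\<in>I. u p = Hm \<xi> p" using assms by (auto simp: ran_def)
  then have "ip I v u = ip I v (Hm \<xi>)" by (intro ip_cong) auto
  also have "\<dots> = ip I \<xi> (Hm v)" by (rule Hm_sym)
  also have "\<dots> = 0" using assms by (simp add: ker_def ip_def)
  finally show ?thesis .
qed

text \<open>The residual of the projection of \<open>z\<close> onto the columns of \<open>H\<close>
  is orthogonal to every column, and since \<open>H\<close> is symmetric this says that the residual
  lies in the kernel.\<close>

lemma decomp:
  obtains v u where "ker v" "ran u" "\<And>p. z p = v p + u p"
proof -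
  obtain c where c: "\<forall>j\<in>I. ip I (\<lambda>i. z i - (\<Sum>k\<in>I. c k * H i k)) (\<lambda>i. H i j) = 0"
    using projection_coefficients[OF fin, of I z "\<lambda>k i. H i k"] by auto
  define v where "v = (\<lambda>i. z i - (\<Sum>k\<in>I. c k * H i k))"
  have "Hm v j = ip I v (\<lambda>i. H i j)" if "j \<in> I" for j
    unfolding Hm_def ip_def by (intro sum.cong refl) (simp add: H_sym that mult.commute)
  then have "ker v" using c by (auto simp: ker_def v_def)
  moreover have "ran (Hm c)" by (rule ran_Hm)
  moreover have "z p = v p + Hm c p" for p
    by (simp add: v_def Hm_def mult.commute)
  ultimately show ?thesis using that by blast
qed

lemma decomp_norm:
  assumes "ker v" "ran u" "\<And>p. p \<in> I \<Longrightarrow> z p = v p + u p"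
  shows "(N z)\<^sup>2 = (N v)\<^sup>2 + (N u)\<^sup>2" "N v \<le> N z" "N u \<le> N z" "N z \<le> N v + N u"
proof -
  have z: "N z = N (\<lambda>p. v p + u p)" using assms(3) by (intro L2_set_cong) auto
  show *: "(N z)\<^sup>2 = (N v)\<^sup>2 + (N u)\<^sup>2"
    unfolding z by (rule L2_set_orth) (rule ker_ran[OF assms(1,2)])
  show "N v \<le> N z" by (rule power2_le_imp_le) (use * in \<open>auto simp: L2_set_nonneg\<close>)
  show "N u \<le> N z" by (rule power2_le_imp_le) (use * in \<open>auto simp: L2_set_nonneg\<close>)
  show "N z \<le> N v + N u" unfolding z by (rule L2_set_triangle_ineq)
qed

lemma Hm_decomp:
  assumes "ker v" "\<And>p. p \<in> I \<Longrightarrow> z p = v p + u p" "p \<in> I"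
  shows "Hm z p = Hm u p"
proof -
  have "Hm z p = Hm (\<lambda>p. v p + u p) p" by (simp add: Hm_cong[of z "\<lambda>p. v p + u p"] assms(2))
  then show ?thesis using assms by (simp add: Hm_add ker_def)
qed

text \<open>Each unit vector splits as \<open>e\<^sub>p = v\<^sub>p + H \<xi>\<^sub>p\<close> with \<open>v\<^sub>p\<close> in the kernel; hence
  \<open>u\<^sub>p = \<langle>H u, \<xi>\<^sub>p\<rangle>\<close> on the range, which replaces a spectral argument.\<close>

lemma gap: "\<exists>l>0. \<forall>u. ran u \<longrightarrow> l * N u \<le> N (Hm u)"
proof -
  have "\<exists>\<xi>. \<forall>u. ran u \<longrightarrow> u p = ip I (Hm u) \<xi>" if p: "p \<in> I" for p
  proof -
    obtain v w where vw: "ker v" "ran w" "\<And>q. (if q = p then 1 else 0::real) = v q + w q"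
      using decomp[of "\<lambda>q. if q = p then 1 else 0"] by blast
    obtain \<xi> where \<xi>: "\<forall>q\<in>I. w q = Hm \<xi> q" using vw by (auto simp: ran_def)
    have "u p = ip I (Hm u) \<xi>" if u: "ran u" for u
    proof -
      have "u p = ip I (\<lambda>q. if q = p then 1 else 0) u"
        using p fin by (simp add: ip_def if_distrib if_distribR cong: if_cong)
      also have "\<dots> = ip I (\<lambda>q. v q + w q) u" by (simp add: vw(3))
      also have "\<dots> = ip I w u" using ker_ran[OF vw(1) u] by (simp add: ip_linear)
      also have "\<dots> = ip I u (Hm \<xi>)" using \<xi> by (subst ip_commute) (rule ip_cong, auto)
      also have "\<dots> = ip I (Hm u) \<xi>" using Hm_sym[of u \<xi>] by (simp add: ip_commute)
      finally show ?thesis .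
    qed
    then show ?thesis by blast
  qed
  then obtain \<xi> where \<xi>: "\<And>p u. p \<in> I \<Longrightarrow> ran u \<Longrightarrow> u p = ip I (Hm u) (\<xi> p)" by metis
  define K where "K = 1 + (\<Sum>p\<in>I. N (\<xi> p))"
  have K: "0 < K" using sum_nonneg[of I "\<lambda>p. N (\<xi> p)"] by (simp add: K_def L2_set_nonneg add_pos_nonneg)
  have "N u \<le> K * N (Hm u)" if u: "ran u" for u
  proof -
    have "N u \<le> (\<Sum>p\<in>I. \<bar>u p\<bar>)" by (rule L2_set_le_sum_abs)
    also have "\<dots> \<le> (\<Sum>p\<in>I. N (Hm u) * N (\<xi> p))"
      by (intro sum_mono) (simp add: \<xi>[OF _ u] abs_ip_le)
    also have "\<dots> \<le> K * N (Hm u)"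
      by (simp add: K_def sum_distrib_right sum_distrib_left algebra_simps L2_set_nonneg)
    finally show ?thesis .
  qed
  then show ?thesis using K by (intro exI[of _ "1 / K"]) (auto simp: field_simps)
qed

lemma Hm_bound: "\<exists>C>0. \<forall>u. \<bar>ip I u (Hm u)\<bar> \<le> C * (N u)\<^sup>2"
proof -
  define C where "C = 1 + (\<Sum>p\<in>I. \<Sum>q\<in>I. \<bar>H p q\<bar>)"
  have C: "0 < C" unfolding C_def by (intro add_pos_nonneg sum_nonneg) auto
  have "\<bar>ip I u (Hm u)\<bar> \<le> C * (N u)\<^sup>2" for u
  proof -
    have m: "\<bar>u p\<bar> \<le> N u" if "p \<in> I" for p
      using member_le_L2_set[OF fin that, of "\<lambda>p. \<bar>u p\<bar>"] by (simp add: L2_set_def)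
    have "\<bar>ip I u (Hm u)\<bar> \<le> (\<Sum>p\<in>I. \<Sum>q\<in>I. \<bar>u p * (H p q * u q)\<bar>)"
      unfolding ip_def Hm_def sum_distrib_left
      by (rule order_trans[OF sum_abs]) (intro sum_mono sum_abs)
    also have "\<dots> \<le> (\<Sum>p\<in>I. \<Sum>q\<in>I. \<bar>H p q\<bar> * (N u)\<^sup>2)"
    proof (intro sum_mono)
      fix p q assume pq: "p \<in> I" "q \<in> I"
      have "\<bar>u p * (H p q * u q)\<bar> = \<bar>H p q\<bar> * (\<bar>u p\<bar> * \<bar>u q\<bar>)" by (simp add: abs_mult)
      also have "\<dots> \<le> \<bar>H p q\<bar> * (N u * N u)"
        using m pq by (intro mult_left_mono mult_mono) (auto simp: L2_set_nonneg)
      finally show "\<bar>u p * (H p q * u q)\<bar> \<le> \<bar>H p q\<bar> * (N u)\<^sup>2" by (simp add: power2_eq_square)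
    qed
    also have "\<dots> = (C - 1) * (N u)\<^sup>2" by (simp add: C_def sum_distrib_right)
    finally show ?thesis by (simp add: algebra_simps) (smt (verit) zero_le_power2)
  qed
  then show ?thesis using C by blast
qed

section \<open>Expansions of f along lines and parabolas\<close>

lemma line_derivative:
  assumes "\<bar>s\<bar> \<le> 1"
  shows "((\<lambda>s. f (\<lambda>p. c p + s * a p)) has_real_derivative ip I a (G (\<lambda>p. c p + s * a p))) (at s)"
proof -
  define R where "R = N (\<lambda>p. c p - x0 p) + N a"
  have R: "N (\<lambda>p. c p - x0 p) \<le> R" "N a \<le> R" "N (\<lambda>p. 0) \<le> R"
    by (auto simp: R_def L2_set_nonneg L2_set_def sum_nonneg)
  obtain C where "\<forall>c a b. N (\<lambda>p. c p - x0 p) \<le> R \<longrightarrow> N a \<le> R \<longrightarrow> N b \<le> R \<longrightarrow>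
      (\<exists>D. tower C 5 D \<and> D 0 = (\<lambda>s. f (\<lambda>p. c p + s * a p + s\<^sup>2 * b p)) \<and>
        D 1 = (\<lambda>s. ip I (\<lambda>p. a p + 2 * s * b p) (G (\<lambda>p. c p + s * a p + s\<^sup>2 * b p))) \<and>
        (c = x0 \<longrightarrow> D 2 0 = ip I a (\<lambda>p. \<Sum>q\<in>I. H p q * a q) + 2 * ip I b (G x0)))"
    using curves[of R] by blast
  from this[rule_format, OF R]
  obtain D where D: "tower C 5 D" "D 0 = (\<lambda>s. f (\<lambda>p. c p + s * a p))"
    "D 1 = (\<lambda>s. ip I a (G (\<lambda>p. c p + s * a p)))" by auto
  have "(D 0 has_real_derivative D (Suc 0) s) (at s)" using D(1) assms by (auto simp: tower_def)
  then show ?thesis using D(2,3) by simp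
qed

lemma G0: "p \<in> I \<Longrightarrow> G x0 p = 0"
proof -
  have "ip I a (G x0) = 0" for a
  proof -
    have "((\<lambda>s. f (\<lambda>p. x0 p + s * a p)) has_real_derivative ip I a (G x0)) (at 0)"
      using line_derivative[of 0 x0 a] by simp
    then show ?thesis
      by (rule DERIV_local_min[where d = 1]) (auto simp: f0 nonneg)
  qed
  from this[of "G x0"] have "N (G x0) = 0" by (simp add: ip_self)
  then show "p \<in> I \<Longrightarrow> G x0 p = 0" using fin by (simp add: L2_set_eq_0_iff)
qed

text \<open>A velocity in the kernel annihilates the quadratic form in \<open>D 2 0\<close>, and the
  acceleration drops out because the gradient vanishes at \<open>x0\<close>; hence
  \<open>nonneg_tower_quartic\<close> applies. The vector paired with the gradient is
  \<open>s\<close> times the velocity of the parabola, the Euler field for the weights one and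
  two.\<close>

lemma parabola:
  "\<exists>C>0. \<forall>v u s. ker v \<longrightarrow> N v \<le> R \<longrightarrow> N u \<le> R \<longrightarrow> \<bar>s\<bar> \<le> 1 \<longrightarrow>
     f (\<lambda>p. x0 p + s * v p + s\<^sup>2 * u p) \<le> C * s ^ 4 \<and>
     \<bar>ip I (\<lambda>p. s * v p + 2 * s\<^sup>2 * u p) (G (\<lambda>p. x0 p + s * v p + s\<^sup>2 * u p))
       - 4 * f (\<lambda>p. x0 p + s * v p + s\<^sup>2 * u p)\<bar> \<le> C * \<bar>s\<bar> ^ 5"
proof -
  obtain C where C: "0 < C" "\<forall>c a b. N (\<lambda>p. c p - x0 p) \<le> R \<longrightarrow> N a \<le> R \<longrightarrow> N b \<le> R \<longrightarrow>
      (\<exists>D. tower C 5 D \<and> D 0 = (\<lambda>s. f (\<lambda>p. c p + s * a p + s\<^sup>2 * b p)) \<and>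
        D 1 = (\<lambda>s. ip I (\<lambda>p. a p + 2 * s * b p) (G (\<lambda>p. c p + s * a p + s\<^sup>2 * b p))) \<and>
        (c = x0 \<longrightarrow> D 2 0 = ip I a (\<lambda>p. \<Sum>q\<in>I. H p q * a q) + 2 * ip I b (G x0)))"
    using curves[of R] by blast
  show ?thesis
  proof (intro exI[of _ C] conjI allI impI C(1))
    fix v u s assume v: "ker v" "N v \<le> R" and u: "N u \<le> R" and s: "\<bar>s::real\<bar> \<le> 1"
    have "N (\<lambda>p. x0 p - x0 p) \<le> R" using v(2) order_trans[OF L2_set_nonneg[of v I]] by (simp add: L2_set_0')
    from C(2)[rule_format, OF this v(2) u]
    obtain D where D: "tower C 5 D" "D 0 = (\<lambda>s. f (\<lambda>p. x0 p + s * v p + s\<^sup>2 * u p))"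
        "D 1 = (\<lambda>s. ip I (\<lambda>p. v p + 2 * s * u p) (G (\<lambda>p. x0 p + s * v p + s\<^sup>2 * u p)))"
        "D 2 0 = ip I v (Hm v) + 2 * ip I u (G x0)" by (auto simp: Hm_def)
    have G00: "ip I a (G x0) = 0" for a by (simp add: ip_def G0)
    have "ip I v (Hm v) = 0" using v by (simp add: ip_def ker_def)
    then have z: "D 0 0 = 0" "D 1 0 = 0" "D 2 0 = 0" using D(2-4) f0 G00 by auto
    have "\<And>s. 0 \<le> D 0 s" using D(2) nonneg by simp
    from nonneg_tower_quartic[OF D(1) this z s]
    have *: "D 0 s \<le> C * s ^ 4" "\<bar>s * D 1 s - 4 * D 0 s\<bar> \<le> C * \<bar>s\<bar> ^ 5" by auto
    show "f (\<lambda>p. x0 p + s * v p + s\<^sup>2 * u p) \<le> C * s ^ 4" using *(1) D(2) by simp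
    have "s * D 1 s = ip I (\<lambda>p. s * (v p + 2 * s * u p)) (G (\<lambda>p. x0 p + s * v p + s\<^sup>2 * u p))"
      unfolding D(3) by (rule ip_scale_left[symmetric])
    also have "(\<lambda>p. s * (v p + 2 * s * u p)) = (\<lambda>p. s * v p + 2 * s\<^sup>2 * u p)"
      by (auto simp: algebra_simps power2_eq_square)
    finally show "\<bar>ip I (\<lambda>p. s * v p + 2 * s\<^sup>2 * u p) (G (\<lambda>p. x0 p + s * v p + s\<^sup>2 * u p))
       - 4 * f (\<lambda>p. x0 p + s * v p + s\<^sup>2 * u p)\<bar> \<le> C * \<bar>s\<bar> ^ 5"
      using *(2) D(2) by simp
  qed
qed

text \<open>A shift by \<open>h * k\<close> with |h| \<le> s keeps the point at scale
  \<open>s\<close>: it only replaces \<open>v\<close> by \<open>v + (h / s) * k\<close>. So f is of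
  order \<open>s ^ 4\<close> on this whole segment, and the stencil with step \<open>s\<close> turns
  this into a derivative of order \<open>s ^ 3\<close>.\<close>

lemma parabola_gradient:
  assumes R: "0 \<le> R"
  shows "\<exists>C>0. \<forall>v u k s. ker v \<longrightarrow> ker k \<longrightarrow> N v \<le> R \<longrightarrow> N u \<le> R \<longrightarrow> N k \<le> 1 \<longrightarrow> 0 < s \<longrightarrow> s \<le> 1 \<longrightarrow>
     \<bar>ip I k (G (\<lambda>p. x0 p + s * v p + s\<^sup>2 * u p))\<bar> \<le> C * s ^ 3"
proof -
  \<comment> \<open>\<open>R + 1\<close> leaves room for the shift of \<open>v\<close> by a kernel
    vector of norm at most one.\<close>
  obtain C1 where C1: "0 < C1" "\<forall>v u s. ker v \<longrightarrow> N v \<le> R + 1 \<longrightarrow> N u \<le> R + 1 \<longrightarrow> \<bar>s\<bar> \<le> 1 \<longrightarrow>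
     f (\<lambda>p. x0 p + s * v p + s\<^sup>2 * u p) \<le> C1 * s ^ 4"
    using parabola[of "R + 1"] by blast
  obtain C where C: "0 < C" "\<forall>c a b. N (\<lambda>p. c p - x0 p) \<le> 2 * R + 1 \<longrightarrow> N a \<le> 2 * R + 1 \<longrightarrow> N b \<le> 2 * R + 1 \<longrightarrow>
      (\<exists>D. tower C 5 D \<and> D 0 = (\<lambda>s. f (\<lambda>p. c p + s * a p + s\<^sup>2 * b p)) \<and>
        D 1 = (\<lambda>s. ip I (\<lambda>p. a p + 2 * s * b p) (G (\<lambda>p. c p + s * a p + s\<^sup>2 * b p))) \<and>
        (c = x0 \<longrightarrow> D 2 0 = ip I a (\<lambda>p. \<Sum>q\<in>I. H p q * a q) + 2 * ip I b (G x0)))"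
    using curves[of "2 * R + 1"] by blast
  show ?thesis
  proof (intro exI[of _ "3 * C1 + C"] conjI allI impI)
    show "0 < 3 * C1 + C" using C1 C by simp
    fix v u k and s :: real
    assume v: "ker v" "N v \<le> R" and k: "ker k" "N k \<le> 1" and u: "N u \<le> R" and s: "0 < s" "s \<le> 1"
    define x where "x = (\<lambda>p. x0 p + s * v p + s\<^sup>2 * u p)"
    have "N (\<lambda>p. x p - x0 p) = N (\<lambda>p. s * v p + s\<^sup>2 * u p)" by (simp add: x_def)
    also have "\<dots> \<le> N (\<lambda>p. s * v p) + N (\<lambda>p. s\<^sup>2 * u p)" by (rule L2_set_triangle_ineq)
    also have "\<dots> = s * N v + s\<^sup>2 * N u" using s by (simp add: L2_set_scale)
    also have "\<dots> \<le> 1 * R + 1 * R" using s v u R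
      by (intro add_mono mult_mono) (auto simp: power_le_one L2_set_nonneg)
    finally have x: "N (\<lambda>p. x p - x0 p) \<le> 2 * R + 1" by simp
    have "N k \<le> 2 * R + 1" "N (\<lambda>p. 0) \<le> 2 * R + 1" using k R by (auto simp: L2_set_0')
    from C(2)[rule_format, OF x this]
    obtain D where D: "tower C 5 D" "D 0 = (\<lambda>s. f (\<lambda>p. x p + s * k p))"
        "D 1 = (\<lambda>s. ip I k (G (\<lambda>p. x p + s * k p)))" by auto
    have "\<bar>D 0 h\<bar> \<le> C1 * s ^ 4" if h: "\<bar>h\<bar> \<le> s" for h
    proof -
      define w where "w = (\<lambda>p. v p + h / s * k p)"
      have w: "ker w" unfolding w_def by (intro ker_add ker_scale v k)
      have "N w \<le> N v + \<bar>h / s\<bar> * N k" unfolding w_def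
        by (rule order_trans[OF L2_set_triangle_ineq]) (simp only: L2_set_scale order_refl)
      also have "\<dots> \<le> R + 1 * 1" using v k h s
        by (intro add_mono mult_mono) (auto simp: field_simps abs_if L2_set_nonneg split: if_splits)
      finally have "N w \<le> R + 1" by simp
      moreover have "(\<lambda>p. x p + h * k p) = (\<lambda>p. x0 p + s * w p + s\<^sup>2 * u p)"
        using s by (auto simp: x_def w_def field_simps)
      ultimately show ?thesis using C1(2)[rule_format, of w u s] w u s nonneg D(2) by simp
    qed
    from tower_stencil[OF D(1) s this]
    have "\<bar>D 1 0\<bar> * s \<le> ((3 * C1 + C) * s ^ 3) * s" by (simp add: algebra_simps eval_nat_numeral)
    then have "\<bar>D 1 0\<bar> \<le> (3 * C1 + C) * s ^ 3" using s by simp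
    then show "\<bar>ip I k (G (\<lambda>p. x0 p + s * v p + s\<^sup>2 * u p))\<bar> \<le> (3 * C1 + C) * s ^ 3"
      using D(3) by (simp add: x_def)
  qed
qed

text \<open>The usual descent inequality. The mean value point lies on a segment inside the unit
  ball, where \<open>G\<close> is Lipschitz; its parameter is estimated by 1, which costs the
  customary factor 1/2.\<close>

lemma descent:
  "\<exists>C>0. \<forall>z h. N z \<le> 1 \<longrightarrow> N (\<lambda>p. z p + h p) \<le> 1 \<longrightarrow>
     f (\<lambda>p. x0 p + (z p + h p)) \<le> f (\<lambda>p. x0 p + z p) + ip I h (G (\<lambda>p. x0 p + z p)) + C * (N h)\<^sup>2"
proof -
  obtain C where C: "0 < C" "\<forall>x y. N (\<lambda>p. x p - x0 p) \<le> 1 \<longrightarrow> N (\<lambda>p. y p - x0 p) \<le> 1 \<longrightarrow>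
      N (\<lambda>p. G x p - G y p) \<le> C * N (\<lambda>p. x p - y p)"
    using G_lip by auto
  show ?thesis
  proof (intro exI[of _ C] conjI C(1) allI impI)
    fix z h assume z: "N z \<le> 1" and zh: "N (\<lambda>p. z p + h p) \<le> 1"
    define x where "x = (\<lambda>p. x0 p + z p)"
    have "\<exists>t>0. t < 1 \<and> f (\<lambda>p. x p + 1 * h p) - f (\<lambda>p. x p + 0 * h p) = (1 - 0) * ip I h (G (\<lambda>p. x p + t * h p))"
      by (rule MVT2) (auto intro!: line_derivative)
    then obtain t where t: "0 < t" "t < 1" "f (\<lambda>p. x p + h p) - f x = ip I h (G (\<lambda>p. x p + t * h p))"
      by auto
    have "N (\<lambda>p. x p + t * h p - x0 p) = N (\<lambda>p. (1 - t) * z p + t * (z p + h p))"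
      by (simp add: x_def algebra_simps)
    also have "\<dots> \<le> (1 - t) * N z + t * N (\<lambda>p. z p + h p)"
      using t L2_set_triangle_ineq[of "\<lambda>p. (1 - t) * z p" "\<lambda>p. t * (z p + h p)" I]
      by (simp add: L2_set_scale del: distrib_left)
    also have "\<dots> \<le> (1 - t) * 1 + t * 1" using t z zh by (intro add_mono mult_left_mono) auto
    finally have "N (\<lambda>p. (x p + t * h p) - x0 p) \<le> 1" by simp
    moreover have "N (\<lambda>p. x p - x0 p) \<le> 1" using z by (simp add: x_def)
    ultimately have "N (\<lambda>p. G (\<lambda>p. x p + t * h p) p - G x p) \<le> C * N (\<lambda>p. (x p + t * h p) - x p)"
      using C(2)[rule_format, of "\<lambda>p. x p + t * h p" x] by simp
    also have "\<dots> = C * (t * N h)" using t by (simp add: L2_set_scale)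
    also have "\<dots> \<le> C * (1 * N h)" using t C by (intro mult_left_mono mult_right_mono) auto
    finally have "N (\<lambda>p. G (\<lambda>p. x p + t * h p) p - G x p) \<le> C * N h" by simp
    then have "N h * N (\<lambda>p. G (\<lambda>p. x p + t * h p) p - G x p) \<le> N h * (C * N h)"
      by (intro mult_left_mono) auto
    moreover have "ip I h (G (\<lambda>p. x p + t * h p)) - ip I h (G x) \<le> N h * N (\<lambda>p. G (\<lambda>p. x p + t * h p) p - G x p)"
      using abs_ip_le[of I h "\<lambda>p. G (\<lambda>p. x p + t * h p) p - G x p"] by (simp add: ip_diff_right)
    ultimately have "f (\<lambda>p. x p + h p) \<le> f x + ip I h (G x) + C * (N h)\<^sup>2"
      using t(3) by (simp add: power2_eq_square algebra_simps)
    then show "f (\<lambda>p. x0 p + (z p + h p)) \<le> f (\<lambda>p. x0 p + z p) + ip I h (G (\<lambda>p. x0 p + z p)) + C * (N h)\<^sup>2"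
      by (simp add: x_def add.assoc)
  qed
qed

text \<open>Needed after a Polyak step, where the range component is too large for the quartic
  bound. By the mean value theorem f is \<langle>z, G\<rangle> at an intermediate point; there
  \<open>G\<close> is a multiple of \<open>Hm z\<close> up to a quadratic error, and the quadratic
  form sees only \<open>u\<close>.\<close>

lemma upper_bound:
  "\<exists>C>0. \<forall>z v u. ker v \<longrightarrow> ran u \<longrightarrow> (\<forall>p\<in>I. z p = v p + u p) \<longrightarrow> N z \<le> 1 \<longrightarrow>
     f (\<lambda>p. x0 p + z p) \<le> C * ((N u)\<^sup>2 + N z ^ 3)"
proof -
  obtain C where C: "0 < C" "\<forall>z. N z \<le> 1 \<longrightarrow> N (\<lambda>p. G (\<lambda>p. x0 p + z p) p - Hm z p) \<le> C * (N z)\<^sup>2"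
    using G_taylor by (auto simp: Hm_def)
  obtain C' where C': "0 < C'" "\<forall>u. \<bar>ip I u (Hm u)\<bar> \<le> C' * (N u)\<^sup>2" using Hm_bound by blast
  show ?thesis
  proof (intro exI[of _ "C + C'"] conjI allI impI)
    show "0 < C + C'" using C C' by simp
    fix z v u assume v: "ker v" and u: "ran u" and zvu: "\<forall>p\<in>I. z p = v p + u p" and z: "N z \<le> 1"
    have "\<exists>t>0. t < 1 \<and> f (\<lambda>p. x0 p + 1 * z p) - f (\<lambda>p. x0 p + 0 * z p) = (1 - 0) * ip I z (G (\<lambda>p. x0 p + t * z p))"
      by (rule MVT2) (auto intro!: line_derivative)
    then obtain t where t: "0 < t" "t < 1" "f (\<lambda>p. x0 p + z p) = ip I z (G (\<lambda>p. x0 p + t * z p))"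
      by (auto simp: f0)
    have tz: "N (\<lambda>p. t * z p) \<le> N z" using t by (simp add: L2_set_scale mult_left_le_one_le)
    have "N (\<lambda>p. G (\<lambda>p. x0 p + t * z p) p - Hm (\<lambda>p. t * z p) p) \<le> C * (N (\<lambda>p. t * z p))\<^sup>2"
      using C(2)[rule_format, of "\<lambda>p. t * z p"] tz z by auto
    also have "\<dots> \<le> C * (N z)\<^sup>2" using tz C by (intro mult_left_mono power_mono) auto
    finally have 1: "N z * N (\<lambda>p. G (\<lambda>p. x0 p + t * z p) p - Hm (\<lambda>p. t * z p) p) \<le> N z * (C * (N z)\<^sup>2)"
      by (intro mult_left_mono) auto
    have "ip I z (G (\<lambda>p. x0 p + t * z p)) - t * ip I z (Hm z)
        = ip I z (\<lambda>p. G (\<lambda>p. x0 p + t * z p) p - Hm (\<lambda>p. t * z p) p)"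
      by (simp add: ip_linear Hm_scale)
    also have "\<dots> \<le> N z * (C * (N z)\<^sup>2)" using abs_ip_le 1 by (smt (verit))
    finally have 2: "f (\<lambda>p. x0 p + z p) \<le> t * ip I z (Hm z) + C * N z ^ 3"
      using t by (simp add: eval_nat_numeral algebra_simps)
    have "ip I z (Hm z) = ip I z (Hm u)" using v zvu by (intro ip_cong) (auto intro: Hm_decomp)
    also have "\<dots> = ip I u (Hm z)" by (rule Hm_sym)
    also have "\<dots> = ip I u (Hm u)" using v zvu by (intro ip_cong) (auto intro: Hm_decomp)
    finally have "\<bar>ip I z (Hm z)\<bar> \<le> C' * (N u)\<^sup>2" using C' by simp
    then have "t * \<bar>ip I z (Hm z)\<bar> \<le> 1 * (C' * (N u)\<^sup>2)" using t by (intro mult_mono) auto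
    moreover have "t * ip I z (Hm z) \<le> t * \<bar>ip I z (Hm z)\<bar>" using t by (intro mult_left_mono) auto
    ultimately have "f (\<lambda>p. x0 p + z p) \<le> C' * (N u)\<^sup>2 + C * N z ^ 3" using 2 by linarith
    also have "\<dots> \<le> (C + C') * ((N u)\<^sup>2 + N z ^ 3)" using C C' by (simp add: algebra_simps)
    finally show "f (\<lambda>p. x0 p + z p) \<le> (C + C') * ((N u)\<^sup>2 + N z ^ 3)" .
  qed
qed

section \<open>Gradient estimates near the minimum and the two kinds of step\<close>

lemma pow5_le: "0 \<le> s \<Longrightarrow> C * s \<le> c \<Longrightarrow> C * s ^ 5 \<le> c * (s::real) ^ 4"
  using mult_right_mono[of "C * s" c "s ^ 4"] by (simp add: eval_nat_numeral algebra_simps)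

text \<open>The quartic growth of \<open>f\<close> along the parabola \<open>s \<mapsto> s v + s\<^sup>2 u\<close> makes \<open>\<langle>\<nabla>f, z\<rangle>\<close> positive
  near the degenerate directions; away from them the gradient is at least of order \<open>|u|\<close>.\<close>

lemma monotonicity:
  "\<exists>A>0. \<exists>c>0. \<exists>\<rho>>0. \<forall>z. N z \<le> \<rho> \<longrightarrow>
     c * N z ^ 4 \<le> ip I z (G (\<lambda>p. x0 p + z p)) + A * (N (G (\<lambda>p. x0 p + z p)))\<^sup>2"
proof -
  obtain c0 \<rho>0 where c0: "0 < c0" "0 < \<rho>0" "\<And>z. N z \<le> \<rho>0 \<Longrightarrow> c0 * N z ^ 4 \<le> f (\<lambda>p. x0 p + z p)"
    using growth by blast
  obtain l where l: "0 < l" "\<And>u. ran u \<Longrightarrow> l * N u \<le> N (Hm u)" using gap by blast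
  obtain C2 where C2: "0 < C2" "\<And>z. N z \<le> 1 \<Longrightarrow> N (\<lambda>p. G (\<lambda>p. x0 p + z p) p - Hm z p) \<le> C2 * (N z)\<^sup>2"
    using G_taylor by (auto simp: Hm_def)
  \<comment> \<open>Threshold between the regimes |u| \<le> C1 |v|^2 and |u| > C1 |v|^2. In the
    second one the first summand makes the quadratic error of the gradient due to \<open>v\<close>
    at most a quarter of l |u|, and the summand 1 gives |v|^2 \<le> |u|.\<close>
  define C1 where "C1 = 4 * C2 / l + 1"
  have C1: "1 < C1" using C2 l by (simp add: C1_def)
  obtain C where C: "0 < C" "\<And>v u s. ker v \<Longrightarrow> N v \<le> C1 \<Longrightarrow> N u \<le> C1 \<Longrightarrow> \<bar>s\<bar> \<le> 1 \<Longrightarrow>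
     \<bar>ip I (\<lambda>p. s * v p + 2 * s\<^sup>2 * u p) (G (\<lambda>p. x0 p + s * v p + s\<^sup>2 * u p))
       - 4 * f (\<lambda>p. x0 p + s * v p + s\<^sup>2 * u p)\<bar> \<le> C * \<bar>s\<bar> ^ 5"
    using parabola[of C1] by blast
  define \<rho> where "\<rho> = Min {1, \<rho>0, c0 / C, l / (4 * C2)}"
  have "0 < \<rho>" "\<rho> \<le> 1" "\<rho> \<le> \<rho>0" "\<rho> \<le> c0 / C" "\<rho> \<le> l / (4 * C2)"
    using c0(1,2) C(1) C2(1) l(1) by (auto simp: \<rho>_def)
  then have \<rho>: "0 < \<rho>" "\<rho> \<le> 1" "\<rho> \<le> \<rho>0" "C * \<rho> \<le> c0" "C2 * \<rho> \<le> l / 4"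
    using C(1) C2(1) by (auto simp: field_simps)
  \<comment> \<open>The first summand of \<open>A\<close> absorbs the cross term |u| |G| near the
    parabola by Young's inequality, the second one serves the regime of large \<open>u\<close>. The
    two entries of \<open>c\<close> belong to the same regimes, where |z| is at most (1 + C1) s and
    2 s.\<close>
  define A where "A = C1\<^sup>2 / (4 * c0) + (2 / l + 4 * C / l\<^sup>2 + 1)"
  define c where "c = min (2 * c0 / (1 + C1) ^ 4) (l\<^sup>2 / 64)"
  have A: "0 < A" "C1\<^sup>2 / (4 * c0) \<le> A" "2 / l + 4 * C / l\<^sup>2 + 1 \<le> A"
    using l(1) C(1) c0(1) C1 by (auto simp: A_def intro!: add_nonneg_pos add_pos_pos)
  have c: "0 < c" "c \<le> 2 * c0 / (1 + C1) ^ 4" "c \<le> l\<^sup>2 / 64"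
    using l c0 C1 by (auto simp: c_def)
  \<comment> \<open>The radius is the square of \<rho> so that the scale
    \<open>s = sqrt (N u)\<close> of the second regime stays below \<rho>.\<close>
  have main: "c * N z ^ 4 \<le> ip I z (G (\<lambda>p. x0 p + z p)) + A * (N (G (\<lambda>p. x0 p + z p)))\<^sup>2"
    if z: "N z \<le> \<rho>\<^sup>2" for z
  proof -
    have \<rho>2: "\<rho>\<^sup>2 \<le> \<rho>" using \<rho> by (simp add: power2_eq_square mult_left_le_one_le)
    define x where "x = (\<lambda>p. x0 p + z p)"
    define n where "n = N (G x)"
    have n0: "0 \<le> n" by (simp add: n_def)
    obtain v u where vu: "ker v" "ran u" "\<And>p. z p = v p + u p" using decomp[of z] by blast
    have Nz: "N v \<le> N z" "N u \<le> N z" "N z \<le> N v + N u" "(N z)\<^sup>2 = (N v)\<^sup>2 + (N u)\<^sup>2"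
      using decomp_norm[OF vu] by auto
    have split: "ip I z (G x) = ip I (\<lambda>p. v p + 2 * u p) (G x) - ip I u (G x)"
      using vu(3) by (simp add: ip_linear ip_cong[of I z "\<lambda>p. v p + u p"])
    have iu: "ip I u (G x) \<le> N u * n" using abs_ip_le[of I u "G x"] by (simp add: n_def)
    \<comment> \<open>Every scale \<open>s\<close> satisfying the two bounds exhibits
      \<open>x\<close> as the point with parameter \<open>s\<close> on a parabola with bounded
      coefficients \<open>v / s\<close> and \<open>u / s^2\<close>.\<close>
    have para: "4 * f x - C * s ^ 5 \<le> ip I (\<lambda>p. v p + 2 * u p) (G x)"
      if s: "0 < s" "s \<le> 1" "N v \<le> C1 * s" "N u \<le> C1 * s\<^sup>2" for s
    proof -
      have "N (\<lambda>p. (1 / s) * v p) \<le> C1" "N (\<lambda>p. (1 / s\<^sup>2) * u p) \<le> C1"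
        using s unfolding L2_set_scale by (auto simp: field_simps)
      moreover have "(\<lambda>p. x0 p + s * ((1 / s) * v p) + s\<^sup>2 * ((1 / s\<^sup>2) * u p)) = x"
        "(\<lambda>p. s * ((1 / s) * v p) + 2 * s\<^sup>2 * ((1 / s\<^sup>2) * u p)) = (\<lambda>p. v p + 2 * u p)"
        using s vu(3) by (auto simp: x_def)
      ultimately show ?thesis
        using C(2)[OF ker_scale[OF vu(1), of "1 / s"], of "\<lambda>p. (1 / s\<^sup>2) * u p" s] s
        by (auto simp: abs_le_iff)
    qed
    show ?thesis
    proof (cases "N u \<le> C1 * (N v)\<^sup>2")
      case near: True
      \<comment> \<open>Of the \<open>4 * f x\<close>, worth four times \<open>c0 * s ^ 4\<close>,
        the Taylor error takes one part and Young's inequality for \<langle>u, G\<rangle> another;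
        two remain.\<close>
      define s where "s = N v"
      show ?thesis
      proof (cases "s = 0")
        case True
        then have "N v = 0" by (simp add: s_def)
        then have "N z \<le> 0" using Nz(3) near by simp
        then have "N z = 0" using L2_set_nonneg[of z I] by linarith
        then have "ip I z (G x) = 0" using abs_ip_le[of I z "G x"] by simp
        then show ?thesis using A \<open>N z = 0\<close> by (simp add: x_def)
      next
        case False
        then have s: "0 < s" "s \<le> \<rho>" using Nz(1) z \<rho>2 by (auto simp: s_def order.strict_iff_order)
        then have s1: "s \<le> 1" using \<rho> by simp
        have "4 * f x - C * s ^ 5 \<le> ip I (\<lambda>p. v p + 2 * u p) (G x)"
          using para[of s] s s1 near C1 by (simp add: s_def)
        moreover have "c0 * s ^ 4 \<le> f x"
        proof -
          have "c0 * s ^ 4 \<le> c0 * N z ^ 4" using c0 Nz by (auto simp: s_def intro!: mult_left_mono power_mono)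
          also have "\<dots> \<le> f x" using c0(3)[of z] z \<rho>2 \<rho> by (simp add: x_def)
          finally show ?thesis .
        qed
        moreover have "C * s ^ 5 \<le> c0 * s ^ 4"
          using s C(1) order_trans[OF mult_left_mono[of s \<rho> C] \<rho>(4)] by (intro pow5_le) auto
        moreover have "N u * n \<le> C1 * s\<^sup>2 * n" using near n0 by (simp add: s_def mult_right_mono)
        moreover have "C1 * s\<^sup>2 * n \<le> c0 * s ^ 4 + C1\<^sup>2 / (4 * c0) * n\<^sup>2"
        proof -
          have "(2 * c0 * s\<^sup>2 - C1 * n)\<^sup>2 / (4 * c0) = c0 * s ^ 4 + C1\<^sup>2 / (4 * c0) * n\<^sup>2 - C1 * s\<^sup>2 * n"
            using c0(1) by (simp add: power2_eq_square eval_nat_numeral field_simps)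
          moreover have "0 \<le> (2 * c0 * s\<^sup>2 - C1 * n)\<^sup>2 / (4 * c0)" using c0(1) by simp
          ultimately show ?thesis by linarith
        qed
        moreover have "C1\<^sup>2 / (4 * c0) * n\<^sup>2 \<le> A * n\<^sup>2" using A by (intro mult_right_mono) auto
        ultimately have *: "2 * c0 * s ^ 4 \<le> ip I z (G x) + A * n\<^sup>2"
          using split iu by linarith
        have "C1 * s\<^sup>2 \<le> C1 * s" using s s1 C1 by (simp add: power2_eq_square)
        then have "N z \<le> (1 + C1) * s" using Nz(3) near by (simp add: s_def algebra_simps)
        then have "c * N z ^ 4 \<le> (2 * c0 / (1 + C1) ^ 4) * ((1 + C1) * s) ^ 4"
          using c C1 c0 by (intro mult_mono power_mono) auto
        also have "\<dots> = 2 * c0 * s ^ 4" using C1 by (simp add: power_mult_distrib)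
        finally show ?thesis using * by (simp add: x_def n_def)
      qed
    next
      case False
      \<comment> \<open>Now the scale is read off from \<open>u\<close>. Only
        \<open>f \<ge> 0\<close> is used for \<langle>G, z\<rangle>; positivity comes from the
        gradient, which is at least of order \<open>s^2\<close>.\<close>
      define s where "s = sqrt (N u)"
      have "0 \<le> C1 * (N v)\<^sup>2" using C1 by simp
      then have up: "0 < N u" using False by linarith
      then have s: "0 < s" "s\<^sup>2 = N u" by (auto simp: s_def)
      have "s\<^sup>2 \<le> \<rho>\<^sup>2" using Nz(2) z s by simp
      then have s\<rho>: "s \<le> \<rho>" by (rule power2_le_imp_le) (use \<rho> in simp)
      then have s1: "s \<le> 1" using \<rho> by simp
      have s2s: "s\<^sup>2 \<le> s" using power_decreasing[of 1 2 s] s(1) s1 by simp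
      have "(N v)\<^sup>2 \<le> C1 * (N v)\<^sup>2" using mult_right_mono[of 1 C1 "(N v)\<^sup>2"] C1 by simp
      then have "(N v)\<^sup>2 \<le> s\<^sup>2" using False s(2) by linarith
      then have vs: "N v \<le> s" by (rule power2_le_imp_le) (use s in simp)
      have "4 * f x - C * s ^ 5 \<le> ip I (\<lambda>p. v p + 2 * u p) (G x)"
      proof (rule para[OF s(1) s1])
        show "N v \<le> C1 * s" using vs mult_right_mono[of 1 C1 s] C1 s(1) by linarith
        show "N u \<le> C1 * s\<^sup>2" using s(2) mult_right_mono[of 1 C1 "s\<^sup>2"] C1 by simp
      qed
      moreover have "0 \<le> f x" by (rule nonneg)
      moreover have "ip I u (G x) \<le> s\<^sup>2 * n" unfolding s(2) by (rule iu)
      ultimately have low: "- (C * s ^ 5) - s\<^sup>2 * n \<le> ip I z (G x)" using split by linarith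
      \<comment> \<open>The gradient differs from \<open>Hm z = Hm u\<close> by at most C2 |z|^2,
        and the shares of \<open>v\<close> and of \<open>u\<close> in this error are each at most a
        quarter of l |u|.\<close>
      have "l * s\<^sup>2 \<le> N (Hm u)" using l(2)[OF vu(2)] s by simp
      also have "N (Hm u) = N (Hm z)" using Hm_decomp[OF vu(1,3)] by (intro L2_set_cong) auto
      also have "\<dots> \<le> n + N (\<lambda>p. G x p - Hm z p)"
        using L2_set_diff_le[of "G x" "\<lambda>p. G x p - Hm z p" I] by (simp add: n_def)
      also have "\<dots> \<le> n + C2 * (N z)\<^sup>2" using C2(2)[of z] z \<rho>2 \<rho> by (simp add: x_def)
      also have "C2 * (N z)\<^sup>2 = C2 * (N v)\<^sup>2 + C2 * s ^ 4"
      proof -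
        have "s ^ 4 = (s\<^sup>2)\<^sup>2" by (simp flip: power_mult)
        then show ?thesis unfolding Nz(4) s(2) by (simp add: distrib_left)
      qed
      also have "C2 * (N v)\<^sup>2 \<le> l / 4 * s\<^sup>2"
      proof -
        have "C1 * (N v)\<^sup>2 \<le> s\<^sup>2" using False s by simp
        moreover have "C1 * (N v)\<^sup>2 = (4 * C2 / l) * (N v)\<^sup>2 + (N v)\<^sup>2" by (simp only: C1_def distrib_right mult_1)
        ultimately have "(4 * C2 / l) * (N v)\<^sup>2 \<le> s\<^sup>2" using zero_le_power2[of "N v"] by linarith
        then show ?thesis using l by (simp add: field_simps)
      qed
      also have "C2 * s ^ 4 \<le> l / 4 * s\<^sup>2"
      proof -
        have "C2 * s \<le> l / 4" using mult_left_mono[OF s\<rho>, of C2] C2 \<rho>(5) by linarith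
        moreover have "C2 * s\<^sup>2 \<le> C2 * s" using s2s C2(1) by (intro mult_left_mono) auto
        ultimately have "C2 * s\<^sup>2 * s\<^sup>2 \<le> l / 4 * s\<^sup>2" by (intro mult_right_mono) auto
        then show ?thesis by (simp add: eval_nat_numeral algebra_simps)
      qed
      finally have "l / 2 * s\<^sup>2 \<le> n" by linarith
      then have s2: "s\<^sup>2 \<le> 2 / l * n" using l by (simp add: field_simps)
      have "s\<^sup>2 * n \<le> 2 / l * n\<^sup>2" using mult_right_mono[OF s2 n0] by (simp add: power2_eq_square)
      moreover have s4: "s ^ 4 \<le> 4 / l\<^sup>2 * n\<^sup>2"
      proof -
        have "(s\<^sup>2)\<^sup>2 \<le> (2 / l * n)\<^sup>2" using s2 by (intro power_mono) auto
        then show ?thesis by (simp add: power_mult_distrib power_divide flip: power_mult)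
      qed
      moreover have "C * s ^ 5 \<le> C * s ^ 4" using s s1 C by (intro mult_left_mono power_decreasing) auto
      moreover have "C * s ^ 4 \<le> 4 * C / l\<^sup>2 * n\<^sup>2" using mult_left_mono[OF s4, of C] C by (simp add: field_simps)
      moreover have "(2 / l + 4 * C / l\<^sup>2 + 1) * n\<^sup>2 \<le> A * n\<^sup>2" using A by (intro mult_right_mono) auto
      ultimately have "n\<^sup>2 \<le> ip I z (G x) + A * n\<^sup>2" using low by (simp add: distrib_right)
      moreover have "c * N z ^ 4 \<le> n\<^sup>2"
      proof -
        have "N z \<le> 2 * s" using Nz(3) vs s(2) s2s by linarith
        then have "c * N z ^ 4 \<le> (l\<^sup>2 / 64) * (2 * s) ^ 4" using c l by (intro mult_mono power_mono) auto
        also have "\<dots> = (l\<^sup>2 / 4) * s ^ 4" by (simp add: power_mult_distrib)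
        also have "\<dots> \<le> (l\<^sup>2 / 4) * (4 / l\<^sup>2 * n\<^sup>2)" using s4 by (intro mult_left_mono) auto
        also have "\<dots> = n\<^sup>2" using l by simp
        finally show ?thesis .
      qed
      ultimately show ?thesis by (simp add: x_def n_def)
    qed
  qed
  show ?thesis using A(1) c(1) \<rho>(1) main by (intro exI[of _ A] exI[of _ c] exI[of _ "\<rho>\<^sup>2"] conjI) auto
qed

text \<open>At \<open>y\<close> the gradient has no range part, so the Lipschitz bound controls the
  range part \<open>r\<close> of the gradient at \<open>x\<close> by the distance to
  \<open>y\<close>. If that distance is of order |z|^3, comparing \<open>r\<close> with
  \<open>Hm u\<close> through the spectral gap gives |u| = O(|z|^2). Then \<open>x\<close> sits at
  scale |z| on a bounded parabola, where the expansions apply.\<close>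

lemma tube_estimates:
  "\<exists>C>0. \<exists>\<rho>>0. \<forall>z y. 0 < N z \<longrightarrow> N z \<le> \<rho> \<longrightarrow> N (\<lambda>p. y p - x0 p) \<le> 1 \<longrightarrow> ker (G y) \<longrightarrow>
     C * N (\<lambda>p. x0 p + z p - y p) \<le> N z ^ 3 \<longrightarrow>
     (\<exists>v u k r. ker v \<and> ran u \<and> (\<forall>p\<in>I. z p = v p + u p) \<and> N u \<le> C * (N z)\<^sup>2 \<and>
        ker k \<and> ran r \<and> (\<forall>p\<in>I. G (\<lambda>p. x0 p + z p) p = k p + r p) \<and>
        N r \<le> C * N (\<lambda>p. x0 p + z p - y p)) \<and>
     N (G (\<lambda>p. x0 p + z p)) \<le> C * N z ^ 3 \<and>
     4 * f (\<lambda>p. x0 p + z p) - C * N z ^ 5 \<le> ip I z (G (\<lambda>p. x0 p + z p)) \<and>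
     f (\<lambda>p. x0 p + z p) \<le> C * N z ^ 4"
proof -
  obtain l where l: "0 < l" "\<And>u. ran u \<Longrightarrow> l * N u \<le> N (Hm u)" using gap by blast
  obtain C2 where C2: "0 < C2" "\<And>z. N z \<le> 1 \<Longrightarrow> N (\<lambda>p. G (\<lambda>p. x0 p + z p) p - Hm z p) \<le> C2 * (N z)\<^sup>2"
    using G_taylor by (auto simp: Hm_def)
  obtain CL where CL: "0 < CL" "\<And>x y. N (\<lambda>p. x p - x0 p) \<le> 1 \<Longrightarrow> N (\<lambda>p. y p - x0 p) \<le> 1 \<Longrightarrow>
      N (\<lambda>p. G x p - G y p) \<le> CL * N (\<lambda>p. x p - y p)"
    using G_lip by auto
  define Cu where "Cu = (1 + C2) / l + 1"
  have Cu: "1 \<le> Cu" "(1 + C2) / l \<le> Cu" using l(1) C2(1) by (auto simp: Cu_def)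
  obtain C3 where C3: "0 < C3" "\<And>v u s. ker v \<Longrightarrow> N v \<le> Cu \<Longrightarrow> N u \<le> Cu \<Longrightarrow> \<bar>s\<bar> \<le> 1 \<Longrightarrow>
     f (\<lambda>p. x0 p + s * v p + s\<^sup>2 * u p) \<le> C3 * s ^ 4 \<and>
     \<bar>ip I (\<lambda>p. s * v p + 2 * s\<^sup>2 * u p) (G (\<lambda>p. x0 p + s * v p + s\<^sup>2 * u p))
       - 4 * f (\<lambda>p. x0 p + s * v p + s\<^sup>2 * u p)\<bar> \<le> C3 * \<bar>s\<bar> ^ 5"
    using parabola[of Cu] by blast
  have "0 \<le> Cu" using Cu by simp
  from parabola_gradient[OF this] obtain C4 where C4: "0 < C4"
    "\<And>v u k s. ker v \<Longrightarrow> ker k \<Longrightarrow> N v \<le> Cu \<Longrightarrow> N u \<le> Cu \<Longrightarrow> N k \<le> 1 \<Longrightarrow> 0 < s \<Longrightarrow> s \<le> 1 \<Longrightarrow>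
     \<bar>ip I k (G (\<lambda>p. x0 p + s * v p + s\<^sup>2 * u p))\<bar> \<le> C4 * s ^ 3" by blast
  define C where "C = CL + C4 + 1 + C3 + Cu * (C4 + 1)"
  have C: "0 < C" "CL \<le> C" "C4 + 1 \<le> C" "C3 + Cu * (C4 + 1) \<le> C" "Cu \<le> C" "C3 \<le> C"
    using CL(1) C4(1) C3(1) Cu by (auto simp: C_def distrib_left add_nonneg_nonneg add_pos_nonneg)
  have main: "(\<exists>v u k r. ker v \<and> ran u \<and> (\<forall>p\<in>I. z p = v p + u p) \<and> N u \<le> C * (N z)\<^sup>2 \<and>
        ker k \<and> ran r \<and> (\<forall>p\<in>I. G (\<lambda>p. x0 p + z p) p = k p + r p) \<and>
        N r \<le> C * N (\<lambda>p. x0 p + z p - y p)) \<and>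
     N (G (\<lambda>p. x0 p + z p)) \<le> C * N z ^ 3 \<and>
     4 * f (\<lambda>p. x0 p + z p) - C * N z ^ 5 \<le> ip I z (G (\<lambda>p. x0 p + z p)) \<and>
     f (\<lambda>p. x0 p + z p) \<le> C * N z ^ 4"
    if z: "0 < N z" "N z \<le> 1" and y: "N (\<lambda>p. y p - x0 p) \<le> 1" "ker (G y)"
      "C * N (\<lambda>p. x0 p + z p - y p) \<le> N z ^ 3" for z y
  proof -
    define x where "x = (\<lambda>p. x0 p + z p)"
    define s where "s = N z"
    have s: "0 < s" "s \<le> 1" using z by (auto simp: s_def)
    obtain v u where vu: "ker v" "ran u" "\<And>p. z p = v p + u p" using decomp[of z] by blast
    obtain k r where kr: "ker k" "ran r" "\<And>p. G x p = k p + r p" using decomp[of "G x"] by blast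
    have Nz: "N v \<le> s" "N u \<le> s" using decomp_norm[OF vu] by (auto simp: s_def)
    \<comment> \<open>Pairing with \<open>r\<close> removes both the kernel part \<open>k\<close>
      and the gradient at \<open>y\<close>, leaving a difference of gradients.\<close>
    have Nr1: "N r \<le> CL * N (\<lambda>p. x p - y p)"
    proof -
      have "(N r)\<^sup>2 = ip I r (\<lambda>p. k p + r p)"
        using ker_ran[OF kr(1,2)] by (simp add: ip_linear ip_self ip_commute)
      also have "\<dots> = ip I r (\<lambda>p. G x p - G y p)"
        using ker_ran[OF y(2) kr(2)] by (simp add: ip_linear kr(3) ip_commute)
      also have "\<dots> \<le> N r * N (\<lambda>p. G x p - G y p)" using abs_ip_le[of I r] by (smt (verit))
      also have "\<dots> \<le> N r * (CL * N (\<lambda>p. x p - y p))"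
        using CL(2)[of x y] z y by (intro mult_left_mono) (auto simp: x_def)
      finally have "N r * N r \<le> N r * (CL * N (\<lambda>p. x p - y p))" by (simp add: power2_eq_square)
      then show ?thesis using CL(1) by (cases "N r = 0") (auto simp: order.strict_iff_order)
    qed
    also have "\<dots> \<le> C * N (\<lambda>p. x p - y p)" using C by (intro mult_right_mono) auto
    finally have Nr: "N r \<le> C * N (\<lambda>p. x p - y p)" .
    also have "\<dots> \<le> s ^ 3" using y(3) by (simp add: x_def s_def)
    finally have Nr3: "N r \<le> s ^ 3" .
    \<comment> \<open>Pairing the Taylor estimate with \<open>Hm u\<close> removes the kernel part
      \<open>k\<close>, for which no bound is available yet.\<close>
    have Nu: "N u \<le> Cu * s\<^sup>2"
    proof -
      have E: "N (\<lambda>p. G x p - Hm z p) \<le> C2 * s\<^sup>2" using C2(2)[of z] s by (simp add: x_def s_def)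
      have "(N (Hm u))\<^sup>2 = ip I (Hm u) (Hm u)" by (simp add: ip_self)
      also have "\<dots> = ip I (Hm u) (Hm z)" using Hm_decomp[OF vu(1,3)] by (intro ip_cong) auto
      also have "\<dots> = ip I (Hm u) r - ip I (Hm u) (\<lambda>p. G x p - Hm z p)"
        using ker_ran[OF kr(1) ran_Hm, of u] by (simp add: ip_linear kr(3) ip_commute)
      also have "\<dots> \<le> N (Hm u) * N r + N (Hm u) * N (\<lambda>p. G x p - Hm z p)"
        using abs_ip_le[of I "Hm u" r] abs_ip_le[of I "Hm u" "\<lambda>p. G x p - Hm z p"] by linarith
      also have "\<dots> \<le> N (Hm u) * s\<^sup>2 + N (Hm u) * (C2 * s\<^sup>2)"
        using E Nr3 power_decreasing[of 2 3 s] s by (intro add_mono mult_left_mono) auto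
      finally have "N (Hm u) * N (Hm u) \<le> N (Hm u) * ((1 + C2) * s\<^sup>2)"
        by (simp add: power2_eq_square algebra_simps)
      then have "N (Hm u) \<le> (1 + C2) * s\<^sup>2"
        using C2(1) by (cases "N (Hm u) = 0") (auto simp: order.strict_iff_order)
      then have "l * N u \<le> (1 + C2) * s\<^sup>2" using l(2)[OF vu(2)] by simp
      then have "N u \<le> (1 + C2) / l * s\<^sup>2" using l(1) by (simp add: field_simps)
      also have "\<dots> \<le> Cu * s\<^sup>2" using Cu by (intro mult_right_mono) auto
      finally show ?thesis .
    qed
    have sc: "ker (\<lambda>p. (1 / s) * v p)" "N (\<lambda>p. (1 / s) * v p) \<le> Cu" "N (\<lambda>p. (1 / s\<^sup>2) * u p) \<le> Cu"
      "(\<lambda>p. x0 p + s * ((1 / s) * v p) + s\<^sup>2 * ((1 / s\<^sup>2) * u p)) = x"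
      "(\<lambda>p. s * ((1 / s) * v p) + 2 * s\<^sup>2 * ((1 / s\<^sup>2) * u p)) = (\<lambda>p. v p + 2 * u p)"
    proof -
      show "ker (\<lambda>p. (1 / s) * v p)" by (rule ker_scale[OF vu(1)])
      have "N v \<le> Cu * s" using Nz(1) s(1) Cu(1) mult_right_mono[of 1 Cu s] by linarith
      then show "N (\<lambda>p. (1 / s) * v p) \<le> Cu" "N (\<lambda>p. (1 / s\<^sup>2) * u p) \<le> Cu"
        unfolding L2_set_scale using s Nu by (auto simp: field_simps)
    qed (use s vu(3) in \<open>auto simp: x_def\<close>)
    have par: "f x \<le> C3 * s ^ 4" "\<bar>ip I (\<lambda>p. v p + 2 * u p) (G x) - 4 * f x\<bar> \<le> C3 * s ^ 5"
      using C3(2)[OF sc(1,2,3), of s] s unfolding sc(4,5) by auto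
    have Nk: "N k \<le> C4 * s ^ 3"
    proof (cases "N k = 0")
      case True
      then show ?thesis using C4(1) s by simp
    next
      case False
      then have kp: "0 < N k" by (simp add: order.strict_iff_order)
      have "N (\<lambda>p. (1 / N k) * k p) \<le> 1" unfolding L2_set_scale using kp by simp
      from C4(2)[OF sc(1) ker_scale[OF kr(1)] sc(2,3) this s]
      have "\<bar>ip I (\<lambda>p. (1 / N k) * k p) (G x)\<bar> \<le> C4 * s ^ 3" unfolding sc(4) .
      moreover have "ip I (\<lambda>p. (1 / N k) * k p) (G x) = (1 / N k) * (N k)\<^sup>2"
      proof -
        have "ip I k (G x) = ip I k (\<lambda>p. k p + r p)" by (intro ip_cong) (auto simp: kr(3))
        also have "\<dots> = (N k)\<^sup>2" using ker_ran[OF kr(1,2)] by (simp add: ip_add_right ip_self)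
        finally show ?thesis by (simp only: ip_scale_left)
      qed
      moreover have "(1 / N k) * (N k)\<^sup>2 = N k" using kp by (simp add: power2_eq_square)
      ultimately show ?thesis by simp
    qed
    have NG: "N (G x) \<le> (C4 + 1) * s ^ 3"
    proof -
      have "N (G x) \<le> N k + N r" using kr(3) by (intro decomp_norm(4)[OF kr])
      then show ?thesis using Nk Nr3 by (simp add: algebra_simps)
    qed
    have "4 * f x - C * s ^ 5 \<le> ip I z (G x)"
    proof -
      have "ip I z (G x) = ip I (\<lambda>p. v p + 2 * u p) (G x) - ip I u (G x)"
        using vu(3) by (simp add: ip_linear ip_cong[of I z "\<lambda>p. v p + u p"])
      moreover have "ip I u (G x) \<le> Cu * (C4 + 1) * s ^ 5"
      proof -
        have "ip I u (G x) \<le> N u * N (G x)" using abs_ip_le[of I u "G x"] by linarith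
        also have "\<dots> \<le> (Cu * s\<^sup>2) * ((C4 + 1) * s ^ 3)" using Nu NG Cu s by (intro mult_mono) auto
        finally show ?thesis by (simp add: eval_nat_numeral algebra_simps)
      qed
      moreover have "(C3 + Cu * (C4 + 1)) * s ^ 5 \<le> C * s ^ 5" using C s by (intro mult_right_mono) auto
      ultimately show ?thesis using par(2) by (simp add: distrib_right abs_le_iff)
    qed
    moreover have "f x \<le> C * s ^ 4" by (rule order_trans[OF par(1) mult_right_mono[OF C(6)]]) simp
    moreover have "N (G x) \<le> C * s ^ 3" by (rule order_trans[OF NG mult_right_mono[OF C(3)]]) (use s in simp)
    moreover have "N u \<le> C * s\<^sup>2" by (rule order_trans[OF Nu mult_right_mono[OF C(5)]]) simp
    ultimately show ?thesis using vu kr Nr unfolding x_def s_def by blast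
  qed
  show ?thesis using C(1) main by (intro exI[of _ C] exI[of _ 1] conjI) auto
qed

text \<open>Near the ravine \<open>f\<close> behaves like a quartic form, so \<open>\<langle>\<nabla>f, z\<rangle> \<approx> 4 f\<close> and
  \<open>|z'|\<^sup>2 = |z|\<^sup>2 - (2 \<langle>g, z\<rangle> - L) L / |g|\<^sup>2 \<lessapprox> |z|\<^sup>2 - 7 f\<^sup>2 / |g|\<^sup>2\<close>, a fixed fraction of \<open>|z|\<^sup>2\<close>.
  The step multiplies the small range component of \<open>g\<close> by a factor of order \<open>|z|\<^sup>-\<^sup>2\<close>, which is
  why \<open>\<epsilon>\<close> has to be small.\<close>

lemma polyak_contraction:
  assumes A: "0 < A"
  shows "\<exists>q>0. q < 1 \<and> (\<exists>\<epsilon>>0. \<exists>\<rho>>0. \<forall>z y g L. 0 < N z \<longrightarrow> N z \<le> \<rho> \<longrightarrow> N (\<lambda>p. y p - x0 p) \<le> 1 \<longrightarrow> ker (G y) \<longrightarrow>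
     N (\<lambda>p. x0 p + z p - y p) \<le> \<epsilon> * N z ^ 3 \<longrightarrow> N (\<lambda>p. g p - G (\<lambda>p. x0 p + z p) p) \<le> \<epsilon> * N z ^ 3 \<longrightarrow>
     \<bar>L - f (\<lambda>p. x0 p + z p)\<bar> \<le> \<epsilon> * N z ^ 4 \<longrightarrow>
     (N (\<lambda>p. z p - L / (N g)\<^sup>2 * g p))\<^sup>2 + A * f (\<lambda>p. x0 p + (z p - L / (N g)\<^sup>2 * g p)) \<le> q\<^sup>2 * (N z)\<^sup>2)"
proof -
  obtain c0 \<rho>0 where c0: "0 < c0" "0 < \<rho>0" "\<And>z. N z \<le> \<rho>0 \<Longrightarrow> c0 * N z ^ 4 \<le> f (\<lambda>p. x0 p + z p)"
    using growth by blast
  obtain C \<rho>1 where C: "0 < C" "0 < \<rho>1" "\<And>z y. 0 < N z \<Longrightarrow> N z \<le> \<rho>1 \<Longrightarrow> N (\<lambda>p. y p - x0 p) \<le> 1 \<Longrightarrow> ker (G y) \<Longrightarrow>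
     C * N (\<lambda>p. x0 p + z p - y p) \<le> N z ^ 3 \<Longrightarrow>
     (\<exists>v u k r. ker v \<and> ran u \<and> (\<forall>p\<in>I. z p = v p + u p) \<and> N u \<le> C * (N z)\<^sup>2 \<and>
        ker k \<and> ran r \<and> (\<forall>p\<in>I. G (\<lambda>p. x0 p + z p) p = k p + r p) \<and>
        N r \<le> C * N (\<lambda>p. x0 p + z p - y p)) \<and>
     N (G (\<lambda>p. x0 p + z p)) \<le> C * N z ^ 3 \<and>
     4 * f (\<lambda>p. x0 p + z p) - C * N z ^ 5 \<le> ip I z (G (\<lambda>p. x0 p + z p)) \<and>
     f (\<lambda>p. x0 p + z p) \<le> C * N z ^ 4"
    using tube_estimates by (elim exE conjE) blast
  obtain C6 where C6: "0 < C6" "\<And>z v u. ker v \<Longrightarrow> ran u \<Longrightarrow> (\<forall>p\<in>I. z p = v p + u p) \<Longrightarrow> N z \<le> 1 \<Longrightarrow>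
     f (\<lambda>p. x0 p + z p) \<le> C6 * ((N u)\<^sup>2 + N z ^ 3)"
    using upper_bound by blast
  \<comment> \<open>The fraction of |z|^2 gained by the step: \<open>c0\<close> from
    \<open>key\<close> times the lower bound \<open>c0 / (2 * (C + 1)^2)\<close> of \<sigma> s^2.
    The cap 1 keeps \<open>1 - c1 / 2\<close> positive.\<close>
  define c1 where "c1 = min 1 (c0\<^sup>2 / (2 * (C + 1)\<^sup>2))"
  have c1: "0 < c1" "c1 \<le> 1" "c1 \<le> c0\<^sup>2 / (2 * (C + 1)\<^sup>2)" using c0(1) C(1) by (auto simp: c1_def)
  \<comment> \<open>The upper bound \<open>(C + 1) / c0^2\<close> of \<sigma> s^2 times the factor
    \<open>C + 1\<close> of the range error: the step moves the range part by at most K \<epsilon>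
    s.\<close>
  define K where "K = (C + 1) / c0\<^sup>2 * (C + 1)"
  have K: "0 < K" using C(1) c0(1) by (simp add: K_def)
  \<comment> \<open>With |u'| \<le> t s and |z'|^3 \<le> t s^2 the term A f after the step costs at
    most half of the gain c1 s^2; this yields \<open>q\<close>.\<close>
  define t where "t = min 1 (c1 / (4 * A * C6))"
  have t: "0 < t" "t \<le> 1" "t \<le> c1 / (4 * A * C6)" using c1 A C6(1) by (auto simp: t_def)
  have tc: "A * (C6 * (2 * t)) \<le> c1 / 2" using t(3) A C6(1) by (simp add: field_simps)
  define \<epsilon> where "\<epsilon> = Min {1, 1 / C, c0 / 2, t / (2 * K)}"
  have \<epsilon>: "0 < \<epsilon>" "\<epsilon> \<le> 1" "\<epsilon> \<le> 1 / C" "\<epsilon> \<le> c0 / 2" "\<epsilon> \<le> t / (2 * K)"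
    using C(1) c0(1) t(1) K by (auto simp: \<epsilon>_def)
  have \<epsilon>': "C * \<epsilon> \<le> 1" "K * \<epsilon> \<le> t / 2" using \<epsilon> C(1) K by (auto simp: field_simps)
  define \<rho> where "\<rho> = Min {1, \<rho>0, \<rho>1, c0 / C, t / (2 * C), t}"
  have \<rho>: "0 < \<rho>" "\<rho> \<le> 1" "\<rho> \<le> \<rho>0" "\<rho> \<le> \<rho>1" "\<rho> \<le> c0 / C" "\<rho> \<le> t / (2 * C)" "\<rho> \<le> t"
    using C(1,2) c0(1,2) t(1) by (auto simp: \<rho>_def)
  have \<rho>': "C * \<rho> \<le> c0" "C * \<rho> \<le> t / 2" using \<rho> C(1) by (auto simp: field_simps)
  define q where "q = sqrt (1 - c1 / 2)"
  have q: "0 < q" "q < 1" "q\<^sup>2 = 1 - c1 / 2" using c1 by (auto simp: q_def)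
  have main: "(N (\<lambda>p. z p - L / (N g)\<^sup>2 * g p))\<^sup>2 + A * f (\<lambda>p. x0 p + (z p - L / (N g)\<^sup>2 * g p)) \<le> q\<^sup>2 * (N z)\<^sup>2"
    if z: "0 < N z" "N z \<le> \<rho>" and y: "N (\<lambda>p. y p - x0 p) \<le> 1" "ker (G y)"
      and d: "N (\<lambda>p. x0 p + z p - y p) \<le> \<epsilon> * N z ^ 3"
      and g: "N (\<lambda>p. g p - G (\<lambda>p. x0 p + z p) p) \<le> \<epsilon> * N z ^ 3"
      and L: "\<bar>L - f (\<lambda>p. x0 p + z p)\<bar> \<le> \<epsilon> * N z ^ 4" for z y g L
  proof -
    define x where "x = (\<lambda>p. x0 p + z p)"
    define s where "s = N z"
    have s: "0 < s" "s \<le> \<rho>" "s \<le> 1" using z \<rho> by (auto simp: s_def)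
    define e where "e = (\<lambda>p. g p - G x p)"
    have Ne: "N e \<le> \<epsilon> * s ^ 3" using g by (simp add: e_def x_def s_def)
    have "C * N (\<lambda>p. x0 p + z p - y p) \<le> C * (\<epsilon> * s ^ 3)" using d C(1) by (intro mult_left_mono) (auto simp: s_def)
    also have "\<dots> \<le> 1 * s ^ 3" using \<epsilon>' s mult_right_mono[of "C * \<epsilon>" 1 "s ^ 3"] by (simp add: mult.assoc)
    finally have "C * N (\<lambda>p. x0 p + z p - y p) \<le> N z ^ 3" by (simp add: s_def)
    from C(3)[OF z(1) order_trans[OF z(2) \<rho>(4)] y this]
    obtain v u k r where vu: "ker v" "ran u" "\<forall>p\<in>I. z p = v p + u p" "N u \<le> C * s\<^sup>2"
      and kr: "ker k" "ran r" "\<forall>p\<in>I. G x p = k p + r p" "N r \<le> C * N (\<lambda>p. x0 p + z p - y p)"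
      and NG: "N (G x) \<le> C * s ^ 3" and ipz: "4 * f x - C * s ^ 5 \<le> ip I z (G x)" and fu: "f x \<le> C * s ^ 4"
      unfolding x_def s_def by blast
    have Nr: "N r \<le> C * \<epsilon> * s ^ 3"
      using order_trans[OF kr(4) mult_left_mono[OF d, of C]] C(1) by (simp add: s_def mult.assoc)
    have fl: "c0 * s ^ 4 \<le> f x" using c0(3)[of z] s \<rho> by (simp add: x_def s_def)
    have \<epsilon>4: "\<epsilon> * s ^ 4 \<le> c0 / 2 * s ^ 4" "\<epsilon> * s ^ 4 \<le> 1 * s ^ 4" using \<epsilon> s by (auto intro!: mult_right_mono)
    have C5: "C * s ^ 5 \<le> c0 * s ^ 4" using s C(1) order_trans[OF mult_left_mono[of s \<rho> C] \<rho>'(1)] by (intro pow5_le) auto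
    have Lf: "f x - \<epsilon> * s ^ 4 \<le> L" "L \<le> f x + \<epsilon> * s ^ 4" using L by (auto simp: x_def s_def abs_le_iff)
    have Ll: "c0 / 2 * s ^ 4 \<le> L" using Lf fl \<epsilon>4 by linarith
    have Lu: "L \<le> (C + 1) * s ^ 4" using Lf fu \<epsilon>4 by (simp add: distrib_right)
    have s4: "0 < s ^ 4" using s by simp
    have c0s4: "0 < c0 * s ^ 4" using c0(1) s4 by simp
    have L0: "0 < L" using Ll c0s4 by simp
    have ie: "\<bar>ip I z e\<bar> \<le> \<epsilon> * s ^ 4"
    proof -
      have "\<bar>ip I z e\<bar> \<le> s * N e" using abs_ip_le[of I z e] by (simp add: s_def)
      also have "\<dots> \<le> s * (\<epsilon> * s ^ 3)" using Ne s by (intro mult_left_mono) auto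
      finally show ?thesis by (simp add: eval_nat_numeral algebra_simps)
    qed
    have ge: "ip I z g = ip I z (G x) + ip I z e" by (simp add: e_def ip_linear)
    have c04: "c0 / 2 * s ^ 4 = (c0 * s ^ 4) / 2" by simp
    \<comment> \<open>The left-out quantity is at least 7 f - 2 C s^5 - 3 \<epsilon> s^4, and the
      growth of f together with the choices of \<rho> and \<epsilon> leaves more than
      \<open>c0 * s ^ 4\<close>.\<close>
    have key: "c0 * s ^ 4 \<le> 2 * ip I z g - L"
      using ipz fl C5 \<epsilon>4(1) Lf(2) ie ge unfolding c04 abs_le_iff by linarith
    have key2: "c0 * s ^ 4 \<le> ip I z g"
      using ipz fl C5 \<epsilon>4(1) ie ge c0s4 unfolding c04 abs_le_iff by linarith
    have "N g \<le> N (G x) + N e"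
      using L2_set_triangle_ineq[of "G x" e I] by (simp add: e_def)
    also have "N e \<le> 1 * s ^ 3" by (rule order_trans[OF Ne mult_right_mono[OF \<epsilon>(2)]]) (use s in simp)
    finally have Ngu: "N g \<le> (C + 1) * s ^ 3" using NG by (simp add: distrib_right)
    have "c0 * s ^ 4 \<le> s * N g" using key2 abs_ip_le[of I z g] by (simp add: s_def)
    then have "s * (c0 * s ^ 3) \<le> s * N g" by (simp add: eval_nat_numeral algebra_simps)
    then have Ngl: "c0 * s ^ 3 \<le> N g" using s by simp
    have "0 < c0 * s ^ 3" using c0(1) s by simp
    then have Ng0: "0 < N g" using Ngl by linarith
    define \<sigma> where "\<sigma> = L / (N g)\<^sup>2"
    have \<sigma>0: "0 < \<sigma>" using L0 Ng0 by (simp add: \<sigma>_def)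
    have \<sigma>u: "\<sigma> * s\<^sup>2 \<le> (C + 1) / c0\<^sup>2"
    proof -
      have "\<sigma> \<le> ((C + 1) * s ^ 4) / (c0 * s ^ 3)\<^sup>2"
        unfolding \<sigma>_def using Lu L0 Ngl c0(1) s C(1) by (intro frac_le power_mono) auto
      also have "\<dots> = (C + 1) / c0\<^sup>2 / s\<^sup>2" using s c0(1) by (simp add: power2_eq_square eval_nat_numeral)
      finally show ?thesis using s(1) by (simp only: pos_le_divide_eq zero_less_power)
    qed
    have \<sigma>l: "c0 / (2 * (C + 1)\<^sup>2) \<le> \<sigma> * s\<^sup>2"
    proof -
      have "(c0 / 2 * s ^ 4) / ((C + 1) * s ^ 3)\<^sup>2 \<le> \<sigma>"
        unfolding \<sigma>_def using Ll L0 Ngu Ng0 c0(1) s by (intro frac_le power_mono) auto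
      also have "(c0 / 2 * s ^ 4) / ((C + 1) * s ^ 3)\<^sup>2 = c0 / (2 * (C + 1)\<^sup>2) / s\<^sup>2"
        using s C(1) by (simp add: power2_eq_square eval_nat_numeral)
      finally show ?thesis using s(1) by (simp only: pos_divide_le_eq zero_less_power)
    qed
    define z' where "z' = (\<lambda>p. z p - \<sigma> * g p)"
    have "(N z')\<^sup>2 = s\<^sup>2 - 2 * \<sigma> * ip I z g + \<sigma>\<^sup>2 * (N g)\<^sup>2"
      unfolding ip_self[symmetric] z'_def s_def
      by (simp add: ip_linear ip_commute[of I g z] power2_eq_square algebra_simps)
    also have "\<sigma>\<^sup>2 * (N g)\<^sup>2 = \<sigma> * L" using Ng0 by (simp add: \<sigma>_def power2_eq_square)
    finally have "(N z')\<^sup>2 = s\<^sup>2 - \<sigma> * (2 * ip I z g - L)" by (simp add: algebra_simps)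
    also have "\<dots> \<le> s\<^sup>2 - \<sigma> * (c0 * s ^ 4)" using key \<sigma>0 by (simp add: mult_left_mono)
    also have "\<sigma> * (c0 * s ^ 4) = (\<sigma> * s\<^sup>2) * (c0 * s\<^sup>2)" by (simp add: eval_nat_numeral algebra_simps)
    also have "s\<^sup>2 - (\<sigma> * s\<^sup>2) * (c0 * s\<^sup>2) \<le> s\<^sup>2 - (c0 / (2 * (C + 1)\<^sup>2)) * (c0 * s\<^sup>2)"
      using \<sigma>l c0(1) by (intro diff_left_mono mult_right_mono) auto
    also have "\<dots> = s\<^sup>2 - (c0\<^sup>2 / (2 * (C + 1)\<^sup>2)) * s\<^sup>2" by (simp add: power2_eq_square)
    also have "\<dots> \<le> s\<^sup>2 - c1 * s\<^sup>2" using c1 by (intro diff_left_mono mult_right_mono) auto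
    finally have z'2: "(N z')\<^sup>2 \<le> s\<^sup>2 - c1 * s\<^sup>2" .
    moreover have "0 \<le> c1 * s\<^sup>2" using c1(1) by simp
    ultimately have "(N z')\<^sup>2 \<le> s\<^sup>2" by linarith
    then have z's: "N z' \<le> s" by (rule power2_le_imp_le) (use s in simp)
    obtain ke re where ke: "ker ke" "ran re" "\<And>p. e p = ke p + re p" using decomp[of e] by blast
    have Nre: "N re \<le> \<epsilon> * s ^ 3" using decomp_norm(3)[OF ke] Ne by simp
    \<comment> \<open>The kernel part of the gradient has full order s^3 but moves only
      \<open>v'\<close>. Into \<open>u'\<close> enter \<open>r\<close> and \<open>re\<close> alone,
      both of order \<epsilon> s^3.\<close>
    define u' where "u' = (\<lambda>p. u p + (- \<sigma>) * (r p + re p))"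
    define v' where "v' = (\<lambda>p. v p + (- \<sigma>) * (k p + ke p))"
    have kv: "ker v'" unfolding v'_def by (intro ker_add ker_scale vu kr ke)
    have ru: "ran u'" unfolding u'_def by (intro ran_add ran_scale vu kr ke)
    have zz: "\<forall>p\<in>I. z' p = v' p + u' p"
    proof
      fix p assume p: "p \<in> I"
      have "g p = G x p + e p" by (simp add: e_def)
      then show "z' p = v' p + u' p" using p vu(3) kr(3) ke(3)
        by (simp add: z'_def v'_def u'_def algebra_simps)
    qed
    have Nu': "N u' \<le> t * s"
    proof -
      have "N u' \<le> N u + N (\<lambda>p. (- \<sigma>) * (r p + re p))" unfolding u'_def by (rule L2_set_triangle_ineq)
      also have "N (\<lambda>p. (- \<sigma>) * (r p + re p)) = \<sigma> * N (\<lambda>p. r p + re p)"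
        unfolding L2_set_scale using \<sigma>0 by simp
      also have "\<dots> \<le> \<sigma> * (C * \<epsilon> * s ^ 3 + \<epsilon> * s ^ 3)"
        using \<sigma>0 Nr Nre L2_set_triangle_ineq[of r re I] by (intro mult_left_mono) auto
      also have "\<dots> = (\<sigma> * s\<^sup>2) * ((C + 1) * \<epsilon> * s)" by (simp add: eval_nat_numeral algebra_simps)
      also have "\<dots> \<le> ((C + 1) / c0\<^sup>2) * ((C + 1) * \<epsilon> * s)" using \<sigma>u C(1) \<epsilon>(1) s by (intro mult_right_mono) auto
      also have "\<dots> = K * \<epsilon> * s" by (simp add: K_def)
      also have "\<dots> \<le> t / 2 * s" using \<epsilon>' s by (intro mult_right_mono) auto
      also have "N u \<le> t / 2 * s"
      proof -
        have "C * s \<le> t / 2" using mult_left_mono[OF s(2), of C] C(1) \<rho>'(2) by linarith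
        then have "C * s * s \<le> t / 2 * s" using s by (intro mult_right_mono) auto
        then show ?thesis using vu(4) by (simp add: power2_eq_square mult.assoc)
      qed
      finally show ?thesis by (simp add: mult.commute)
    qed
    have "(N u')\<^sup>2 + N z' ^ 3 \<le> (2 * t) * s\<^sup>2"
    proof -
      have "(N u')\<^sup>2 \<le> (t * s)\<^sup>2" using Nu' by (intro power_mono) auto
      also have "\<dots> = (t * t) * s\<^sup>2" by (simp add: power2_eq_square)
      also have "\<dots> \<le> (t * 1) * s\<^sup>2" using t by (intro mult_right_mono mult_left_mono) auto
      finally have 1: "(N u')\<^sup>2 \<le> t * s\<^sup>2" by simp
      have "N z' ^ 3 \<le> s ^ 3" using z's by (intro power_mono) auto
      also have "\<dots> = s * s\<^sup>2" by (simp add: eval_nat_numeral)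
      also have "\<dots> \<le> t * s\<^sup>2" using s \<rho> by (intro mult_right_mono) auto
      finally show ?thesis using 1 by simp
    qed
    then have "C6 * ((N u')\<^sup>2 + N z' ^ 3) \<le> C6 * ((2 * t) * s\<^sup>2)" using C6(1) by (intro mult_left_mono) auto
    moreover have "f (\<lambda>p. x0 p + z' p) \<le> C6 * ((N u')\<^sup>2 + N z' ^ 3)"
      using z's s by (intro C6(2)[OF kv ru zz]) auto
    ultimately have "A * f (\<lambda>p. x0 p + z' p) \<le> A * (C6 * ((2 * t) * s\<^sup>2))" using A by (intro mult_left_mono) auto
    also have "\<dots> = (A * (C6 * (2 * t))) * s\<^sup>2" by simp
    also have "\<dots> \<le> c1 / 2 * s\<^sup>2" using tc by (intro mult_right_mono) auto
    finally have "(N z')\<^sup>2 + A * f (\<lambda>p. x0 p + z' p) \<le> (1 - c1 / 2) * s\<^sup>2"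
      using z'2 by (simp add: algebra_simps)
    then show ?thesis unfolding q(3) z'_def \<sigma>_def s_def .
  qed
  show ?thesis
    by (intro exI[of _ q] conjI exI[of _ \<epsilon>] exI[of _ \<rho>] allI impI q(1,2) \<epsilon>(1) \<rho>(1) main)
qed

text \<open>By \<open>monotonicity\<close> the first-order change of |z|^2 is harmful by at most a
  multiple of \<eta> |G|^2, while the descent inequality lowers f by a comparable amount. A
  sufficiently large multiple of f therefore compensates everything, including the second-order
  terms for small \<eta>.\<close>

lemma gradient_step:
  "\<exists>A>0. \<exists>\<eta>ub>0. \<exists>\<epsilon>>0. \<exists>\<rho>>0. \<forall>z g \<eta>. N z \<le> \<rho> \<longrightarrow> N (\<lambda>p. z p - \<eta> * g p) \<le> \<rho> \<longrightarrow>
     N (\<lambda>p. g p - G (\<lambda>p. x0 p + z p) p) \<le> \<epsilon> * N z ^ 3 \<longrightarrow> 0 < \<eta> \<longrightarrow> \<eta> < \<eta>ub \<longrightarrow>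
     (N (\<lambda>p. z p - \<eta> * g p))\<^sup>2 + A * f (\<lambda>p. x0 p + (z p - \<eta> * g p)) \<le> (N z)\<^sup>2 + A * f (\<lambda>p. x0 p + z p)"
proof -
  obtain A c \<rho>0 where Ac: "0 < A" "0 < c" "0 < \<rho>0" "\<And>z. N z \<le> \<rho>0 \<Longrightarrow>
     c * N z ^ 4 \<le> ip I z (G (\<lambda>p. x0 p + z p)) + A * (N (G (\<lambda>p. x0 p + z p)))\<^sup>2"
    using monotonicity by blast
  obtain C where C: "0 < C" "\<And>z h. N z \<le> 1 \<Longrightarrow> N (\<lambda>p. z p + h p) \<le> 1 \<Longrightarrow>
     f (\<lambda>p. x0 p + (z p + h p)) \<le> f (\<lambda>p. x0 p + z p) + ip I h (G (\<lambda>p. x0 p + z p)) + C * (N h)\<^sup>2"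
    using descent by blast
  \<comment> \<open>Half of B |g|^2 equals 8 A |g|^2. One half of it pays for the terms quadratic in
    \<eta>, the other for the deficit 2 A |G|^2, because |g|^2 is at least |G|^2 / 2 up to
    |e|^2.\<close>
  define B where "B = 16 * A"
  define \<eta>ub where "\<eta>ub = 4 * A / (1 + B * C)"
  have B: "0 < B" using Ac by (simp add: B_def)
  have BC: "0 < 1 + B * C" using B C(1) by (simp add: add_pos_pos)
  have \<eta>ub: "0 < \<eta>ub" using Ac BC by (simp add: \<eta>ub_def)
  \<comment> \<open>The error \<open>e\<close> costs 2 \<epsilon> s^4 in \<langle>z, g\<rangle> and
    12 A |e|^2 in the gradient terms, to be covered by 2 c s^4.\<close>
  define \<epsilon> where "\<epsilon> = min 1 (c / (1 + 6 * A))"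
  have \<epsilon>: "0 < \<epsilon>" "\<epsilon> \<le> 1" using Ac(1,2) by (auto simp: \<epsilon>_def)
  have "\<epsilon> \<le> c / (1 + 6 * A)" by (simp add: \<epsilon>_def)
  then have \<epsilon>c: "\<epsilon> * (1 + 6 * A) \<le> c" using Ac(1) by (simp add: pos_le_divide_eq)
  define \<rho> where "\<rho> = min 1 \<rho>0"
  have \<rho>: "0 < \<rho>" "\<rho> \<le> 1" "\<rho> \<le> \<rho>0" using Ac by (auto simp: \<rho>_def)
  have main: "(N (\<lambda>p. z p - \<eta> * g p))\<^sup>2 + B * f (\<lambda>p. x0 p + (z p - \<eta> * g p)) \<le> (N z)\<^sup>2 + B * f (\<lambda>p. x0 p + z p)"
    if z: "N z \<le> \<rho>" "N (\<lambda>p. z p - \<eta> * g p) \<le> \<rho>"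
      and g: "N (\<lambda>p. g p - G (\<lambda>p. x0 p + z p) p) \<le> \<epsilon> * N z ^ 3" and \<eta>: "0 < \<eta>" "\<eta> < \<eta>ub" for z g \<eta>
  proof -
    define x where "x = (\<lambda>p. x0 p + z p)"
    define s where "s = N z"
    have s: "0 \<le> s" "s \<le> 1" using z \<rho> by (auto simp: s_def)
    define e where "e = (\<lambda>p. g p - G x p)"
    have Ne: "N e \<le> \<epsilon> * s ^ 3" using g by (simp add: e_def x_def s_def)
    have zg: "(N (\<lambda>p. z p - \<eta> * g p))\<^sup>2 = s\<^sup>2 - 2 * \<eta> * ip I z g + \<eta>\<^sup>2 * (N g)\<^sup>2"
      unfolding ip_self[symmetric] s_def
      by (simp add: ip_linear ip_commute[of I g z] power2_eq_square algebra_simps)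
    have "f (\<lambda>p. x0 p + (z p + (- \<eta>) * g p)) \<le> f x + ip I (\<lambda>p. (- \<eta>) * g p) (G x) + C * (N (\<lambda>p. (- \<eta>) * g p))\<^sup>2"
      using C(2)[of z "\<lambda>p. (- \<eta>) * g p"] z \<rho> by (simp add: x_def)
    then have fd: "f (\<lambda>p. x0 p + (z p - \<eta> * g p)) \<le> f x - \<eta> * ip I g (G x) + C * (\<eta>\<^sup>2 * (N g)\<^sup>2)"
      unfolding ip_scale_left L2_set_scale by (simp add: power_mult_distrib)
    have ie: "- (\<epsilon> * s ^ 4) \<le> ip I z e"
    proof -
      have "\<bar>ip I z e\<bar> \<le> s * N e" using abs_ip_le[of I z e] by (simp add: s_def)
      also have "\<dots> \<le> s * (\<epsilon> * s ^ 3)" using Ne s by (intro mult_left_mono) auto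
      finally show ?thesis by (simp add: eval_nat_numeral algebra_simps abs_le_iff)
    qed
    have ge: "ip I z g = ip I z (G x) + ip I z e" by (simp add: e_def ip_linear)
    have igG: "(N g)\<^sup>2 / 2 - (N e)\<^sup>2 / 2 \<le> ip I g (G x)"
    proof -
      have "ip I g (G x) = (N g)\<^sup>2 - ip I g e" by (simp add: e_def ip_linear ip_self)
      moreover have "ip I g e \<le> N g * N e" using abs_ip_le[of I g e] by linarith
      moreover have "N g * N e \<le> (N g)\<^sup>2 / 2 + (N e)\<^sup>2 / 2"
        using sum_squares_bound[of "N g" "N e"] by simp
      ultimately show ?thesis by linarith
    qed
    have nG: "(N (G x))\<^sup>2 / 2 - (N e)\<^sup>2 \<le> (N g)\<^sup>2"
    proof -
      have "N (G x) \<le> N g + N e" using L2_set_diff_le[of g e I] by (simp add: e_def)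
      then have "(N (G x))\<^sup>2 \<le> (N g + N e)\<^sup>2" by (intro power_mono) auto
      then show ?thesis using sum_squares_bound[of "N g" "N e"] by (simp add: power2_sum)
    qed
    have Ne2: "(N e)\<^sup>2 \<le> \<epsilon> * s ^ 4"
    proof -
      have "(N e)\<^sup>2 \<le> (\<epsilon> * s ^ 3)\<^sup>2" using Ne by (intro power_mono) auto
      also have "\<dots> = (\<epsilon> * \<epsilon>) * s ^ 6" by (simp add: power_mult_distrib power2_eq_square eval_nat_numeral)
      also have "\<dots> \<le> (\<epsilon> * 1) * s ^ 4" using \<epsilon> s by (intro mult_mono power_decreasing) auto
      finally show ?thesis by simp
    qed
    have mon: "c * s ^ 4 \<le> ip I z (G x) + A * (N (G x))\<^sup>2" using Ac(4)[of z] z \<rho> by (simp add: x_def s_def)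
    have "\<eta> * (1 + B * C) \<le> 4 * A" using \<eta>(2) BC by (simp add: \<eta>ub_def field_simps)
    then have "\<eta> * (1 + B * C) * (N g)\<^sup>2 \<le> 4 * A * (N g)\<^sup>2" by (intro mult_right_mono) auto
    then have 1: "\<eta> * (N g)\<^sup>2 + B * (C * (\<eta> * (N g)\<^sup>2)) \<le> 4 * A * (N g)\<^sup>2" by (simp add: algebra_simps)
    have 2: "B * ((N g)\<^sup>2 / 2 - (N e)\<^sup>2 / 2) \<le> B * ip I g (G x)" using igG B by (intro mult_left_mono) auto
    have 3: "4 * A * ((N (G x))\<^sup>2 / 2 - (N e)\<^sup>2) \<le> 4 * A * (N g)\<^sup>2" using nG Ac by (intro mult_left_mono) auto
    have 4: "12 * A * (N e)\<^sup>2 \<le> 12 * A * (\<epsilon> * s ^ 4)" using Ne2 Ac by (intro mult_left_mono) auto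
    have 5: "\<epsilon> * (1 + 6 * A) * s ^ 4 \<le> c * s ^ 4" using \<epsilon>c by (intro mult_right_mono) auto
    have "- 2 * ip I z g + \<eta> * (N g)\<^sup>2 - B * ip I g (G x) + B * (C * (\<eta> * (N g)\<^sup>2)) \<le> 0"
      using 1 2 3 4 5 mon ge ie unfolding B_def by (simp add: algebra_simps)
    then have "\<eta> * (- 2 * ip I z g + \<eta> * (N g)\<^sup>2 - B * ip I g (G x) + B * (C * (\<eta> * (N g)\<^sup>2))) \<le> 0"
      using \<eta> by (simp add: mult_le_0_iff)
    moreover have "B * f (\<lambda>p. x0 p + (z p - \<eta> * g p)) \<le> B * (f x - \<eta> * ip I g (G x) + C * (\<eta>\<^sup>2 * (N g)\<^sup>2))"
      using fd B by (intro mult_left_mono) auto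
    ultimately show ?thesis
      unfolding zg by (simp add: x_def s_def power2_eq_square algebra_simps)
  qed
  show ?thesis
    by (intro exI[of _ B] exI[of _ \<eta>ub] exI[of _ \<epsilon>] exI[of _ \<rho>] conjI allI impI B \<eta>ub \<epsilon>(1) \<rho>(1) main)
qed

end

section \<open>The ravine and the contraction theorem\<close>

lemma edist_nonneg [simp]: "0 \<le> edist I x y"
  by (simp add: edist_def)

lemma edist_self [simp]: "edist I x x = 0"
  by (simp add: edist_def L2_set_0')

lemma edist_commute: "edist I x y = edist I y x"
  unfolding edist_def by (rule L2_set_diff_commute)

lemma edist_triangle: "edist I x z \<le> edist I x y + edist I y z"
  unfolding edist_def by (rule L2_set_diff_triangle)

lemma abs_coord_le_edist: "finite I \<Longrightarrow> p \<in> I \<Longrightarrow> \<bar>x p - y p\<bar> \<le> edist I x y"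
  using member_le_L2_set[of I p "\<lambda>p. \<bar>x p - y p\<bar>"] by (simp add: edist_def L2_set_def)

lemma continuous_on_edist: "continuous_on S (\<lambda>y. edist I y x)"
  unfolding edist_def L2_set_def
  by (intro continuous_intros continuous_on_subset[OF continuous_on_product_coordinates]) auto

lemma square_powr_three_halves:
  assumes "0 \<le> (a::real)"
  shows "(a\<^sup>2) powr (3/2) = a ^ 3"
proof -
  have "(a\<^sup>2) powr (3/2) = (a powr 2) powr (3/2)" using assms by simp
  also have "\<dots> = a powr 3" by (simp only: powr_powr) simp
  also have "\<dots> = a ^ 3" using assms by simp
  finally show ?thesis .
qed

locale smooth_min_grad = smooth_min +
  assumes x0: "x0 \<in> euclid I"
    and G_partial: "p \<in> I \<Longrightarrow> G x p = partial p f x"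
    and H_partial: "p \<in> I \<Longrightarrow> q \<in> I \<Longrightarrow> H p q = partial p (partial q f) x0"
begin

text \<open>\<open>H\<close> is symmetric, so the orthogonal complement of its range is its kernel.
  The definite description in \<open>orth_proj\<close> requires uniqueness: two candidates agree on
  \<open>I\<close> by orthogonality and outside \<open>I\<close> by extensionality.\<close>

lemma orth_proj_zero_iff: "orth_proj I (hess I f x0 ` euclid I) g = (\<lambda>i\<in>I. 0) \<longleftrightarrow> ker g"
proof -
  define V where "V = hess I f x0 ` euclid I"
  have hess: "hess I f x0 v = restrict (Hm v) I" for v
    unfolding hess_def Hm_def by (intro restrict_ext sum.cong) (simp_all add: H_partial)
  have ranV: "ran w" if "w \<in> V" for w
    using that by (auto simp: V_def hess ran_def)
  have Vran: "restrict w I \<in> V" if w: "ran w" for w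
  proof -
    obtain \<xi> where \<xi>: "\<forall>p\<in>I. w p = Hm \<xi> p" using w by (auto simp: ran_def)
    have "Hm (restrict \<xi> I) = Hm \<xi>" by (rule Hm_cong) simp
    then have "restrict w I = hess I f x0 (restrict \<xi> I)" using \<xi> by (auto simp: hess)
    moreover have "restrict \<xi> I \<in> euclid I" by (auto simp: euclid_def)
    ultimately show ?thesis by (simp add: V_def)
  qed
  obtain k r where kr: "ker k" "ran r" "\<And>p. g p = k p + r p" using decomp[of g] by blast
  define w0 where "w0 = restrict r I"
  have w0: "w0 \<in> V \<and> (\<forall>u\<in>V. (\<Sum>i\<in>I. (g i - w0 i) * u i) = 0)"
  proof (intro conjI ballI)
    show "w0 \<in> V" unfolding w0_def by (rule Vran[OF kr(2)])
    fix u assume "u \<in> V"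
    then have "ip I k u = 0" using ker_ran[OF kr(1) ranV] by simp
    moreover have "(\<Sum>i\<in>I. (g i - w0 i) * u i) = ip I k u"
      unfolding ip_def by (intro sum.cong refl) (simp add: w0_def kr(3))
    ultimately show "(\<Sum>i\<in>I. (g i - w0 i) * u i) = 0" by simp
  qed
  have "w = w0" if w: "w \<in> V \<and> (\<forall>u\<in>V. (\<Sum>i\<in>I. (g i - w i) * u i) = 0)" for w
  proof -
    have z: "ip I (\<lambda>i. w i - w0 i) u = 0" if "u \<in> V" for u
    proof -
      have "ip I (\<lambda>i. g i - w0 i) u = 0" "ip I (\<lambda>i. g i - w i) u = 0"
        unfolding ip_def using conjunct2[OF w] conjunct2[OF w0] that by blast+
      then show ?thesis by (simp add: ip_diff_left)
    qed
    have "ip I (\<lambda>i. w i - w0 i) (\<lambda>i. w i - w0 i) = ip I (\<lambda>i. w i - w0 i) w - ip I (\<lambda>i. w i - w0 i) w0"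
      by (rule ip_diff_right)
    also have "\<dots> = 0" using z[OF conjunct1[OF w]] z[OF conjunct1[OF w0]] by simp
    finally have eq: "\<forall>i\<in>I. w i = w0 i" using fin by (simp add: ip_self L2_set_eq_0_iff)
    have "w \<in> extensional I" using conjunct1[OF w] by (auto simp: V_def hess)
    moreover have "w0 \<in> extensional I" by (simp add: w0_def)
    ultimately show ?thesis using eq by (intro extensionalityI) auto
  qed
  then have "orth_proj I V g = w0" unfolding orth_proj_def using w0 by (intro the_equality)
  moreover have "w0 = (\<lambda>i\<in>I. 0) \<longleftrightarrow> ker g"
  proof
    assume eq: "w0 = (\<lambda>i\<in>I. 0)"
    have "r i = 0" if i: "i \<in> I" for i
    proof -
      have "r i = w0 i" using i by (simp add: w0_def)
      then show ?thesis using i by (simp add: eq)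
    qed
    then have "Hm g = Hm k" by (intro Hm_cong) (simp add: kr(3))
    then show "ker g" using kr(1) by (simp add: ker_def)
  next
    assume g: "ker g"
    have "ker (\<lambda>p. g p + (-1) * k p)" by (intro ker_add ker_scale g kr(1))
    from ker_ran[OF this kr(2)] have "ip I r r = 0" by (simp add: kr(3))
    then have "\<forall>i\<in>I. r i = 0" using fin by (simp add: ip_self L2_set_eq_0_iff)
    then show "w0 = (\<lambda>i\<in>I. 0)" by (auto simp: w0_def restrict_def)
  qed
  ultimately show ?thesis by (simp add: V_def)
qed

lemma ravine_iff: "x \<in> ravine I f x0 r \<longleftrightarrow> x \<in> euclid I \<and> edist I x x0 < r \<and> ker (G x)"
proof -
  have "Hm (grad I f x) = Hm (G x)" by (rule Hm_cong) (simp add: grad_def G_partial)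
  then show ?thesis by (simp add: ravine_def orth_proj_zero_iff ker_def)
qed

text \<open>Continuity in the product topology, in which the Euclidean distance is continuous; it
  makes the ravine relatively closed.\<close>

lemma continuous_on_G:
  assumes p: "p \<in> I"
  shows "continuous_on {y. edist I y x0 \<le> 1} (\<lambda>y. G y p)"
proof -
  obtain C where C: "0 < C" "\<And>x y. N (\<lambda>p. x p - x0 p) \<le> 1 \<Longrightarrow> N (\<lambda>p. y p - x0 p) \<le> 1 \<Longrightarrow>
      N (\<lambda>p. G x p - G y p) \<le> C * N (\<lambda>p. x p - y p)"
    using G_lip by auto
  show ?thesis
    unfolding continuous_on_def
  proof
    fix x assume x: "x \<in> {y. edist I y x0 \<le> 1}"
    have "((\<lambda>y. edist I y x) \<longlongrightarrow> edist I x x) (at x within {y. edist I y x0 \<le> 1})"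
      using continuous_on_edist[of "{y. edist I y x0 \<le> 1}" I x] x unfolding continuous_on_def by blast
    then have "((\<lambda>y. C * edist I y x) \<longlongrightarrow> 0) (at x within {y. edist I y x0 \<le> 1})"
      by (auto intro: tendsto_mult_right_zero)
    then have "((\<lambda>y. G y p - G x p) \<longlongrightarrow> 0) (at x within {y. edist I y x0 \<le> 1})"
    proof (rule Lim_null_comparison[rotated])
      show "\<forall>\<^sub>F y in at x within {y. edist I y x0 \<le> 1}. norm (G y p - G x p) \<le> C * edist I y x"
        unfolding eventually_at_filter
      proof (intro always_eventually allI impI)
        fix y assume "y \<noteq> x" "y \<in> {y. edist I y x0 \<le> 1}"
        then have "N (\<lambda>p. G y p - G x p) \<le> C * edist I y x"
          using C(2)[of y x] x by (simp add: edist_def)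
        moreover have "\<bar>G y p - G x p\<bar> \<le> N (\<lambda>p. G y p - G x p)"
          using abs_coord_le_edist[OF fin p, of "G y" "G x"] by (simp add: edist_def)
        ultimately show "norm (G y p - G x p) \<le> C * edist I y x" by simp
      qed
    qed
    then show "((\<lambda>y. G y p) \<longlongrightarrow> G x p) (at x within {y. edist I y x0 \<le> 1})"
      by (simp add: LIM_zero_iff)
  qed
qed

text \<open>The ravine is cut out by an open ball, so a minimiser is first found in the closed ball
  of radius \<open>r / 2\<close>, which is compact. For \<open>x\<close> within \<open>r / 4\<close>
  of \<open>x0\<close>, any ravine point outside that ball is farther from \<open>x\<close> than
  \<open>x0\<close>, itself a ravine point.\<close>

lemma nearest_ravine:
  assumes r: "0 < r" "r \<le> 1" and x: "x \<in> euclid I" "edist I x x0 < r / 4"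
  defines "M \<equiv> ravine I f x0 r"
  shows "nearest I M x \<in> M" "dist_to I M x = edist I x (nearest I M x)"
    "edist I x (nearest I M x) \<le> edist I x x0"
proof -
  \<comment> \<open>The closed ball as a compact subset of a product of intervals; the factor
    \<open>{undefined}\<close> outside \<open>I\<close> encodes extensionality.\<close>
  define K where "K = PiE UNIV (\<lambda>i. if i \<in> I then {x0 i - r / 2 .. x0 i + r / 2} else {undefined}) \<inter>
    {y. edist I y x0 \<le> r / 2}"
  define S where "S = K \<inter> (\<lambda>y. \<Sum>p\<in>I. \<bar>Hm (G y) p\<bar>) -` {0}"
  have "compactin (product_topology (\<lambda>i. euclidean) UNIV)
      (PiE UNIV (\<lambda>i. if i \<in> I then {x0 i - r / 2 .. x0 i + r / 2} else {undefined}))"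
    unfolding compactin_PiE by auto
  then have "compact (PiE UNIV (\<lambda>i. if i \<in> I then {x0 i - r / 2 .. x0 i + r / 2} else {undefined}))"
    by (simp add: euclidean_product_topology)
  moreover have "closed {y. edist I y x0 \<le> r / 2}"
    by (intro closed_Collect_le continuous_on_edist continuous_on_const)
  ultimately have "compact K" unfolding K_def by (rule compact_Int_closed)
  moreover have "closedin (top_of_set K) S"
    unfolding S_def
  proof (rule continuous_closedin_preimage)
    have "K \<subseteq> {y. edist I y x0 \<le> 1}" using r by (auto simp: K_def)
    then show "continuous_on K (\<lambda>y. \<Sum>p\<in>I. \<bar>Hm (G y) p\<bar>)"
      unfolding Hm_def
      by (intro continuous_intros continuous_on_subset[OF continuous_on_G]) auto
  qed simp
  ultimately have S: "compact S" by (rule closedin_compact)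
  have SM: "y \<in> S \<longleftrightarrow> y \<in> M \<and> edist I y x0 \<le> r / 2" for y
  proof -
    have "y \<in> PiE UNIV (\<lambda>i. if i \<in> I then {x0 i - r / 2 .. x0 i + r / 2} else {undefined}) \<longleftrightarrow> y \<in> euclid I"
      if d: "edist I y x0 \<le> r / 2"
    proof -
      have "y i \<in> {x0 i - r / 2 .. x0 i + r / 2}" if i: "i \<in> I" for i
      proof -
        have "\<bar>y i - x0 i\<bar> \<le> r / 2"
          using abs_coord_le_edist[OF fin i, of y x0] d by linarith
        then show ?thesis unfolding abs_diff_le_iff by simp
      qed
      then have "(\<forall>i. y i \<in> (if i \<in> I then {x0 i - r / 2 .. x0 i + r / 2} else {undefined})) \<longleftrightarrow>
          (\<forall>i. i \<notin> I \<longrightarrow> y i = undefined)"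
        by (metis singleton_iff)
      then show ?thesis by (simp add: euclid_def PiE_iff extensional_def)
    qed
    moreover have "(\<Sum>p\<in>I. \<bar>Hm (G y) p\<bar>) = 0 \<longleftrightarrow> ker (G y)"
      by (simp add: ker_def sum_nonneg_eq_0_iff[OF fin])
    ultimately show ?thesis using r by (auto simp: S_def K_def M_def ravine_iff)
  qed
  have "ker (G x0)" by (simp add: ker_def Hm_def G0)
  then have x0S: "x0 \<in> S" using r x0 by (simp add: SM M_def ravine_iff)
  obtain y where y: "y \<in> S" "\<And>y'. y' \<in> S \<Longrightarrow> edist I x y \<le> edist I x y'"
    using continuous_attains_inf[OF S _ continuous_on_edist[of S I x]] x0S
    by (auto simp: edist_commute[of I x])
  have min: "edist I x y \<le> edist I x y'" if "y' \<in> M" for y'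
  proof (cases "edist I y' x0 \<le> r / 2")
    case True
    then show ?thesis using y(2) SM that by auto
  next
    case False
    have "edist I y' x0 \<le> edist I x y' + edist I x x0"
      using edist_triangle[of I y' x0 x] by (simp add: edist_commute)
    then show ?thesis using False y(2)[OF x0S] x(2) by simp
  qed
  have "is_arg_min (edist I x) (\<lambda>y. y \<in> M) y"
    using y(1) SM min by (auto simp: is_arg_min_def not_less)
  \<comment> \<open>\<open>nearest\<close> may select any one of several minimisers; all that is
    used of it is minimality.\<close>
  then have "is_arg_min (edist I x) (\<lambda>y. y \<in> M) (nearest I M x)"
    unfolding nearest_def arg_min_on_def arg_min_def
    by (rule someI[where P = "is_arg_min (edist I x) (\<lambda>y. y \<in> M)"])
  then have n: "nearest I M x \<in> M" "\<And>y'. y' \<in> M \<Longrightarrow> edist I x (nearest I M x) \<le> edist I x y'"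
    by (auto simp: is_arg_min_def not_less)
  then show "nearest I M x \<in> M" by simp
  show "dist_to I M x = edist I x (nearest I M x)"
    unfolding dist_to_def using n by (intro cInf_eq_minimum) auto
  show "edist I x (nearest I M x) \<le> edist I x x0" using n(2) x0S SM by auto
qed

text \<open>Extending the gradient by \<open>0\<close> outside \<open>I\<close> turns the restricted step into plain vector
  arithmetic, because \<open>x\<close> and \<open>x0\<close> are both \<^const>\<open>undefined\<close> there.\<close>

lemma gd_step_eq:
  assumes "x \<in> euclid I" and g_def: "g = (\<lambda>p. if p \<in> I then partial p L x else 0)"
  shows "gd_step I L s x = (\<lambda>p. x0 p + ((x p - x0 p) - s * g p))"
    and "L2_set (grad I L x) I = N g"
proof -
  have "x p = undefined" "x0 p = undefined" if "p \<notin> I" for p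
    using assms(1) x0 that by (auto simp: euclid_def PiE_def extensional_def)
  then show "gd_step I L s x = (\<lambda>p. x0 p + ((x p - x0 p) - s * g p))"
    by (auto simp: gd_step_def grad_def g_def)
  show "L2_set (grad I L x) I = N g" by (intro L2_set_cong) (auto simp: grad_def g_def)
qed

text \<open>The perturbed loss, the spread and the mismatch vary with the student weights, whereas
  the neighborhood and the constants must not. Hence \<open>L\<close>, \<open>D\<close> and \<Delta>
  are quantified inside and are known only through the fixed constants \<open>CD\<close> and
  \<open>Ce\<close>.\<close>

definition contracts ::
  "real \<Rightarrow> real \<Rightarrow> real \<Rightarrow> real \<Rightarrow> ('a \<Rightarrow> real) set \<Rightarrow> real \<Rightarrow> real \<Rightarrow> real \<Rightarrow> bool" where
  "contracts CD Ce r \<tau> W q \<eta>ub \<kappa>0 \<longleftrightarrow> (\<forall>L D \<Delta> \<kappa> \<eta> x K.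
    (\<forall>y. 0 \<le> D y \<and> D y \<le> CD * (edist I y x0)\<^sup>2) \<longrightarrow> 0 \<le> \<Delta> \<longrightarrow>
    (\<forall>x. edist I x x0 \<le> 1 \<longrightarrow> L2_set (\<lambda>p. partial p L x - G x p) I \<le> Ce * \<Delta> \<and>
      \<bar>L x - f x\<bar> \<le> Ce * (\<Delta> * edist I x x0 + \<Delta>\<^sup>2)) \<longrightarrow>
    \<kappa>0 \<le> \<kappa> \<longrightarrow> 0 < \<eta> \<longrightarrow> \<eta> < \<eta>ub \<longrightarrow>
    x \<in> W \<longrightarrow> x \<in> tube I (ravine I f x0 r) D \<tau> \<longrightarrow> x \<notin> core I (ravine I f x0 r) D \<kappa> \<Delta> \<longrightarrow>
    (\<forall>j\<le>K. (gd_step I L \<eta> ^^ j) (polyak_step I L x) \<in> W) \<longrightarrow>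
    (\<forall>j<K. (gd_step I L \<eta> ^^ j) (polyak_step I L x) \<notin> core I (ravine I f x0 r) D \<kappa> \<Delta>) \<longrightarrow>
    edist I ((gd_step I L \<eta> ^^ K) (polyak_step I L x)) x0 \<le> q * edist I x x0)"

lemma contractsD:
  assumes "contracts CD Ce r \<tau> W q \<eta>ub \<kappa>0"
    and "\<And>y. 0 \<le> D y" "\<And>y. D y \<le> CD * (edist I y x0)\<^sup>2" and "0 \<le> \<Delta>"
    and "\<And>x. edist I x x0 \<le> 1 \<Longrightarrow> L2_set (\<lambda>p. partial p L x - G x p) I \<le> Ce * \<Delta> \<and>
      \<bar>L x - f x\<bar> \<le> Ce * (\<Delta> * edist I x x0 + \<Delta>\<^sup>2)"
    and "\<kappa>0 \<le> \<kappa>" "0 < \<eta>" "\<eta> < \<eta>ub"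
    and "x \<in> W" "x \<in> tube I (ravine I f x0 r) D \<tau>" "x \<notin> core I (ravine I f x0 r) D \<kappa> \<Delta>"
    and "\<forall>j\<le>K. (gd_step I L \<eta> ^^ j) (polyak_step I L x) \<in> W"
    and "\<forall>j<K. (gd_step I L \<eta> ^^ j) (polyak_step I L x) \<notin> core I (ravine I f x0 r) D \<kappa> \<Delta>"
  shows "edist I ((gd_step I L \<eta> ^^ K) (polyak_step I L x)) x0 \<le> q * edist I x x0"
  by (rule assms(1)[unfolded contracts_def, rule_format, of D \<Delta> L \<kappa> \<eta> x K]) (simp_all add: assms(2-))

text \<open>The spread at the nearest point is at most 4 CD |z|^2. Thus membership in the tube
  bounds the distance to the ravine, and absence from the core bounds the mismatch, by small
  multiples of |z|^3; these are the hypotheses of the two step lemmas. The Lyapunov function links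
  them.\<close>

theorem polyak_gradient_contraction:
  assumes CD: "0 < CD" and Ce: "0 < Ce"
  shows "\<exists>r0>0. \<forall>r. 0 < r \<and> r \<le> r0 \<longrightarrow> (\<exists>\<tau>0>0. \<forall>\<tau>. 0 < \<tau> \<and> \<tau> < \<tau>0 \<longrightarrow>
    (\<exists>W q \<eta>ub \<kappa>0. nbhd I x0 W \<and> 0 < q \<and> q < 1 \<and> 0 < \<eta>ub \<and> 1 \<le> \<kappa>0 \<and> contracts CD Ce r \<tau> W q \<eta>ub \<kappa>0))"
proof -
  obtain A \<eta>ub \<epsilon>1 \<rho>1 where A: "0 < A" "0 < \<eta>ub" "0 < \<epsilon>1" "0 < \<rho>1"
    "\<And>z g \<eta>. N z \<le> \<rho>1 \<Longrightarrow> N (\<lambda>p. z p - \<eta> * g p) \<le> \<rho>1 \<Longrightarrow>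
     N (\<lambda>p. g p - G (\<lambda>p. x0 p + z p) p) \<le> \<epsilon>1 * N z ^ 3 \<Longrightarrow> 0 < \<eta> \<Longrightarrow> \<eta> < \<eta>ub \<Longrightarrow>
     (N (\<lambda>p. z p - \<eta> * g p))\<^sup>2 + A * f (\<lambda>p. x0 p + (z p - \<eta> * g p)) \<le> (N z)\<^sup>2 + A * f (\<lambda>p. x0 p + z p)"
    using gradient_step by blast
  obtain q \<epsilon>2 \<rho>2 where q: "0 < q" "q < 1" "0 < \<epsilon>2" "0 < \<rho>2"
    "\<And>z y g L. 0 < N z \<Longrightarrow> N z \<le> \<rho>2 \<Longrightarrow> N (\<lambda>p. y p - x0 p) \<le> 1 \<Longrightarrow> ker (G y) \<Longrightarrow>
     N (\<lambda>p. x0 p + z p - y p) \<le> \<epsilon>2 * N z ^ 3 \<Longrightarrow> N (\<lambda>p. g p - G (\<lambda>p. x0 p + z p) p) \<le> \<epsilon>2 * N z ^ 3 \<Longrightarrow>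
     \<bar>L - f (\<lambda>p. x0 p + z p)\<bar> \<le> \<epsilon>2 * N z ^ 4 \<Longrightarrow>
     (N (\<lambda>p. z p - L / (N g)\<^sup>2 * g p))\<^sup>2 + A * f (\<lambda>p. x0 p + (z p - L / (N g)\<^sup>2 * g p)) \<le> q\<^sup>2 * (N z)\<^sup>2"
    using polyak_contraction[OF A(1)] by blast
  define \<epsilon> where "\<epsilon> = min \<epsilon>1 \<epsilon>2"
  have \<epsilon>: "0 < \<epsilon>" "\<epsilon> \<le> \<epsilon>1" "\<epsilon> \<le> \<epsilon>2" using A(3) q(3) by (auto simp: \<epsilon>_def)
  \<comment> \<open>The terms \<Delta> s and \<Delta>^2 cost \<epsilon>' s^4 each, whence the factor
    2; the cap 1 ensures \<Delta> \<le> s for the second one.\<close>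
  define \<epsilon>' where "\<epsilon>' = min 1 (\<epsilon> / (2 * Ce))"
  have \<epsilon>': "0 < \<epsilon>'" "\<epsilon>' \<le> 1" "\<epsilon>' \<le> \<epsilon> / (2 * Ce)" using \<epsilon>(1) Ce by (auto simp: \<epsilon>'_def)
  have \<epsilon>Ce: "2 * (Ce * \<epsilon>') \<le> \<epsilon>" using \<epsilon>'(3) Ce by (simp add: field_simps)
  \<comment> \<open>Outside the core \<open>\<kappa> * \<Delta> powr (2/3)\<close> is below 4 CD
    s^2; this threshold turns that into \<Delta> \<le> \<epsilon>' s^3.\<close>
  define \<kappa>0 where "\<kappa>0 = max 1 (4 * CD / \<epsilon>' powr (2/3))"
  \<comment> \<open>The power 3/2 of 4 CD |z|^2 is \<open>(4 * CD) powr (3/2)\<close> times |z|^3,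
    so the tube lies within \<epsilon>2 |z|^3 of the ravine.\<close>
  define \<tau>0 where "\<tau>0 = \<epsilon>2 / (4 * CD) powr (3/2)"
  have \<tau>0: "0 < \<tau>0" using q(3) CD by (simp add: \<tau>0_def)
  have main: "edist I ((gd_step I L \<eta> ^^ K) (polyak_step I L x)) x0 \<le> q * edist I x x0"
    if r: "0 < r" "r \<le> 1" and \<tau>: "0 < \<tau>" "\<tau> < \<tau>0"
      and \<rho>: "0 < \<rho>" "\<rho> \<le> \<rho>1" "\<rho> \<le> \<rho>2" "\<rho> \<le> r / 4" "W = {x \<in> euclid I. edist I x x0 < \<rho>}"
      and D: "\<forall>y. 0 \<le> D y \<and> D y \<le> CD * (edist I y x0)\<^sup>2" and \<Delta>: "0 \<le> \<Delta>"
      and L: "\<forall>x. edist I x x0 \<le> 1 \<longrightarrow> L2_set (\<lambda>p. partial p L x - G x p) I \<le> Ce * \<Delta> \<and>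
          \<bar>L x - f x\<bar> \<le> Ce * (\<Delta> * edist I x x0 + \<Delta>\<^sup>2)"
      and \<kappa>: "\<kappa>0 \<le> \<kappa>" and \<eta>: "0 < \<eta>" "\<eta> < \<eta>ub"
      and x: "x \<in> W" "x \<in> tube I (ravine I f x0 r) D \<tau>" "x \<notin> core I (ravine I f x0 r) D \<kappa> \<Delta>"
      and traj: "\<forall>j\<le>K. (gd_step I L \<eta> ^^ j) (polyak_step I L x) \<in> W"
        "\<forall>j<K. (gd_step I L \<eta> ^^ j) (polyak_step I L x) \<notin> core I (ravine I f x0 r) D \<kappa> \<Delta>"
    for r \<tau> \<rho> W L D \<Delta> \<kappa> \<eta> x K
  proof -
    define M where "M = ravine I f x0 r"
    have near: "nearest I M x \<in> M" "dist_to I M x = edist I x (nearest I M x)"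
      "edist I (nearest I M x) x0 \<le> 2 * edist I x x0" "D (nearest I M x) \<le> 4 * CD * (edist I x x0)\<^sup>2"
      if "x \<in> W" for x
    proof -
      have xe: "x \<in> euclid I" "edist I x x0 < r / 4" using that \<rho> by auto
      note n = nearest_ravine[OF r xe, folded M_def]
      show "nearest I M x \<in> M" "dist_to I M x = edist I x (nearest I M x)" by (rule n)+
      show 2: "edist I (nearest I M x) x0 \<le> 2 * edist I x x0"
        using n(3) edist_triangle[of I "nearest I M x" x0 x] by (simp add: edist_commute)
      have "D (nearest I M x) \<le> CD * (edist I (nearest I M x) x0)\<^sup>2" using D by blast
      also have "\<dots> \<le> CD * (2 * edist I x x0)\<^sup>2" using CD 2 by (intro mult_left_mono power_mono) auto
      finally show "D (nearest I M x) \<le> 4 * CD * (edist I x x0)\<^sup>2" by (simp add: power_mult_distrib)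
    qed
    have small: "0 < edist I x x0" "L2_set (\<lambda>p. partial p L x - G x p) I \<le> \<epsilon> * edist I x x0 ^ 3"
      "\<bar>L x - f x\<bar> \<le> \<epsilon> * edist I x x0 ^ 4"
      if xW: "x \<in> W" and xC: "x \<notin> core I M D \<kappa> \<Delta>" for x
    proof -
      define s where "s = edist I x x0"
      have s0: "0 \<le> s" "s \<le> 1" using xW \<rho> r by (auto simp: s_def)
      have xe: "x \<in> euclid I" using xW \<rho> by simp
      have k: "\<kappa> * \<Delta> powr (2/3) < 4 * CD * s\<^sup>2"
        using xC xe near(4)[OF xW] by (auto simp: core_def s_def)
      have k0: "1 \<le> \<kappa>" "4 * CD / \<epsilon>' powr (2/3) \<le> \<kappa>" using \<kappa> by (auto simp: \<kappa>0_def)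
      have "0 \<le> \<kappa> * \<Delta> powr (2/3)" using k0 by simp
      then have "0 < 4 * CD * s\<^sup>2" using k by linarith
      then show s1: "0 < edist I x x0" using s0 by (auto simp: s_def[symmetric] order.strict_iff_order)
      have "4 * CD \<le> \<kappa> * \<epsilon>' powr (2/3)" using k0(2) \<epsilon>'(1) by (simp add: divide_le_eq)
      then have "4 * CD * s\<^sup>2 \<le> \<kappa> * \<epsilon>' powr (2/3) * s\<^sup>2" by (intro mult_right_mono) auto
      then have "\<kappa> * \<Delta> powr (2/3) < \<kappa> * (\<epsilon>' powr (2/3) * s\<^sup>2)" using k by simp
      then have "\<Delta> powr (2/3) \<le> \<epsilon>' powr (2/3) * s\<^sup>2" using k0(1) by simp
      then have "(\<Delta> powr (2/3)) powr (3/2) \<le> (\<epsilon>' powr (2/3) * s\<^sup>2) powr (3/2)"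
        by (intro powr_mono2) auto
      also have "\<dots> = \<epsilon>' * s ^ 3" using \<epsilon>'(1) s0 by (simp add: powr_mult powr_powr square_powr_three_halves)
      finally have d: "\<Delta> \<le> \<epsilon>' * s ^ 3" using \<Delta> by (simp add: powr_powr)
      have Lx: "L2_set (\<lambda>p. partial p L x - G x p) I \<le> Ce * \<Delta>" "\<bar>L x - f x\<bar> \<le> Ce * (\<Delta> * s + \<Delta>\<^sup>2)"
        using L s0 by (auto simp: s_def)
      have "Ce * \<Delta> \<le> Ce * (\<epsilon>' * s ^ 3)" using d Ce by (intro mult_left_mono) auto
      also have "\<dots> \<le> (2 * (Ce * \<epsilon>')) * s ^ 3" using s0 Ce \<epsilon>'(1) by simp
      also have "\<dots> \<le> \<epsilon> * s ^ 3" using \<epsilon>Ce s0 by (intro mult_right_mono) auto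
      finally show "L2_set (\<lambda>p. partial p L x - G x p) I \<le> \<epsilon> * edist I x x0 ^ 3"
        using Lx(1) by (simp add: s_def)
      have "\<Delta>\<^sup>2 \<le> \<epsilon>' * s ^ 4"
      proof -
        have "\<epsilon>' * s ^ 3 \<le> 1 * s" using \<epsilon>' s0 power_decreasing[of 1 3 s] by (intro mult_mono) auto
        then have "\<Delta> * \<Delta> \<le> (\<epsilon>' * s ^ 3) * s" using d \<Delta> s0 by (intro mult_mono) auto
        then show ?thesis by (simp add: eval_nat_numeral algebra_simps)
      qed
      moreover have "\<Delta> * s \<le> \<epsilon>' * s ^ 4" using mult_right_mono[OF d s0(1)] by (simp add: eval_nat_numeral algebra_simps)
      ultimately have "Ce * (\<Delta> * s + \<Delta>\<^sup>2) \<le> Ce * (2 * (\<epsilon>' * s ^ 4))" using Ce by (intro mult_left_mono) auto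
      also have "\<dots> = (2 * (Ce * \<epsilon>')) * s ^ 4" by simp
      also have "\<dots> \<le> \<epsilon> * s ^ 4" using \<epsilon>Ce by (intro mult_right_mono) auto
      finally show "\<bar>L x - f x\<bar> \<le> \<epsilon> * edist I x x0 ^ 4" using Lx(2) by (simp add: s_def)
    qed
    have gN: "L2_set (\<lambda>p. (if p \<in> I then partial p L x else 0) - G x p) I = L2_set (\<lambda>p. partial p L x - G x p) I" for x
      by (intro L2_set_cong) auto
    \<comment> \<open>Since f is nonnegative, \<Phi> dominates the squared distance, so a bound on
      \<Phi> at time \<open>K\<close> suffices.\<close>
    define \<Phi> where "\<Phi> = (\<lambda>x. (edist I x x0)\<^sup>2 + A * f x)"
    have start: "\<Phi> (polyak_step I L x) \<le> q\<^sup>2 * (edist I x x0)\<^sup>2"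
    proof -
      define z where "z = (\<lambda>p. x p - x0 p)"
      define y where "y = nearest I M x"
      define g where "g = (\<lambda>p. if p \<in> I then partial p L x else 0)"
      have Nz: "N z = edist I x x0" by (simp add: z_def edist_def)
      have xz: "(\<lambda>p. x0 p + z p) = x" by (simp add: z_def)
      have xe: "x \<in> euclid I" using x(1) \<rho> by simp
      note sm = small[OF x(1) x(3)[folded M_def]]
      have 1: "0 < N z" "N z \<le> \<rho>2" using sm(1) x(1) \<rho> by (auto simp: Nz)
      have yM: "y \<in> M" using near(1)[OF x(1)] by (simp add: y_def)
      have 2: "N (\<lambda>p. y p - x0 p) \<le> 1" using yM r by (simp add: M_def ravine_iff edist_def)
      have 3: "ker (G y)" using yM by (simp add: M_def ravine_iff)
      have 4: "N (\<lambda>p. x0 p + z p - y p) \<le> \<epsilon>2 * N z ^ 3"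
      proof -
        have "edist I x y \<le> \<tau> * D y powr (3/2)"
          using x(2) near(2)[OF x(1)] by (simp add: tube_def y_def M_def)
        also have "\<dots> \<le> \<tau> * (4 * CD * (edist I x x0)\<^sup>2) powr (3/2)"
          using \<tau> D near(4)[OF x(1)] by (intro mult_left_mono powr_mono2) (auto simp: y_def)
        also have "\<dots> = (\<tau> * (4 * CD) powr (3/2)) * edist I x x0 ^ 3"
          using CD by (simp add: powr_mult square_powr_three_halves)
        also have "\<dots> \<le> (\<tau>0 * (4 * CD) powr (3/2)) * edist I x x0 ^ 3"
          using \<tau> by (intro mult_right_mono) auto
        also have "\<tau>0 * (4 * CD) powr (3/2) = \<epsilon>2" using CD by (simp add: \<tau>0_def)
        finally show ?thesis by (simp add: z_def edist_def)
      qed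
      have 5: "N (\<lambda>p. g p - G (\<lambda>p. x0 p + z p) p) \<le> \<epsilon>2 * N z ^ 3"
      proof -
        have "N (\<lambda>p. g p - G x p) \<le> \<epsilon> * N z ^ 3" using sm(2) gN[of x] by (simp add: g_def Nz)
        also have "\<dots> \<le> \<epsilon>2 * N z ^ 3" using \<epsilon> by (intro mult_right_mono) auto
        finally show ?thesis by (simp add: xz)
      qed
      have 6: "\<bar>L x - f (\<lambda>p. x0 p + z p)\<bar> \<le> \<epsilon>2 * N z ^ 4"
      proof -
        have "\<bar>L x - f x\<bar> \<le> \<epsilon> * N z ^ 4" using sm(3) by (simp add: Nz)
        also have "\<dots> \<le> \<epsilon>2 * N z ^ 4" using \<epsilon> by (intro mult_right_mono) auto
        finally show ?thesis by (simp add: xz)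
      qed
      note st = gd_step_eq[OF xe g_def]
      have ps: "polyak_step I L x = (\<lambda>p. x0 p + (z p - L x / (N g)\<^sup>2 * g p))"
        unfolding polyak_step_def st z_def by simp
      have "edist I (polyak_step I L x) x0 = N (\<lambda>p. z p - L x / (N g)\<^sup>2 * g p)"
        by (simp add: ps edist_def)
      then show ?thesis using q(5)[OF 1 2 3 4 5 6] by (simp add: \<Phi>_def ps Nz)
    qed
    \<comment> \<open>The passage from \<open>j\<close> to \<open>Suc j\<close> needs the core
      avoided only at \<open>j\<close>, so the last iterate may lie in the core.\<close>
    have "\<Phi> ((gd_step I L \<eta> ^^ j) (polyak_step I L x)) \<le> q\<^sup>2 * (edist I x x0)\<^sup>2" if "j \<le> K" for j
      using that
    proof (induction j)
      case 0
      then show ?case using start by simp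
    next
      case (Suc j)
      define w where "w = (gd_step I L \<eta> ^^ j) (polyak_step I L x)"
      have wW: "w \<in> W" "w \<notin> core I M D \<kappa> \<Delta>" "gd_step I L \<eta> w \<in> W"
        using traj Suc.prems by (auto simp: w_def M_def dest: spec[of _ "Suc j"])
      define z where "z = (\<lambda>p. w p - x0 p)"
      define g where "g = (\<lambda>p. if p \<in> I then partial p L w else 0)"
      have Nz: "N z = edist I w x0" by (simp add: z_def edist_def)
      have xz: "(\<lambda>p. x0 p + z p) = w" by (simp add: z_def)
      have we: "w \<in> euclid I" using wW \<rho> by simp
      have st: "gd_step I L \<eta> w = (\<lambda>p. x0 p + (z p - \<eta> * g p))"
        unfolding z_def by (rule gd_step_eq[OF we g_def])
      have Nz': "N (\<lambda>p. z p - \<eta> * g p) = edist I (gd_step I L \<eta> w) x0" by (simp add: st edist_def)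
      have "N (\<lambda>p. g p - G w p) \<le> \<epsilon> * N z ^ 3" using small(2)[OF wW(1,2)] gN[of w] by (simp add: g_def Nz)
      also have "\<dots> \<le> \<epsilon>1 * N z ^ 3" using \<epsilon> by (intro mult_right_mono) auto
      finally have "N (\<lambda>p. g p - G (\<lambda>p. x0 p + z p) p) \<le> \<epsilon>1 * N z ^ 3" by (simp add: xz)
      moreover have "N z \<le> \<rho>1" "N (\<lambda>p. z p - \<eta> * g p) \<le> \<rho>1" using wW \<rho> by (auto simp: Nz Nz')
      ultimately have "\<Phi> (gd_step I L \<eta> w) \<le> \<Phi> w"
        using A(5)[of z \<eta> g] \<eta> by (simp add: \<Phi>_def xz Nz Nz' st[symmetric])
      also have "\<dots> \<le> q\<^sup>2 * (edist I x x0)\<^sup>2" using Suc by (simp add: w_def)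
      finally show ?case by (simp add: w_def)
    qed
    note PhiK = this[of K, OF order_refl]
    have fK: "0 \<le> A * f ((gd_step I L \<eta> ^^ K) (polyak_step I L x))"
      using A(1) nonneg by (intro mult_nonneg_nonneg) auto
    from PhiK have "(edist I ((gd_step I L \<eta> ^^ K) (polyak_step I L x)) x0)\<^sup>2 \<le> (q * edist I x x0)\<^sup>2"
      using fK unfolding \<Phi>_def power_mult_distrib by linarith
    then show ?thesis by (rule power2_le_imp_le) (use q in simp)
  qed
  show ?thesis
  \<comment> \<open>Radius 1 keeps the ravine inside the unit ball, where the gradient estimates
    hold.\<close>
  proof (rule exI[of _ "1::real"], rule conjI, simp, intro allI impI, elim conjE)
    fix r :: real assume r: "0 < r" "r \<le> 1"
    show "\<exists>\<tau>0>0. \<forall>\<tau>. 0 < \<tau> \<and> \<tau> < \<tau>0 \<longrightarrow>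
      (\<exists>W q \<eta>ub \<kappa>0. nbhd I x0 W \<and> 0 < q \<and> q < 1 \<and> 0 < \<eta>ub \<and> 1 \<le> \<kappa>0 \<and> contracts CD Ce r \<tau> W q \<eta>ub \<kappa>0)"
    proof (rule exI[of _ \<tau>0], rule conjI[OF \<tau>0], intro allI impI, elim conjE)
      fix \<tau> assume \<tau>: "0 < \<tau>" "\<tau> < \<tau>0"
      define \<rho> where "\<rho> = Min {\<rho>1, \<rho>2, r / 4}"
      have \<rho>: "0 < \<rho>" "\<rho> \<le> \<rho>1" "\<rho> \<le> \<rho>2" "\<rho> \<le> r / 4" using A(4) q(4) r by (auto simp: \<rho>_def)
      define W where "W = {x \<in> euclid I. edist I x x0 < \<rho>}"
      have k1: "1 \<le> \<kappa>0" by (simp add: \<kappa>0_def)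
      have W: "nbhd I x0 W" using \<rho>(1) by (auto simp: nbhd_def W_def)
      have "contracts CD Ce r \<tau> W q \<eta>ub \<kappa>0"
        unfolding contracts_def by (intro allI impI, rule main[OF r \<tau> \<rho> W_def]; assumption)
      then show "\<exists>W q \<eta>ub \<kappa>0. nbhd I x0 W \<and> 0 < q \<and> q < 1 \<and> 0 < \<eta>ub \<and> 1 \<le> \<kappa>0 \<and> contracts CD Ce r \<tau> W q \<eta>ub \<kappa>0"
        using W q(1,2) A(2) k1 by blast
    qed
  qed
qed

end

section \<open>Gaussian integrals\<close>

text \<open>Dominated convergence along sequences tending to \<open>s0\<close>: the mean value
  theorem writes each difference quotient as a value of \<open>u'\<close>, which \<open>g\<close>
  dominates.\<close>

lemma has_real_derivative_integral:
  fixes u u' :: "real \<Rightarrow> 'a \<Rightarrow> real"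
  assumes int: "\<And>s. \<bar>s - s0\<bar> < 1 \<Longrightarrow> integrable M (u s)"
    and der: "\<And>s x. \<bar>s - s0\<bar> < 1 \<Longrightarrow> ((\<lambda>s. u s x) has_real_derivative u' s x) (at s)"
    and bound: "\<And>s x. \<bar>s - s0\<bar> < 1 \<Longrightarrow> \<bar>u' s x\<bar> \<le> g x"
    and g: "integrable M g" and meas: "u' s0 \<in> borel_measurable M"
  shows "((\<lambda>s. \<integral>x. u s x \<partial>M) has_real_derivative (\<integral>x. u' s0 x \<partial>M)) (at s0)"
  unfolding has_field_derivative_iff tendsto_at_iff_sequentially
proof (intro allI impI)
  fix X assume X: "\<forall>i. X i \<in> UNIV - {s0}" "X \<longlonglongrightarrow> s0"
  obtain n0 where n0: "\<And>n. n \<ge> n0 \<Longrightarrow> \<bar>X n - s0\<bar> < 1"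
    using LIMSEQ_D[OF X(2), of 1] by auto
  \<comment> \<open>Drops finitely many terms, so that the domination near \<open>s0\<close> applies
    to the whole sequence.\<close>
  define Y where "Y = (\<lambda>n. X (n + n0))"
  have Y: "Y n \<noteq> s0" "\<bar>Y n - s0\<bar> < 1" for n using X(1) n0[of "n + n0"] by (auto simp: Y_def)
  have YL: "Y \<longlonglongrightarrow> s0" unfolding Y_def by (rule LIMSEQ_ignore_initial_segment[OF X(2)])
  have "(\<lambda>n. \<integral>x. (u (Y n) x - u s0 x) / (Y n - s0) \<partial>M) \<longlonglongrightarrow> (\<integral>x. u' s0 x \<partial>M)"
  proof (rule integral_dominated_convergence[where w = g])
    show "AE x in M. (\<lambda>n. (u (Y n) x - u s0 x) / (Y n - s0)) \<longlonglongrightarrow> u' s0 x"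
    proof (rule AE_I2)
      fix x
      have "((\<lambda>s. (u s x - u s0 x) / (s - s0)) \<longlongrightarrow> u' s0 x) (at s0)"
        using der[of s0 x] by (simp add: has_field_derivative_iff)
      then show "(\<lambda>n. (u (Y n) x - u s0 x) / (Y n - s0)) \<longlonglongrightarrow> u' s0 x"
        unfolding tendsto_at_iff_sequentially comp_def using Y(1) YL by simp
    qed
    show "AE x in M. norm ((u (Y n) x - u s0 x) / (Y n - s0)) \<le> g x" for n
    proof (rule AE_I2)
      fix x
      have "\<exists>t. \<bar>t - s0\<bar> < 1 \<and> (u (Y n) x - u s0 x) / (Y n - s0) = u' t x"
      proof (cases "s0 < Y n")
        case True
        have "\<exists>t>s0. t < Y n \<and> u (Y n) x - u s0 x = (Y n - s0) * u' t x"
          using Y(2)[of n] by (intro MVT2[OF True] der) auto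
        then obtain t where "s0 < t" "t < Y n" "u (Y n) x - u s0 x = (Y n - s0) * u' t x" by auto
        then show ?thesis using Y[of n] by (intro exI[of _ t]) (auto simp: field_simps)
      next
        case False
        then have "Y n < s0" using Y(1)[of n] by simp
        then have "\<exists>t>Y n. t < s0 \<and> u s0 x - u (Y n) x = (s0 - Y n) * u' t x"
          using Y(2)[of n] by (intro MVT2 der) auto
        then obtain t where "Y n < t" "t < s0" "u s0 x - u (Y n) x = (s0 - Y n) * u' t x" by auto
        then show ?thesis using Y[of n] by (intro exI[of _ t]) (auto simp: field_simps)
      qed
      then obtain t where t: "\<bar>t - s0\<bar> < 1" "(u (Y n) x - u s0 x) / (Y n - s0) = u' t x" by blast
      show "norm ((u (Y n) x - u s0 x) / (Y n - s0)) \<le> g x" unfolding t(2) using bound[OF t(1)] by simp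
    qed
  qed (use int Y g meas in auto)
  also have "(\<lambda>n. \<integral>x. (u (Y n) x - u s0 x) / (Y n - s0) \<partial>M)
      = (\<lambda>n. (integral\<^sup>L M (u (Y n)) - integral\<^sup>L M (u s0)) / (Y n - s0))"
    using int Y(2) by (simp add: int[of s0])
  finally have "(\<lambda>n. (integral\<^sup>L M (u (X (n + n0))) - integral\<^sup>L M (u s0)) / (X (n + n0) - s0)) \<longlonglongrightarrow> (\<integral>x. u' s0 x \<partial>M)"
    by (simp add: Y_def)
  then show "((\<lambda>y. (integral\<^sup>L M (u y) - integral\<^sup>L M (u s0)) / (y - s0)) \<circ> X) \<longlonglongrightarrow> (\<integral>x. u' s0 x \<partial>M)"
    unfolding comp_def by (rule LIMSEQ_offset)
qed

section \<open>Gaussian densities as products of one-dimensional ones\<close>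

lemma gauss_exp: "gauss d c x = (2 * pi) powr (- real d / 2) * exp (- (\<Sum>k<d. (x k - c k)\<^sup>2) / 2)"
  by (simp add: gauss_def edist_def L2_set_def sum_nonneg)

lemma gauss_pos: "0 < gauss d c x"
  by (simp add: gauss_exp)

lemma gauss_prod: "gauss d c x = (\<Prod>k<d. normal_density (c k) 1 (x k))"
proof -
  have "(\<Prod>k<d. normal_density (c k) 1 (x k)) = (1 / sqrt (2 * pi)) ^ d * (\<Prod>k<d. exp (- (x k - c k)\<^sup>2 / 2))"
  proof -
    have "normal_density (c k) 1 (x k) = 1 / sqrt (2 * pi) * exp (- (x k - c k)\<^sup>2 / 2)" for k
      by (simp add: normal_density_def)
    then show ?thesis by (simp only: prod.distrib prod_constant card_lessThan)
  qed
  also have "(\<Prod>k<d. exp (- (x k - c k)\<^sup>2 / 2)) = exp (- (\<Sum>k<d. (x k - c k)\<^sup>2) / 2)"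
    by (simp add: exp_sum[symmetric] sum_negf sum_divide_distrib)
  also have "(1 / sqrt (2 * pi)) ^ d = (2 * pi) powr (- real d / 2)"
  proof -
    have "1 / sqrt (2 * pi) = (2 * pi) powr (- 1 / 2)"
      by (simp add: powr_half_sqrt[symmetric] powr_minus_divide)
    then show ?thesis by (simp add: powr_powr flip: powr_realpow)
  qed
  finally show ?thesis by (simp add: gauss_exp)
qed

abbreviation Leb :: "nat \<Rightarrow> (nat \<Rightarrow> real) measure" where
  "Leb d \<equiv> \<Pi>\<^sub>M k\<in>{..<d}. lborel"

interpretation lb: product_sigma_finite "\<lambda>_::nat. lborel :: real measure"
  by (simp add: product_sigma_finite_def lborel.sigma_finite_measure_axioms)

lemma gauss_measurable [measurable]: "gauss d c \<in> borel_measurable (Leb d)"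
  unfolding gauss_prod[abs_def] by measurable

lemma mixture_measurable [measurable]: "mixture d n w c \<in> borel_measurable (Leb d)"
  unfolding mixture_def[abs_def] by measurable

lemma gauss_integral:
  assumes "\<And>k. k < d \<Longrightarrow> integrable lborel (\<lambda>t. normal_density (c k) 1 t * h k t)"
  shows "integrable (Leb d) (\<lambda>x. gauss d c x * (\<Prod>k<d. h k (x k)))"
    and "(\<integral>x. gauss d c x * (\<Prod>k<d. h k (x k)) \<partial>Leb d) = (\<Prod>k<d. \<integral>t. normal_density (c k) 1 t * h k t \<partial>lborel)"
  using lb.product_integrable_prod[of "{..<d}" "\<lambda>k t. normal_density (c k) 1 t * h k t"]
    lb.product_integral_prod[of "{..<d}" "\<lambda>k t. normal_density (c k) 1 t * h k t"] assms
  by (auto simp: gauss_prod prod.distrib)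

lemma gauss_integral_1: "integrable (Leb d) (gauss d c)" "(\<integral>x. gauss d c x \<partial>Leb d) = 1"
  using gauss_integral[of d c "\<lambda>_ _. 1"] by auto

lemma gauss_integral_coord:
  assumes h: "h \<in> borel_measurable borel" "\<And>t. \<bar>h t\<bar> \<le> B" and k: "k < d"
  shows "integrable (Leb d) (\<lambda>x. gauss d c x * h (x k))"
    and "(\<integral>x. gauss d c x * h (x k) \<partial>Leb d) = (\<integral>t. normal_density (c k) 1 t * h t \<partial>lborel)"
proof -
  have i: "integrable lborel (\<lambda>t. normal_density (c k) 1 t * h t)"
  proof (rule Bochner_Integration.integrable_bound)
    show "integrable lborel (\<lambda>t. B * normal_density (c k) 1 t)" by simp
    show "AE t in lborel. norm (normal_density (c k) 1 t * h t) \<le> norm (B * normal_density (c k) 1 t)"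
    proof (rule AE_I2)
      fix t
      have "\<bar>h t\<bar> * normal_density (c k) 1 t \<le> \<bar>B\<bar> * normal_density (c k) 1 t"
        using h(2)[of t] by (intro mult_right_mono) auto
      then show "norm (normal_density (c k) 1 t * h t) \<le> norm (B * normal_density (c k) 1 t)"
        by (simp add: abs_mult mult.commute)
    qed
  qed (use h in measurable)
  have e: "(\<Prod>j<d. (if j = k then h else (\<lambda>_. 1)) (x j)) = h (x k)" for x
    using k by (subst prod.remove[of _ k]) (auto intro!: prod.neutral)
  have "integrable lborel (\<lambda>t. normal_density (c j) 1 t * (if j = k then h else (\<lambda>_. 1)) t)" for j
    using i by auto
  note g = gauss_integral[of d c "\<lambda>j. if j = k then h else (\<lambda>_. 1)", OF this, unfolded e]
  show "integrable (Leb d) (\<lambda>x. gauss d c x * h (x k))" by (rule g)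
  have "(\<Prod>j<d. \<integral>t. normal_density (c j) 1 t * (if j = k then h else (\<lambda>_. 1)) t \<partial>lborel)
      = (\<integral>t. normal_density (c k) 1 t * h t \<partial>lborel)"
    using k by (subst prod.remove[of _ k]) (auto intro!: prod.neutral)
  then show "(\<integral>x. gauss d c x * h (x k) \<partial>Leb d) = (\<integral>t. normal_density (c k) 1 t * h t \<partial>lborel)"
    using g(2) by simp
qed

text \<open>A product weight dominates every polynomial in the coordinates and still lets Gaussian
  integrals factor over the coordinates.\<close>

definition pweight :: "nat \<Rightarrow> nat \<Rightarrow> (nat \<Rightarrow> real) \<Rightarrow> real" where
  "pweight d N x = (\<Prod>k<d. (1 + \<bar>x k\<bar>) ^ N)"

lemma pweight_ge_1: "1 \<le> pweight d N x"
  unfolding pweight_def by (intro prod_ge_1) auto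

lemma pweight_add: "pweight d N x * pweight d K x = pweight d (N + K) x"
  by (simp add: pweight_def prod.distrib power_add)

lemma pweight_mono: "N \<le> K \<Longrightarrow> pweight d N x \<le> pweight d K x"
  unfolding pweight_def by (intro prod_mono) (auto intro!: power_increasing)

lemma pweight_coord: "k < d \<Longrightarrow> (1 + \<bar>x k\<bar>) ^ N \<le> pweight d N x"
proof -
  assume k: "k < d"
  have "pweight d N x = (1 + \<bar>x k\<bar>) ^ N * (\<Prod>j\<in>{..<d} - {k}. (1 + \<bar>x j\<bar>) ^ N)"
    unfolding pweight_def using k by (subst prod.remove[of _ k]) auto
  moreover have "1 \<le> (\<Prod>j\<in>{..<d} - {k}. (1 + \<bar>x j\<bar>) ^ N)" by (intro prod_ge_1) auto
  ultimately show ?thesis using mult_left_mono[of 1 _ "(1 + \<bar>x k\<bar>) ^ N"] by fastforce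
qed

lemma pweight_measurable [measurable]: "pweight d N \<in> borel_measurable (Leb d)"
  unfolding pweight_def[abs_def] by measurable

text \<open>Splitting \<open>1 + |t|\<close> into \<open>1 + |c|\<close> and \<open>|t - c|\<close>
  reduces the claim to absolute central moments.\<close>

lemma normal_poly_integrable: "integrable lborel (\<lambda>t. normal_density c 1 t * (1 + \<bar>t\<bar>) ^ N)"
proof (rule Bochner_Integration.integrable_bound)
  show "integrable lborel (\<lambda>t. 2 ^ N * (normal_density c 1 t * (1 + \<bar>c\<bar>) ^ N + normal_density c 1 t * \<bar>t - c\<bar> ^ N))"
    by (intro integrable_mult_right Bochner_Integration.integrable_add integrable_normal_moment_abs integrable_mult_left) auto
  show "AE t in lborel. norm (normal_density c 1 t * (1 + \<bar>t\<bar>) ^ N)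
      \<le> norm (2 ^ N * (normal_density c 1 t * (1 + \<bar>c\<bar>) ^ N + normal_density c 1 t * \<bar>t - c\<bar> ^ N))"
  proof (rule AE_I2)
    fix t :: real
    define a where "a = 1 + \<bar>c\<bar>"
    define b where "b = \<bar>t - c\<bar>"
    have ab: "0 \<le> a" "0 \<le> b" by (auto simp: a_def b_def)
    have "1 + \<bar>t\<bar> \<le> a + b" by (simp add: a_def b_def)
    also have "\<dots> \<le> 2 * max a b" by simp
    finally have "(1 + \<bar>t\<bar>) ^ N \<le> (2 * max a b) ^ N" by (intro power_mono) auto
    also have "\<dots> = 2 ^ N * max a b ^ N" by (simp add: power_mult_distrib)
    also have "\<dots> \<le> 2 ^ N * (a ^ N + b ^ N)" using ab by (intro mult_left_mono) (auto simp: max_def)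
    finally have "normal_density c 1 t * (1 + \<bar>t\<bar>) ^ N \<le> normal_density c 1 t * (2 ^ N * (a ^ N + b ^ N))"
      by (intro mult_left_mono) auto
    then show "norm (normal_density c 1 t * (1 + \<bar>t\<bar>) ^ N)
      \<le> norm (2 ^ N * (normal_density c 1 t * (1 + \<bar>c\<bar>) ^ N + normal_density c 1 t * \<bar>t - c\<bar> ^ N))"
      by (simp add: a_def b_def algebra_simps)
  qed
qed measurable

section \<open>Mixtures as probability measures\<close>

lemma mixture_pos:
  assumes "simplex_pos n w"
  shows "0 < mixture d n w c x"
proof -
  have "n \<noteq> 0" using assms by (cases n) (auto simp: simplex_pos_def)
  then show ?thesis unfolding mixture_def using assms
    by (intro sum_pos) (auto simp: simplex_pos_def gauss_pos)
qed

lemma mixture_integral: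
  assumes "simplex_pos n w"
  shows "integrable (Leb d) (mixture d n w c)" "(\<integral>x. mixture d n w c x \<partial>Leb d) = 1"
proof -
  show "integrable (Leb d) (mixture d n w c)"
    unfolding mixture_def[abs_def] by (intro Bochner_Integration.integrable_sum integrable_mult_right gauss_integral_1)
  show "(\<integral>x. mixture d n w c x \<partial>Leb d) = 1"
    unfolding mixture_def using assms
    by (subst Bochner_Integration.integral_sum)
       (auto intro!: integrable_mult_right gauss_integral_1 simp: gauss_integral_1 simplex_pos_def)
qed

lemma mixture_measure_integrable:
  assumes "simplex_pos m ps" and [measurable]: "g \<in> borel_measurable (Leb d)"
  shows "integrable (mixture_measure d m ps c) g \<longleftrightarrow> integrable (Leb d) (\<lambda>x. mixture d m ps c x * g x)"
    and "integral\<^sup>L (mixture_measure d m ps c) g = (\<integral>x. mixture d m ps c x * g x \<partial>Leb d)"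
proof -
  have nn: "AE x in Leb d. 0 \<le> mixture d m ps c x"
    using mixture_pos[OF assms(1), of d c] by (auto intro: less_imp_le)
  show "integrable (mixture_measure d m ps c) g \<longleftrightarrow> integrable (Leb d) (\<lambda>x. mixture d m ps c x * g x)"
    unfolding mixture_measure_def by (subst integrable_density) (use nn in auto)
  show "integral\<^sup>L (mixture_measure d m ps c) g = (\<integral>x. mixture d m ps c x * g x \<partial>Leb d)"
    unfolding mixture_measure_def by (subst integral_density) (use nn in auto)
qed

lemma mixture_measure_pweight:
  assumes "simplex_pos m ps"
  shows "integrable (mixture_measure d m ps c) (pweight d N)"
proof -
  have "integrable (Leb d) (\<lambda>x. \<Sum>i<m. ps i * (gauss d (c i) x * pweight d N x))"
    unfolding pweight_def
    by (intro Bochner_Integration.integrable_sum integrable_mult_right gauss_integral(1) normal_poly_integrable)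
  then show ?thesis
    by (subst mixture_measure_integrable[OF assms pweight_measurable]) (simp add: mixture_def sum_distrib_right mult.assoc)
qed

lemma mixture_measure_prob:
  assumes "simplex_pos m ps"
  shows "prob_space (mixture_measure d m ps c)"
proof
  have nn: "AE x in Leb d. 0 \<le> mixture d m ps c x"
    using mixture_pos[OF assms, of d c] by (auto intro: less_imp_le)
  have "emeasure (mixture_measure d m ps c) (space (mixture_measure d m ps c))
      = (\<integral>\<^sup>+ x. ennreal (mixture d m ps c x) \<partial>Leb d)"
    by (simp add: mixture_measure_def emeasure_density cong: nn_integral_cong)
  also have "\<dots> = ennreal (\<integral>x. mixture d m ps c x \<partial>Leb d)"
    using mixture_integral[OF assms] nn by (intro nn_integral_eq_integral) auto
  finally show "emeasure (mixture_measure d m ps c) (space (mixture_measure d m ps c)) = 1"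
    using mixture_integral[OF assms, of d c] by simp
qed

section \<open>Smoothness of the loss\<close>

type_synonym par = "nat \<times> nat \<Rightarrow> real"

text \<open>The posterior probability of component \<open>i\<close> given the sample
  \<open>x\<close>.\<close>

definition resp :: "nat \<Rightarrow> nat \<Rightarrow> (nat \<Rightarrow> real) \<Rightarrow> nat \<Rightarrow> par \<Rightarrow> (nat \<Rightarrow> real) \<Rightarrow> real" where
  "resp d n w i \<mu> x = w i * gauss d (curry \<mu> i) x / mixture d n w (curry \<mu>) x"

text \<open>The derivative of the logarithm of the \<open>i\<close>-th Gaussian density when the
  means move in direction \<open>y\<close>.\<close>

definition lin :: "nat \<Rightarrow> nat \<Rightarrow> par \<Rightarrow> par \<Rightarrow> (nat \<Rightarrow> real) \<Rightarrow> real" where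
  "lin d i \<mu> y x = (\<Sum>k<d. y (i, k) * (x k - \<mu> (i, k)))"

definition pos :: "par \<Rightarrow> par \<Rightarrow> par \<Rightarrow> real \<Rightarrow> par" where
  "pos c a b s = (\<lambda>p. c p + s * a p + s\<^sup>2 * b p)"

definition vel :: "par \<Rightarrow> par \<Rightarrow> real \<Rightarrow> par" where
  "vel a b s = (\<lambda>p. a p + 2 * s * b p)"

text \<open>The arguments stand for the position \<open>\<mu>\<close>, velocity \<open>y\<close> and half acceleration \<open>b\<close> of a parabola
  in parameter space and for a sample \<open>x\<close>. The class is closed under differentiation along
  parabolas and its members grow polynomially in \<open>x\<close>, so their expectations are smooth.\<close>

inductive stat :: "nat \<Rightarrow> nat \<Rightarrow> (nat \<Rightarrow> real) \<Rightarrow> (par \<Rightarrow> par \<Rightarrow> par \<Rightarrow> (nat \<Rightarrow> real) \<Rightarrow> real) \<Rightarrow> bool"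
  for d n w where
  const: "stat d n w (\<lambda>\<mu> y b x. r)"
| sample: "k < d \<Longrightarrow> stat d n w (\<lambda>\<mu> y b x. x k)"
| mu: "p \<in> params d n \<Longrightarrow> stat d n w (\<lambda>\<mu> y b x. \<mu> p)"
| velo: "p \<in> params d n \<Longrightarrow> stat d n w (\<lambda>\<mu> y b x. y p)"
| acc: "p \<in> params d n \<Longrightarrow> stat d n w (\<lambda>\<mu> y b x. b p)"
| resp: "i < n \<Longrightarrow> stat d n w (\<lambda>\<mu> y b x. resp d n w i \<mu> x)"
| ln: "stat d n w (\<lambda>\<mu> y b x. ln (mixture d n w (curry \<mu>) x))"
| add: "stat d n w e \<Longrightarrow> stat d n w g \<Longrightarrow> stat d n w (\<lambda>\<mu> y b x. e \<mu> y b x + g \<mu> y b x)"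
| mult: "stat d n w e \<Longrightarrow> stat d n w g \<Longrightarrow> stat d n w (\<lambda>\<mu> y b x. e \<mu> y b x * g \<mu> y b x)"

locale gauss_model =
  fixes d n m :: nat and ps :: "nat \<Rightarrow> real" and cs :: "nat \<Rightarrow> nat \<Rightarrow> real" and w :: "nat \<Rightarrow> real"
  assumes ps: "simplex_pos m ps" and w: "simplex_pos n w"
begin

abbreviation "P \<equiv> mixture_measure d m ps cs"

section \<open>Measurability, growth and integrability of statistics\<close>

lemma mix_pos: "0 < mixture d n w c x"
  by (rule mixture_pos[OF w])

lemma w_pos: "i < n \<Longrightarrow> 0 < w i"
  using w by (simp add: simplex_pos_def)

lemma n_pos: "0 < n"
  using w by (cases n) (auto simp: simplex_pos_def)

lemma stat_sum:
  assumes "finite A" "\<And>a. a \<in> A \<Longrightarrow> stat d n w (e a)"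
  shows "stat d n w (\<lambda>\<mu> y b x. \<Sum>a\<in>A. e a \<mu> y b x)"
  using assms by (induction A rule: finite_induct) (auto intro: stat.const stat.add)

lemma stat_uminus: "stat d n w e \<Longrightarrow> stat d n w (\<lambda>\<mu> y b x. - e \<mu> y b x)"
  using stat.mult[OF stat.const[of d n w "-1"]] by simp

lemma stat_diff: "stat d n w e \<Longrightarrow> stat d n w g \<Longrightarrow> stat d n w (\<lambda>\<mu> y b x. e \<mu> y b x - g \<mu> y b x)"
  using stat.add[OF _ stat_uminus, of e g] by simp

lemma stat_lin: "i < n \<Longrightarrow> stat d n w (\<lambda>\<mu> y b x. lin d i \<mu> y x)"
  unfolding lin_def by (intro stat_sum stat.mult stat_diff stat.velo stat.sample stat.mu) auto

lemma stat_measurable: "stat d n w e \<Longrightarrow> e \<mu> y b \<in> borel_measurable (Leb d)"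
proof (induction rule: stat.induct)
  case (resp i)
  show ?case unfolding resp_def[abs_def] by measurable
qed (auto intro: measurable_component_singleton)

definition bdd :: "real \<Rightarrow> par \<Rightarrow> bool" where
  "bdd R z \<longleftrightarrow> (\<forall>p\<in>params d n. \<bar>z p\<bar> \<le> R)"

text \<open>A mixture never exceeds the maximal Gaussian density, and it is at least its component
  0, whose logarithm is quadratic in the sample.\<close>

lemma ln_mixture_growth:
  "\<exists>C\<ge>0. \<forall>\<mu> x. bdd R \<mu> \<longrightarrow> \<bar>ln (mixture d n w (curry \<mu>) x)\<bar> \<le> C * pweight d 2 x"
proof -
  define g0 where "g0 = (2 * pi) powr (- real d / 2)"
  have g0: "0 < g0" by (simp add: g0_def)
  define C where "C = \<bar>ln g0\<bar> + \<bar>ln (w 0 * g0)\<bar> + real d * (1 + R)\<^sup>2"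
  have C: "0 \<le> C" by (simp add: C_def)
  have "\<bar>ln (mixture d n w (curry \<mu>) x)\<bar> \<le> C * pweight d 2 x" if R: "bdd R \<mu>" for \<mu> x
  proof -
    have "mixture d n w (curry \<mu>) x \<le> (\<Sum>i<n. w i * g0)"
      unfolding mixture_def gauss_exp g0_def
      by (intro sum_mono mult_left_mono) (auto simp: sum_nonneg less_imp_le[OF w_pos])
    also have "\<dots> = g0" using w by (simp add: simplex_pos_def flip: sum_distrib_right)
    finally have up: "ln (mixture d n w (curry \<mu>) x) \<le> ln g0" using mix_pos g0 by simp
    define S where "S = (\<Sum>k<d. (x k - \<mu> (0, k))\<^sup>2)"
    have "w 0 * gauss d (curry \<mu> 0) x \<le> mixture d n w (curry \<mu>) x"
      unfolding mixture_def using n_pos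
      by (intro member_le_sum) (auto intro!: mult_nonneg_nonneg less_imp_le[OF w_pos] less_imp_le[OF gauss_pos])
    then have "ln (w 0 * gauss d (curry \<mu> 0) x) \<le> ln (mixture d n w (curry \<mu>) x)"
      using w_pos[OF n_pos] gauss_pos mix_pos by (subst ln_le_cancel_iff) auto
    moreover have "w 0 * gauss d (curry \<mu> 0) x = (w 0 * g0) * exp (- S / 2)"
      by (simp add: gauss_exp g0_def S_def)
    moreover have "ln ((w 0 * g0) * exp (- S / 2)) = ln (w 0 * g0) - S / 2"
      using w_pos[OF n_pos] g0 by (subst ln_mult_pos) auto
    ultimately have low: "ln (w 0 * g0) - S / 2 \<le> ln (mixture d n w (curry \<mu>) x)" by simp
    have S: "S \<le> real d * (1 + R)\<^sup>2 * pweight d 2 x"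
    proof -
      have "(x k - \<mu> (0, k))\<^sup>2 \<le> (1 + R)\<^sup>2 * pweight d 2 x" if k: "k < d" for k
      proof -
        have m: "\<bar>\<mu> (0, k)\<bar> \<le> R" using R k n_pos by (auto simp: bdd_def)
        have "\<bar>x k - \<mu> (0, k)\<bar> \<le> \<bar>x k\<bar> + R" using m by linarith
        also have "\<dots> \<le> (1 + R) * (1 + \<bar>x k\<bar>)" using m mult_nonneg_nonneg[of R "\<bar>x k\<bar>"] by (simp add: algebra_simps)
        finally have "\<bar>x k - \<mu> (0, k)\<bar>\<^sup>2 \<le> ((1 + R) * (1 + \<bar>x k\<bar>))\<^sup>2" by (intro power_mono) auto
        also have "\<dots> = (1 + R)\<^sup>2 * (1 + \<bar>x k\<bar>)\<^sup>2" by (simp add: power_mult_distrib)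
        also have "\<dots> \<le> (1 + R)\<^sup>2 * pweight d 2 x" using pweight_coord[OF k, of x 2] by (intro mult_left_mono) auto
        finally show ?thesis by simp
      qed
      then have "S \<le> (\<Sum>k<d. (1 + R)\<^sup>2 * pweight d 2 x)" unfolding S_def by (intro sum_mono) auto
      then show ?thesis by simp
    qed
    have "0 \<le> S" by (simp add: S_def sum_nonneg)
    then have "\<bar>ln (mixture d n w (curry \<mu>) x)\<bar> \<le> \<bar>ln g0\<bar> + \<bar>ln (w 0 * g0)\<bar> + S" using up low by linarith
    also have "\<dots> \<le> (\<bar>ln g0\<bar> + \<bar>ln (w 0 * g0)\<bar>) * pweight d 2 x + real d * (1 + R)\<^sup>2 * pweight d 2 x"
      using S mult_left_mono[OF pweight_ge_1[of d 2 x], of "\<bar>ln g0\<bar> + \<bar>ln (w 0 * g0)\<bar>"] by simp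
    also have "\<dots> = C * pweight d 2 x" by (simp add: C_def distrib_right)
    finally show ?thesis .
  qed
  then show ?thesis using C by blast
qed

lemma resp_bounds: "i < n \<Longrightarrow> 0 \<le> resp d n w i \<mu> x" "i < n \<Longrightarrow> resp d n w i \<mu> x \<le> 1"
proof -
  assume i: "i < n"
  show "0 \<le> resp d n w i \<mu> x" unfolding resp_def
    using i by (intro divide_nonneg_pos mix_pos mult_nonneg_nonneg less_imp_le[OF w_pos] less_imp_le[OF gauss_pos])
  have "w i * gauss d (curry \<mu> i) x \<le> mixture d n w (curry \<mu>) x"
    unfolding mixture_def using i
    by (intro member_le_sum) (auto intro!: mult_nonneg_nonneg less_imp_le[OF w_pos] less_imp_le[OF gauss_pos])
  then show "resp d n w i \<mu> x \<le> 1" unfolding resp_def using mix_pos by simp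
qed

lemma stat_growth:
  "stat d n w e \<Longrightarrow> \<exists>C\<ge>0. \<exists>N. \<forall>\<mu> y b x. bdd R \<mu> \<longrightarrow> bdd R y \<longrightarrow> bdd R b \<longrightarrow> \<bar>e \<mu> y b x\<bar> \<le> C * pweight d N x"
proof (induction rule: stat.induct)
  case (const r)
  show ?case by (intro exI[of _ "\<bar>r\<bar>"] conjI exI[of _ 0]) (auto simp: pweight_def)
next
  case (sample k)
  have "\<bar>x k\<bar> \<le> 1 * pweight d 1 x" for x using pweight_coord[OF sample, of x 1] by simp
  then show ?case by (intro exI[of _ 1] conjI exI[of _ 1]) auto
next
  case (mu p)
  then show ?case by (intro exI[of _ "\<bar>R\<bar>"] conjI exI[of _ 0]) (force simp: pweight_def bdd_def)+
next
  case (velo p)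
  then show ?case by (intro exI[of _ "\<bar>R\<bar>"] conjI exI[of _ 0]) (force simp: pweight_def bdd_def)+
next
  case (acc p)
  then show ?case by (intro exI[of _ "\<bar>R\<bar>"] conjI exI[of _ 0]) (force simp: pweight_def bdd_def)+
next
  case (resp i)
  then show ?case using resp_bounds[OF resp]
    by (intro exI[of _ 1] conjI exI[of _ 0]) (auto simp: pweight_def abs_le_iff intro: order_trans[of _ 0])
next
  case ln
  then show ?case using ln_mixture_growth[of R] by blast
next
  case (add e g)
  then obtain C N C' N' where 1: "0 \<le> C" "\<And>\<mu> y b x. bdd R \<mu> \<Longrightarrow> bdd R y \<Longrightarrow> bdd R b \<Longrightarrow> \<bar>e \<mu> y b x\<bar> \<le> C * pweight d N x"
    and 2: "0 \<le> C'" "\<And>\<mu> y b x. bdd R \<mu> \<Longrightarrow> bdd R y \<Longrightarrow> bdd R b \<Longrightarrow> \<bar>g \<mu> y b x\<bar> \<le> C' * pweight d N' x" by blast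
  have "\<bar>e \<mu> y b x + g \<mu> y b x\<bar> \<le> (C + C') * pweight d (max N N') x" if "bdd R \<mu>" "bdd R y" "bdd R b" for \<mu> y b x
  proof -
    have "\<bar>e \<mu> y b x + g \<mu> y b x\<bar> \<le> C * pweight d N x + C' * pweight d N' x"
      using 1(2)[OF that, of x] 2(2)[OF that, of x] by linarith
    also have "\<dots> \<le> C * pweight d (max N N') x + C' * pweight d (max N N') x"
      using 1(1) 2(1) by (intro add_mono mult_left_mono pweight_mono) auto
    finally show ?thesis by (simp add: distrib_right)
  qed
  then show ?case using 1(1) 2(1) by (intro exI[of _ "C + C'"] conjI exI[of _ "max N N'"]) auto
next
  case (mult e g)
  then obtain C N C' N' where 1: "0 \<le> C" "\<And>\<mu> y b x. bdd R \<mu> \<Longrightarrow> bdd R y \<Longrightarrow> bdd R b \<Longrightarrow> \<bar>e \<mu> y b x\<bar> \<le> C * pweight d N x"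
    and 2: "0 \<le> C'" "\<And>\<mu> y b x. bdd R \<mu> \<Longrightarrow> bdd R y \<Longrightarrow> bdd R b \<Longrightarrow> \<bar>g \<mu> y b x\<bar> \<le> C' * pweight d N' x" by blast
  have "\<bar>e \<mu> y b x * g \<mu> y b x\<bar> \<le> (C * C') * pweight d (N + N') x" if "bdd R \<mu>" "bdd R y" "bdd R b" for \<mu> y b x
  proof -
    have "\<bar>e \<mu> y b x * g \<mu> y b x\<bar> \<le> (C * pweight d N x) * (C' * pweight d N' x)"
      unfolding abs_mult using 1(1) order_trans[OF zero_le_one pweight_ge_1]
      by (intro mult_mono 1(2)[OF that] 2(2)[OF that] mult_nonneg_nonneg) auto
    also have "\<dots> = (C * C') * pweight d (N + N') x" by (simp add: pweight_add[symmetric])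
    finally show ?thesis .
  qed
  then show ?case using 1(1) 2(1) by (intro exI[of _ "C * C'"] conjI exI[of _ "N + N'"]) auto
qed

lemma stat_integrable: "stat d n w e \<Longrightarrow> integrable P (e \<mu> y b)"
proof -
  assume e: "stat d n w e"
  define R where "R = (\<Sum>p\<in>params d n. \<bar>\<mu> p\<bar> + \<bar>y p\<bar> + \<bar>b p\<bar>)"
  have "\<bar>\<mu> p\<bar> + \<bar>y p\<bar> + \<bar>b p\<bar> \<le> R" if "p \<in> params d n" for p
    unfolding R_def using that by (intro member_le_sum) auto
  then have R: "bdd R \<mu>" "bdd R y" "bdd R b" unfolding bdd_def by (smt (verit) abs_ge_zero)+
  obtain C N where C: "\<And>x. \<bar>e \<mu> y b x\<bar> \<le> C * pweight d N x" using stat_growth[OF e, of R] R by blast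
  show ?thesis
  proof (rule Bochner_Integration.integrable_bound)
    show "integrable P (\<lambda>x. C * pweight d N x)" by (intro integrable_mult_right mixture_measure_pweight ps)
    show "e \<mu> y b \<in> borel_measurable P" using stat_measurable[OF e] by (simp add: mixture_measure_def)
    show "AE x in P. norm (e \<mu> y b x) \<le> norm (C * pweight d N x)"
      using C by (intro AE_I2) (smt (verit) real_norm_def)
  qed
qed

text \<open>The derivative along every parabola with the sample fixed. The half acceleration
  \<open>b\<close> stays constant there, so three parameter arguments close the calculus: velocities
  differentiate to \<open>2 * b\<close>, and \<open>b\<close> to 0.\<close>

definition flow_deriv :: "(par \<Rightarrow> par \<Rightarrow> par \<Rightarrow> (nat \<Rightarrow> real) \<Rightarrow> real) \<Rightarrow> (par \<Rightarrow> par \<Rightarrow> par \<Rightarrow> (nat \<Rightarrow> real) \<Rightarrow> real) \<Rightarrow> bool" where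
  "flow_deriv e e' \<longleftrightarrow> stat d n w e \<and> stat d n w e' \<and>
     (\<forall>c a b s x. ((\<lambda>s. e (pos c a b s) (vel a b s) b x) has_real_derivative e' (pos c a b s) (vel a b s) b x) (at s))"

section \<open>Rules for derivatives along parabolas\<close>

lemma flow_deriv_const: "flow_deriv (\<lambda>\<mu> y b x. r) (\<lambda>\<mu> y b x. 0)"
  by (auto simp: flow_deriv_def intro: stat.const)

lemma flow_deriv_sample: "k < d \<Longrightarrow> flow_deriv (\<lambda>\<mu> y b x. x k) (\<lambda>\<mu> y b x. 0)"
  by (auto simp: flow_deriv_def intro: stat.const stat.sample)

lemma pos_deriv: "((\<lambda>s. pos c a b s p) has_real_derivative vel a b s p) (at s)"
  unfolding pos_def vel_def by (auto intro!: derivative_eq_intros)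

lemma flow_deriv_mu: "p \<in> params d n \<Longrightarrow> flow_deriv (\<lambda>\<mu> y b x. \<mu> p) (\<lambda>\<mu> y b x. y p)"
  by (simp add: flow_deriv_def stat.mu stat.velo pos_deriv del: mem_Sigma_iff)

lemma flow_deriv_velo: "p \<in> params d n \<Longrightarrow> flow_deriv (\<lambda>\<mu> y b x. y p) (\<lambda>\<mu> y b x. 2 * b p)"
  unfolding flow_deriv_def vel_def
  by (auto intro!: stat.velo stat.mult stat.const stat.acc derivative_eq_intros)

lemma flow_deriv_acc: "p \<in> params d n \<Longrightarrow> flow_deriv (\<lambda>\<mu> y b x. b p) (\<lambda>\<mu> y b x. 0)"
  unfolding flow_deriv_def by (auto intro!: stat.const stat.acc)

lemma flow_deriv_add: "flow_deriv e e' \<Longrightarrow> flow_deriv g g' \<Longrightarrow>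
    flow_deriv (\<lambda>\<mu> y b x. e \<mu> y b x + g \<mu> y b x) (\<lambda>\<mu> y b x. e' \<mu> y b x + g' \<mu> y b x)"
  unfolding flow_deriv_def by (intro conjI allI stat.add DERIV_add) auto

lemma flow_deriv_mult: "flow_deriv e e' \<Longrightarrow> flow_deriv g g' \<Longrightarrow>
    flow_deriv (\<lambda>\<mu> y b x. e \<mu> y b x * g \<mu> y b x) (\<lambda>\<mu> y b x. e' \<mu> y b x * g \<mu> y b x + g' \<mu> y b x * e \<mu> y b x)"
  unfolding flow_deriv_def by (intro conjI allI stat.mult stat.add DERIV_mult) auto

lemma flow_deriv_uminus: "flow_deriv e e' \<Longrightarrow> flow_deriv (\<lambda>\<mu> y b x. - e \<mu> y b x) (\<lambda>\<mu> y b x. - e' \<mu> y b x)"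
  unfolding flow_deriv_def by (intro conjI allI stat_uminus DERIV_minus) auto

lemma flow_deriv_diff: "flow_deriv e e' \<Longrightarrow> flow_deriv g g' \<Longrightarrow>
    flow_deriv (\<lambda>\<mu> y b x. e \<mu> y b x - g \<mu> y b x) (\<lambda>\<mu> y b x. e' \<mu> y b x - g' \<mu> y b x)"
  unfolding flow_deriv_def by (intro conjI allI stat_diff DERIV_diff) auto

lemma flow_deriv_sum:
  assumes "finite A" "\<And>a. a \<in> A \<Longrightarrow> flow_deriv (e a) (e' a)"
  shows "flow_deriv (\<lambda>\<mu> y b x. \<Sum>a\<in>A. e a \<mu> y b x) (\<lambda>\<mu> y b x. \<Sum>a\<in>A. e' a \<mu> y b x)"
  using assms by (induction A rule: finite_induct) (auto intro: flow_deriv_const flow_deriv_add)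

lemma gauss_deriv:
  "((\<lambda>s. gauss d (curry (pos c a b s) i) x) has_real_derivative
     gauss d (curry (pos c a b s) i) x * lin d i (pos c a b s) (vel a b s) x) (at s)"
proof -
  have 1: "((\<lambda>s. \<Sum>k<d. (x k - pos c a b s (i, k))\<^sup>2) has_real_derivative
      (\<Sum>k<d. 2 * (x k - pos c a b s (i, k)) * (0 - vel a b s (i, k)))) (at s)"
    by (intro DERIV_sum) (auto intro!: derivative_eq_intros pos_deriv)
  have "((\<lambda>s. exp (- (\<Sum>k<d. (x k - pos c a b s (i, k))\<^sup>2) / 2)) has_real_derivative
      exp (- (\<Sum>k<d. (x k - pos c a b s (i, k))\<^sup>2) / 2) *
      (- (\<Sum>k<d. 2 * (x k - pos c a b s (i, k)) * (0 - vel a b s (i, k))) / 2)) (at s)"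
    by (rule DERIV_fun_exp[OF DERIV_cdivide[OF DERIV_minus[OF 1]]])
  moreover have "- (\<Sum>k<d. 2 * (x k - pos c a b s (i, k)) * (0 - vel a b s (i, k))) / 2 = lin d i (pos c a b s) (vel a b s) x"
    unfolding lin_def sum_negf[symmetric] sum_divide_distrib by (intro sum.cong refl) (simp add: field_simps)
  ultimately have "((\<lambda>s. exp (- (\<Sum>k<d. (x k - pos c a b s (i, k))\<^sup>2) / 2)) has_real_derivative
      exp (- (\<Sum>k<d. (x k - pos c a b s (i, k))\<^sup>2) / 2) * lin d i (pos c a b s) (vel a b s) x) (at s)" by (simp only:)
  from DERIV_cmult[OF this, of "(2 * pi) powr (- real d / 2)"]
  show ?thesis unfolding gauss_exp by (simp add: mult.assoc)
qed

lemma mixture_deriv: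
  "((\<lambda>s. mixture d n w (curry (pos c a b s)) x) has_real_derivative
     mixture d n w (curry (pos c a b s)) x *
       (\<Sum>j<n. resp d n w j (pos c a b s) x * lin d j (pos c a b s) (vel a b s) x)) (at s)"
proof -
  have "((\<lambda>s. mixture d n w (curry (pos c a b s)) x) has_real_derivative
     (\<Sum>j<n. w j * (gauss d (curry (pos c a b s) j) x * lin d j (pos c a b s) (vel a b s) x))) (at s)"
    unfolding mixture_def by (intro DERIV_sum DERIV_cmult gauss_deriv)
  also have "(\<Sum>j<n. w j * (gauss d (curry (pos c a b s) j) x * lin d j (pos c a b s) (vel a b s) x))
    = mixture d n w (curry (pos c a b s)) x *
       (\<Sum>j<n. resp d n w j (pos c a b s) x * lin d j (pos c a b s) (vel a b s) x)"
    unfolding sum_distrib_left resp_def using mix_pos[of "curry (pos c a b s)" x]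
    by (intro sum.cong refl) (simp add: field_simps)
  finally show ?thesis .
qed

text \<open>Fisher's identity: the score of a mixture is the posterior average of the component
  scores.\<close>

lemma flow_deriv_ln: "flow_deriv (\<lambda>\<mu> y b x. ln (mixture d n w (curry \<mu>) x)) (\<lambda>\<mu> y b x. \<Sum>j<n. resp d n w j \<mu> x * lin d j \<mu> y x)"
  unfolding flow_deriv_def
proof (intro conjI allI)
  fix c a b s x
  show "((\<lambda>s. ln (mixture d n w (curry (pos c a b s)) x)) has_real_derivative
      (\<Sum>j<n. resp d n w j (pos c a b s) x * lin d j (pos c a b s) (vel a b s) x)) (at s)"
    using mixture_deriv[of c a b x s] mix_pos[of "curry (pos c a b s)" x]
    by (auto intro!: derivative_eq_intros)
qed (auto intro!: stat.ln stat_sum stat.mult stat.resp stat_lin)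

text \<open>The softmax rule: the logarithmic derivative of a posterior probability is its own
  component score minus the posterior average.\<close>

lemma flow_deriv_resp:
  assumes i: "i < n"
  shows "flow_deriv (\<lambda>\<mu> y b x. resp d n w i \<mu> x)
    (\<lambda>\<mu> y b x. resp d n w i \<mu> x * (lin d i \<mu> y x - (\<Sum>j<n. resp d n w j \<mu> x * lin d j \<mu> y x)))"
  unfolding flow_deriv_def
proof (intro conjI allI)
  fix c a b s x
  define X where "X = mixture d n w (curry (pos c a b s)) x"
  define Z where "Z = (\<Sum>j<n. resp d n w j (pos c a b s) x * lin d j (pos c a b s) (vel a b s) x)"
  define g where "g = gauss d (curry (pos c a b s) i) x"
  define A where "A = lin d i (pos c a b s) (vel a b s) x"
  have X: "X \<noteq> 0" using mix_pos[of "curry (pos c a b s)" x] by (simp add: X_def)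
  have "((\<lambda>s. w i * gauss d (curry (pos c a b s) i) x / mixture d n w (curry (pos c a b s)) x) has_real_derivative
      (w i * (g * A) * X - w i * g * (X * Z)) / (X * X)) (at s)"
    unfolding g_def A_def X_def Z_def
    by (intro DERIV_divide DERIV_cmult gauss_deriv mixture_deriv) (use mix_pos in \<open>simp add: less_imp_neq[symmetric]\<close>)
  also have "(w i * (g * A) * X - w i * g * (X * Z)) / (X * X) = (w i * g / X) * (A - Z)"
    using X by (simp add: field_simps)
  finally show "((\<lambda>s. resp d n w i (pos c a b s) x) has_real_derivative
      resp d n w i (pos c a b s) x * (lin d i (pos c a b s) (vel a b s) x
        - (\<Sum>j<n. resp d n w j (pos c a b s) x * lin d j (pos c a b s) (vel a b s) x))) (at s)"
    by (simp only: resp_def g_def A_def X_def Z_def)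
qed (use i in \<open>auto intro!: stat_sum stat_diff stat.mult stat.resp stat_lin\<close>)

lemma stat_flow_deriv: "stat d n w e \<Longrightarrow> \<exists>e'. flow_deriv e e'"
proof (induction rule: stat.induct)
  case (add e g)
  then show ?case using flow_deriv_add by blast
next
  case (mult e g)
  then show ?case using flow_deriv_mult by blast
next
  case ln
  show ?case using flow_deriv_ln by blast
qed (blast intro: flow_deriv_const flow_deriv_sample flow_deriv_mu flow_deriv_velo flow_deriv_acc flow_deriv_resp)+

definition mean :: "(par \<Rightarrow> par \<Rightarrow> par \<Rightarrow> (nat \<Rightarrow> real) \<Rightarrow> real) \<Rightarrow> par \<Rightarrow> par \<Rightarrow> par \<Rightarrow> real" where
  "mean e \<mu> y b = (\<integral>x. e \<mu> y b x \<partial>P)"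

section \<open>Expectations of statistics along parabolas\<close>

lemma mean_sum:
  assumes "finite A" "\<And>a. a \<in> A \<Longrightarrow> stat d n w (e a)"
  shows "mean (\<lambda>\<mu> y b x. \<Sum>a\<in>A. r a * e a \<mu> y b x) \<mu> y b = (\<Sum>a\<in>A. r a * mean (e a) \<mu> y b)"
  unfolding mean_def using assms
  by (subst Bochner_Integration.integral_sum) (auto intro: stat_integrable)

lemma mean_bound:
  assumes "stat d n w e"
  shows "\<exists>C>0. \<forall>\<mu> y b. bdd R \<mu> \<longrightarrow> bdd R y \<longrightarrow> bdd R b \<longrightarrow> \<bar>mean e \<mu> y b\<bar> \<le> C"
proof -
  obtain C N where C: "0 \<le> C" "\<And>\<mu> y b x. bdd R \<mu> \<Longrightarrow> bdd R y \<Longrightarrow> bdd R b \<Longrightarrow> \<bar>e \<mu> y b x\<bar> \<le> C * pweight d N x"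
    using stat_growth[OF assms, of R] by blast
  define K where "K = 1 + (\<integral>x. C * pweight d N x \<partial>P)"
  have i: "integrable P (\<lambda>x. C * pweight d N x)" by (intro integrable_mult_right mixture_measure_pweight ps)
  have K: "0 < K" unfolding K_def
    using C(1) by (intro add_pos_nonneg Bochner_Integration.integral_nonneg mult_nonneg_nonneg)
      (auto intro: order_trans[OF zero_le_one pweight_ge_1])
  have "\<bar>mean e \<mu> y b\<bar> \<le> K" if "bdd R \<mu>" "bdd R y" "bdd R b" for \<mu> y b
  proof -
    have "\<bar>mean e \<mu> y b\<bar> \<le> (\<integral>x. \<bar>e \<mu> y b x\<bar> \<partial>P)" unfolding mean_def by (rule integral_abs_bound)
    also have "\<dots> \<le> (\<integral>x. C * pweight d N x \<partial>P)"
      using C(2)[OF that] by (intro integral_mono integrable_abs stat_integrable assms i) auto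
    finally show ?thesis by (simp add: K_def)
  qed
  then show ?thesis using K by blast
qed

text \<open>The factor 7 is 1 + 2 + 4 for |s| \<le> 2. Parameters up to 2 occur because
  differentiation under the integral at |s0| \<le> 1 uses a dominating function on an interval of
  radius 1.\<close>

lemma bdd_pos: "bdd R c \<Longrightarrow> bdd R a \<Longrightarrow> bdd R b \<Longrightarrow> \<bar>s\<bar> \<le> 2 \<Longrightarrow> bdd (7 * R) (pos c a b s)"
  and bdd_vel: "bdd R a \<Longrightarrow> bdd R b \<Longrightarrow> \<bar>s\<bar> \<le> 2 \<Longrightarrow> bdd (7 * R) (vel a b s)"
proof -
  assume R: "bdd R a" "bdd R b" and s: "\<bar>s\<bar> \<le> 2"
  have s2: "s\<^sup>2 \<le> 4" using abs_le_square_iff[of s 2] s by simp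
  {
    fix p assume p: "p \<in> params d n"
    have ab: "\<bar>a p\<bar> \<le> R" "\<bar>b p\<bar> \<le> R" using R p by (auto simp: bdd_def)
    then have R0: "0 \<le> R" by linarith
    have "\<bar>s * a p\<bar> \<le> 2 * R" "\<bar>s * b p\<bar> \<le> 2 * R" "\<bar>s\<^sup>2 * b p\<bar> \<le> 4 * R"
      unfolding abs_mult using s s2 ab R0 by (auto intro!: mult_mono)
    note this R0 ab
  } note * = this
  show "bdd (7 * R) (vel a b s)"
    unfolding bdd_def vel_def
  proof
    fix p assume p: "p \<in> params d n"
    show "\<bar>a p + 2 * s * b p\<bar> \<le> 7 * R" using *[OF p] by (simp only: mult.assoc)
  qed
  show "bdd (7 * R) (pos c a b s)" if "bdd R c"
    unfolding bdd_def pos_def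
  proof
    fix p assume p: "p \<in> params d n"
    have "\<bar>c p\<bar> \<le> R" using that p by (auto simp: bdd_def)
    then show "\<bar>c p + s * a p + s\<^sup>2 * b p\<bar> \<le> 7 * R" using *[OF p] by linarith
  qed
qed

lemma bdd_mono: "bdd R z \<Longrightarrow> R \<le> R' \<Longrightarrow> bdd R' z"
  by (force simp: bdd_def)

lemma bdd_exists: "\<exists>R. bdd R c \<and> bdd R a \<and> bdd R b"
proof -
  have "\<bar>c p\<bar> + \<bar>a p\<bar> + \<bar>b p\<bar> \<le> (\<Sum>p\<in>params d n. \<bar>c p\<bar> + \<bar>a p\<bar> + \<bar>b p\<bar>)" if "p \<in> params d n" for p
    using that by (intro member_le_sum) auto
  then show ?thesis unfolding bdd_def by (intro exI[of _ "\<Sum>p\<in>params d n. \<bar>c p\<bar> + \<bar>a p\<bar> + \<bar>b p\<bar>"]) (smt (verit) abs_ge_zero)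
qed

lemma mean_deriv:
  assumes p: "flow_deriv e e'" and s0: "\<bar>s0\<bar> \<le> 1"
  shows "((\<lambda>s. mean e (pos c a b s) (vel a b s) b) has_real_derivative mean e' (pos c a b s0) (vel a b s0) b) (at s0)"
proof -
  have e: "stat d n w e" "stat d n w e'" using p by (auto simp: flow_deriv_def)
  obtain R where R: "bdd R c" "bdd R a" "bdd R b" using bdd_exists by blast
  have R7: "bdd (7 * R) b" using bdd_vel[OF R(3) R(3), of 0] by (simp add: vel_def)
  obtain C N where C: "\<And>\<mu> y b x. bdd (7 * R) \<mu> \<Longrightarrow> bdd (7 * R) y \<Longrightarrow> bdd (7 * R) b \<Longrightarrow> \<bar>e' \<mu> y b x\<bar> \<le> C * pweight d N x"
    using stat_growth[OF e(2), of "7 * R"] by blast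
  show ?thesis
    unfolding mean_def
  proof (rule has_real_derivative_integral[where u = "\<lambda>s x. e (pos c a b s) (vel a b s) b x"
        and u' = "\<lambda>s x. e' (pos c a b s) (vel a b s) b x" and g = "\<lambda>x. C * pweight d N x"])
    show "\<bar>e' (pos c a b s) (vel a b s) b x\<bar> \<le> C * pweight d N x" if "\<bar>s - s0\<bar> < 1" for s x
      using that s0 by (intro C bdd_pos bdd_vel R R7) auto
    show "e' (pos c a b s0) (vel a b s0) b \<in> borel_measurable P"
      using stat_measurable[OF e(2)] by (simp add: mixture_measure_def)
    show "integrable P (\<lambda>x. C * pweight d N x)" by (intro integrable_mult_right mixture_measure_pweight ps)
  qed (use p in \<open>auto simp: flow_deriv_def intro: stat_integrable\<close>)
qed

text \<open>The first derivatives are prescribed, because they must be recognised as gradient and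
  Hessian terms. The higher ones are only needed to exist with a uniform bound, so they are chosen
  by iterating \<open>stat_flow_deriv\<close>.\<close>

lemma mean_tower:
  assumes "flow_deriv e0 e1" "flow_deriv e1 e2"
  shows "\<exists>C>0. \<forall>c a b. bdd R c \<longrightarrow> bdd R a \<longrightarrow> bdd R b \<longrightarrow> (\<exists>D. tower C 5 D \<and>
    D 0 = (\<lambda>s. mean e0 (pos c a b s) (vel a b s) b) \<and>
    D 1 = (\<lambda>s. mean e1 (pos c a b s) (vel a b s) b) \<and>
    D 2 = (\<lambda>s. mean e2 (pos c a b s) (vel a b s) b))"
proof -
  obtain nxt where nxt: "\<And>e. stat d n w e \<Longrightarrow> flow_deriv e (nxt e)" using stat_flow_deriv by metis
  define F where "F = (\<lambda>k::nat. if k = 0 then e0 else if k = 1 then e1 else (nxt ^^ (k - 2)) e2)"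
  have F2: "stat d n w (F (k + 2))" for k
  proof (induction k)
    case 0
    then show ?case using assms by (simp add: F_def flow_deriv_def)
  next
    case (Suc k)
    then have "flow_deriv (F (k + 2)) (nxt (F (k + 2)))" by (rule nxt)
    then show ?case by (simp add: F_def flow_deriv_def)
  qed
  have F: "flow_deriv (F k) (F (Suc k))" for k
  proof -
    consider "k = 0" | "k = 1" | j where "k = j + 2"
      by (metis One_nat_def Suc_1 add.commute add_Suc_right not0_implies_Suc plus_1_eq_Suc)
    then show ?thesis
    proof cases
      case 3
      then show ?thesis using nxt[OF F2[of j]] by (simp add: F_def)
    qed (use assms in \<open>auto simp: F_def\<close>)
  qed
  then have Fc: "stat d n w (F k)" for k :: nat by (auto simp: flow_deriv_def)
  have "\<exists>C>0. \<forall>\<mu> y b. bdd (7 * R) \<mu> \<longrightarrow> bdd (7 * R) y \<longrightarrow> bdd (7 * R) b \<longrightarrow> \<bar>mean (F k) \<mu> y b\<bar> \<le> C" for k :: nat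
    by (rule mean_bound[OF Fc])
  then obtain C where C: "\<And>k. 0 < C k"
    "\<And>k \<mu> y b. bdd (7 * R) \<mu> \<Longrightarrow> bdd (7 * R) y \<Longrightarrow> bdd (7 * R) b \<Longrightarrow> \<bar>mean (F k) \<mu> y b\<bar> \<le> C k" by metis
  define K where "K = (\<Sum>k\<le>5. C k)"
  have CK: "C k \<le> K" if "k \<le> 5" for k :: nat unfolding K_def using C(1) that by (intro member_le_sum) (auto intro: less_imp_le)
  have K: "0 < K" using C(1)[of 0] CK[of 0] by simp
  have "\<exists>D. tower K 5 D \<and>
    D 0 = (\<lambda>s. mean e0 (pos c a b s) (vel a b s) b) \<and>
    D 1 = (\<lambda>s. mean e1 (pos c a b s) (vel a b s) b) \<and>
    D 2 = (\<lambda>s. mean e2 (pos c a b s) (vel a b s) b)" if R: "bdd R c" "bdd R a" "bdd R b" for c a b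
  proof (intro exI conjI)
    have R7: "bdd (7 * R) b" using bdd_vel[OF R(3) R(3), of 0] by (simp add: vel_def)
    show "tower K 5 (\<lambda>k s. mean (F k) (pos c a b s) (vel a b s) b)"
      unfolding tower_def
    proof (intro conjI allI impI)
      fix k :: nat and s assume k: "k \<le> 5" and s: "\<bar>s::real\<bar> \<le> 1"
      have "\<bar>mean (F k) (pos c a b s) (vel a b s) b\<bar> \<le> C k"
        using s by (intro C(2) bdd_pos bdd_vel R R7) auto
      then show "\<bar>mean (F k) (pos c a b s) (vel a b s) b\<bar> \<le> K" using CK[OF k] by simp
    qed (rule mean_deriv[OF F])
  qed (simp_all add: F_def)
  then show ?thesis using K by blast
qed

end

section \<open>Gaussian smoothing with prescribed minima\<close>

text \<open>Trigonometric polynomials with arbitrary real frequencies. The amplitude-phase form is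
  closed under products by the product-to-sum formula, and Gaussian smoothing acts on each summand
  as a scalar.\<close>

inductive trig :: "(real \<Rightarrow> real) \<Rightarrow> bool" where
  cos: "trig (\<lambda>t. a * cos (v * t + b))"
| add: "trig f \<Longrightarrow> trig g \<Longrightarrow> trig (\<lambda>t. f t + g t)"

lemma trig_const: "trig (\<lambda>t. a)"
  using trig.cos[of a 0 0] by simp

lemma trig_mult:
  assumes "trig f" "trig g"
  shows "trig (\<lambda>t. f t * g t)"
  using assms
proof (induction f rule: trig.induct)
  case (cos a v b)
  from cos show ?case
  proof (induction g rule: trig.induct)
    case (cos a' v' b')
    have "(\<lambda>t. a * cos (v * t + b) * (a' * cos (v' * t + b')))
        = (\<lambda>t. a * a' / 2 * cos ((v - v') * t + (b - b')) + a * a' / 2 * cos ((v + v') * t + (b + b')))"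
    proof
      fix t
      have "cos (v * t + b) * cos (v' * t + b') =
          (cos ((v - v') * t + (b - b')) + cos ((v + v') * t + (b + b'))) / 2"
      proof -
        have "(v * t + b) - (v' * t + b') = (v - v') * t + (b - b')"
          "(v * t + b) + (v' * t + b') = (v + v') * t + (b + b')" by (simp_all add: algebra_simps)
        then show ?thesis unfolding cos_times_cos by (simp only:)
      qed
      moreover have "a * cos (v * t + b) * (a' * cos (v' * t + b')) = a * a' * (cos (v * t + b) * cos (v' * t + b'))"
        by simp
      ultimately show "a * cos (v * t + b) * (a' * cos (v' * t + b'))
        = a * a' / 2 * cos ((v - v') * t + (b - b')) + a * a' / 2 * cos ((v + v') * t + (b + b'))"
        by (simp only:) (simp only: add_divide_distrib distrib_left times_divide_eq_left times_divide_eq_right)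
    qed
    then show ?case by (simp only: trig.add trig.cos)
  next
    case (add f g)
    then have "trig (\<lambda>t. a * cos (v * t + b) * f t + a * cos (v * t + b) * g t)" by (intro trig.add)
    then show ?case by (simp add: distrib_left)
  qed
next
  case (add f1 f2)
  then have "trig (\<lambda>t. f1 t * g t + f2 t * g t)" by (intro trig.add) auto
  then show ?case by (simp add: distrib_right)
qed

lemma trig_prod: "finite A \<Longrightarrow> (\<And>a. a \<in> A \<Longrightarrow> trig (f a)) \<Longrightarrow> trig (\<lambda>t. \<Prod>a\<in>A. f a t)"
  by (induction A rule: finite_induct) (auto intro: trig_const trig_mult)

lemma trig_continuous: "trig f \<Longrightarrow> continuous_on S f"
  by (induction rule: trig.induct) (auto intro!: continuous_intros)

text \<open>The real part of the characteristic function of the standard normal law, after a shift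
  by \<open>c\<close>: smoothing multiplies a wave of frequency \<open>v\<close> by
  \<open>exp (- v\<^sup>2 / 2)\<close>.\<close>

lemma normal_cos:
  "(\<integral>t. normal_density c 1 t * cos (v * t + b) \<partial>lborel) = exp (- v\<^sup>2 / 2) * cos (v * c + b)"
proof -
  define z where "z = iexp (v * c + b)"
  have "char std_normal_distribution v = complex_of_real (exp (- v\<^sup>2 / 2))"
    using char_std_normal_distribution by simp
  moreover have "char std_normal_distribution v = (CLINT t|lborel. std_normal_density t *\<^sub>R iexp (v * t))"
    unfolding char_def by (subst integral_density) (auto simp: normal_density_nonneg)
  ultimately have c: "(CLINT t|lborel. std_normal_density t *\<^sub>R iexp (v * t)) = exp (- v\<^sup>2 / 2)" by simp
  have int: "integrable lborel (\<lambda>t. std_normal_density t *\<^sub>R iexp (v * t))"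
    by (rule Bochner_Integration.integrable_bound[OF integrable_normal_density[of 1 0]]) auto
  have "(\<integral>t. normal_density c 1 t * cos (v * t + b) \<partial>lborel)
      = (\<integral>t. normal_density c 1 (c + 1 * t) * cos (v * (c + 1 * t) + b) \<partial>lborel)"
    by (subst lborel_integral_real_affine[where c = 1 and t = c]) auto
  also have "\<dots> = (\<integral>t. Re (z * (std_normal_density t *\<^sub>R iexp (v * t))) \<partial>lborel)"
  proof (rule Bochner_Integration.integral_cong[OF refl])
    fix t :: real
    have "z * iexp (v * t) = iexp (v * (c + t) + b)"
      by (simp add: z_def exp_add[symmetric] algebra_simps)
    then have "Re (z * iexp (v * t)) = cos (v * (c + t) + b)" by (simp add: Re_exp)
    then show "normal_density c 1 (c + 1 * t) * cos (v * (c + 1 * t) + b) = Re (z * (std_normal_density t *\<^sub>R iexp (v * t)))"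
      by (simp add: normal_density_def scaleR_conv_of_real mult.left_commute[of z])
  qed
  also have "\<dots> = Re (CLINT t|lborel. z * (std_normal_density t *\<^sub>R iexp (v * t)))"
    by (intro integral_Re integrable_mult_right int)
  also have "\<dots> = Re (z * complex_of_real (exp (- v\<^sup>2 / 2)))"
    by (simp only: integral_mult_right_zero c)
  also have "\<dots> = exp (- v\<^sup>2 / 2) * cos (v * c + b)" by (simp add: z_def Re_exp)
  finally show ?thesis .
qed

text \<open>Deconvolution: each amplitude is multiplied by \<open>exp (v\<^sup>2 / 2)\<close>. With
  finitely many frequencies the preimage stays bounded.\<close>

lemma trig_gauss_preimage:
  "trig f \<Longrightarrow> \<exists>g B. g \<in> borel_measurable borel \<and> (\<forall>t. \<bar>g t\<bar> \<le> B) \<and>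
     (\<forall>c. (\<integral>t. normal_density c 1 t * g t \<partial>lborel) = f c)"
proof (induction rule: trig.induct)
  case (cos a v b)
  define K where "K = a * exp (v\<^sup>2 / 2)"
  define g where "g = (\<lambda>t. K * cos (v * t + b))"
  have "\<bar>g t\<bar> \<le> \<bar>K\<bar>" for t
    using mult_left_mono[OF abs_cos_le_one, of "\<bar>K\<bar>" "v * t + b"] by (simp add: g_def abs_mult)
  moreover have "(\<integral>t. normal_density c 1 t * g t \<partial>lborel) = a * cos (v * c + b)" for c
  proof -
    have "(\<integral>t. normal_density c 1 t * g t \<partial>lborel) = K * (\<integral>t. normal_density c 1 t * cos (v * t + b) \<partial>lborel)"
      unfolding g_def by (simp add: mult.left_commute)
    also have "\<dots> = a * (exp (v\<^sup>2 / 2) * exp (- v\<^sup>2 / 2)) * cos (v * c + b)"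
      by (simp only: normal_cos K_def mult.assoc)
    also have "exp (v\<^sup>2 / 2) * exp (- v\<^sup>2 / 2) = 1" by (simp add: exp_add[symmetric])
    finally show ?thesis by simp
  qed
  moreover have "g \<in> borel_measurable borel" unfolding g_def by measurable
  ultimately show ?case by blast
next
  case (add f1 f2)
  obtain g1 B1 where g1: "g1 \<in> borel_measurable borel" "\<And>t. \<bar>g1 t\<bar> \<le> B1"
    "\<And>c. (\<integral>t. normal_density c 1 t * g1 t \<partial>lborel) = f1 c" using add.IH(1) by blast
  obtain g2 B2 where g2: "g2 \<in> borel_measurable borel" "\<And>t. \<bar>g2 t\<bar> \<le> B2"
    "\<And>c. (\<integral>t. normal_density c 1 t * g2 t \<partial>lborel) = f2 c" using add.IH(2) by blast
  have i: "integrable lborel (\<lambda>t. normal_density c 1 t * g t)"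
    if g: "g \<in> borel_measurable borel" "\<And>t. \<bar>g t\<bar> \<le> B" for c B and g :: "real \<Rightarrow> real"
  proof (rule Bochner_Integration.integrable_bound)
    show "integrable lborel (\<lambda>t. B * normal_density c 1 t)" by simp
    show "AE t in lborel. norm (normal_density c 1 t * g t) \<le> norm (B * normal_density c 1 t)"
    proof (rule AE_I2)
      fix t
      have "\<bar>g t\<bar> * normal_density c 1 t \<le> \<bar>B\<bar> * normal_density c 1 t"
        using g(2)[of t] by (intro mult_right_mono) auto
      then show "norm (normal_density c 1 t * g t) \<le> norm (B * normal_density c 1 t)"
        by (simp add: abs_mult mult.commute)
    qed
  qed (use g in measurable)
  have "(\<lambda>t. g1 t + g2 t) \<in> borel_measurable borel" using g1(1) g2(1) by measurable
  moreover have "\<bar>g1 t + g2 t\<bar> \<le> B1 + B2" for t using g1(2)[of t] g2(2)[of t] by linarith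
  moreover have "(\<integral>t. normal_density c 1 t * (g1 t + g2 t) \<partial>lborel) = f1 c + f2 c" for c
    using i[OF g1(1,2), of c] i[OF g2(1,2), of c] g1(3) g2(3) by (simp add: distrib_left)
  ultimately show ?case by blast
qed

lemma one_minus_cos_ge: "\<bar>u\<bar> \<le> 1 \<Longrightarrow> u\<^sup>2 / 4 \<le> 1 - cos (u::real)"
proof -
  assume u: "\<bar>u\<bar> \<le> 1"
  have "\<exists>t. \<bar>t\<bar> \<le> \<bar>u\<bar> \<and> cos u = (\<Sum>m<4. cos_coeff m * u ^ m) + (cos (t + 1 / 2 * real 4 * pi) / fact 4) * u ^ 4"
    by (rule Maclaurin_cos_expansion)
  then obtain t where t: "cos u = (\<Sum>m<4. cos_coeff m * u ^ m) + (cos (t + 1 / 2 * real 4 * pi) / fact 4) * u ^ 4" by blast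
  have c: "cos (t + 1 / 2 * real 4 * pi) \<le> 1" by simp
  have "(cos (t + 1 / 2 * real 4 * pi) / fact 4) * u ^ 4 \<le> (1 / 24) * u ^ 4"
    using c by (intro mult_right_mono) (auto simp: fact_numeral)
  also have "\<dots> \<le> (1 / 24) * u\<^sup>2"
  proof -
    have "u ^ 4 = u\<^sup>2 * u\<^sup>2" by (simp add: power2_eq_square eval_nat_numeral)
    also have "\<dots> \<le> u\<^sup>2 * 1" using u by (intro mult_left_mono) (auto simp: abs_square_le_1)
    finally show ?thesis by simp
  qed
  finally have "cos u \<le> (\<Sum>m<4. cos_coeff m * u ^ m) + (1 / 24) * u\<^sup>2" using t by simp
  also have "(\<Sum>m<4. cos_coeff m * u ^ m) = 1 - u\<^sup>2 / 2"
  proof -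
    have "{..<4} = {0, 1, 2, 3::nat}" by auto
    then show ?thesis by (simp add: cos_coeff_def)
  qed
  finally show ?thesis using zero_le_power2[of u] by linarith
qed

text \<open>The trigonometric polynomial \<open>\<Prod>a\<in>Y. 1 - cos (v (t - a))\<close> has nondegenerate minima exactly where
  needed, and every trigonometric polynomial is the Gaussian smoothing of another one.\<close>

lemma gauss_local_minima:
  assumes "finite (Y :: real set)"
  shows "\<exists>g B c \<rho>. g \<in> borel_measurable borel \<and> 0 < B \<and> (\<forall>t. \<bar>g t\<bar> \<le> B) \<and> 0 < c \<and> 0 < \<rho> \<and>
    (\<forall>y\<in>Y. \<forall>s. \<bar>s - y\<bar> \<le> \<rho> \<longrightarrow>
      c * (s - y)\<^sup>2 \<le> (\<integral>t. normal_density s 1 t * g t \<partial>lborel) - (\<integral>t. normal_density y 1 t * g t \<partial>lborel))"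
proof -
  define D where "D = 1 + (\<Sum>a\<in>Y. \<bar>a\<bar>)"
  have D: "1 \<le> D" by (simp add: D_def sum_nonneg)
  have YD: "\<bar>a\<bar> \<le> D" if "a \<in> Y" for a
    using member_le_sum[of a Y abs] that assms by (simp add: D_def)
  \<comment> \<open>Points of \<open>Y\<close> differ by at most \<open>2 * D\<close>, so the phases
    \<open>v * (y - a)\<close> stay in [-1, 1], where \<open>1 - cos\<close> vanishes only at
    0.\<close>
  define v where "v = 1 / (2 * D)"
  have v: "0 < v" "v \<le> 1" using D by (auto simp: v_def)
  define h where "h = (\<lambda>a t. 1 - cos (v * (t - a)))"
  have htrig: "trig (h a)" for a
  proof -
    have "trig (\<lambda>t. 1 + (-1) * cos (v * t + (- v * a)))" by (intro trig.add trig_const trig.cos)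
    then show ?thesis by (simp add: h_def algebra_simps)
  qed
  define F where "F = (\<lambda>t. \<Prod>a\<in>Y. h a t)"
  have "trig F" unfolding F_def by (intro trig_prod assms htrig)
  from trig_gauss_preimage[OF this] obtain g B where g: "g \<in> borel_measurable borel" "\<And>t. \<bar>g t\<bar> \<le> B"
    "\<And>s. (\<integral>t. normal_density s 1 t * g t \<partial>lborel) = F s" by blast
  have FY: "F y = 0" if "y \<in> Y" for y
    unfolding F_def by (rule prod_zero[OF assms]) (use that in \<open>auto simp: h_def intro!: bexI[of _ y]\<close>)
  have "\<exists>c>0. \<exists>\<rho>>0. \<forall>s. \<bar>s - y\<bar> \<le> \<rho> \<longrightarrow> c * (s - y)\<^sup>2 \<le> F s" if y: "y \<in> Y" for y
  proof -
    \<comment> \<open>The factors without a zero at \<open>y\<close>. Their product is positive at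
      \<open>y\<close>, hence at least half as large nearby, and the remaining factor supplies the
      quadratic growth.\<close>
    define R where "R = (\<lambda>t. \<Prod>a\<in>Y - {y}. h a t)"
    have "0 < h a y" if a: "a \<in> Y - {y}" for a
    proof -
      have "\<bar>y - a\<bar> \<le> 2 * D" using YD[OF y] YD[of a] a by auto
      then have "\<bar>v * (y - a)\<bar> \<le> 1" using D by (simp add: v_def abs_mult)
      from one_minus_cos_ge[OF this] have "(v * (y - a))\<^sup>2 / 4 \<le> h a y" by (simp add: h_def)
      moreover have "0 < (v * (y - a))\<^sup>2" using v a by simp
      ultimately show ?thesis by linarith
    qed
    then have Ry: "0 < R y" unfolding R_def by (intro prod_pos) auto
    have "trig R" unfolding R_def using assms by (intro trig_prod htrig) auto
    then have "continuous_on UNIV R" by (rule trig_continuous)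
    then have "isCont R y" by (simp add: continuous_on_eq_continuous_at)
    then obtain e where e: "0 < e" "\<And>t. \<bar>t - y\<bar> < e \<Longrightarrow> \<bar>R t - R y\<bar> < R y / 2"
      unfolding continuous_at_eps_delta dist_real_def using Ry by (meson half_gt_zero)
    define \<rho> where "\<rho> = min 1 (e / 2)"
    have "(R y * v\<^sup>2 / 8) * (s - y)\<^sup>2 \<le> F s" if s: "\<bar>s - y\<bar> \<le> \<rho>" for s
    proof -
      have "\<bar>s - y\<bar> < e" using s e(1) by (auto simp: \<rho>_def)
      from e(2)[OF this] have R: "R y / 2 \<le> R s" by (auto simp: abs_if split: if_splits)
      have "\<bar>v * (s - y)\<bar> \<le> 1" unfolding abs_mult using v s by (intro mult_le_one) (auto simp: \<rho>_def)
      from one_minus_cos_ge[OF this] have "(v * (s - y))\<^sup>2 / 4 \<le> h y s" by (simp add: h_def)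
      then have "(R y / 2) * ((v * (s - y))\<^sup>2 / 4) \<le> R s * h y s" using R Ry by (intro mult_mono) auto
      moreover have "(R y / 2) * ((v * (s - y))\<^sup>2 / 4) = (R y * v\<^sup>2 / 8) * (s - y)\<^sup>2"
        by (simp only: power_mult_distrib) simp
      moreover have "R s * h y s = F s" unfolding F_def R_def using y assms
        by (subst (2) prod.remove[of _ y]) (auto simp: mult.commute)
      ultimately show ?thesis by (simp only:)
    qed
    moreover have "0 < R y * v\<^sup>2 / 8" using Ry v by simp
    moreover have "0 < \<rho>" using e(1) by (simp add: \<rho>_def)
    ultimately show ?thesis by blast
  qed
  then obtain C P where CP: "\<And>y. y \<in> Y \<Longrightarrow> 0 < C y" "\<And>y. y \<in> Y \<Longrightarrow> 0 < P y"
    "\<And>y s. y \<in> Y \<Longrightarrow> \<bar>s - y\<bar> \<le> P y \<Longrightarrow> C y * (s - y)\<^sup>2 \<le> F s" by metis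
  define c where "c = Min (insert 1 (C ` Y))"
  define \<rho> where "\<rho> = Min (insert 1 (P ` Y))"
  have c: "0 < c" "\<And>y. y \<in> Y \<Longrightarrow> c \<le> C y" using assms CP(1) by (auto simp: c_def)
  have \<rho>: "0 < \<rho>" "\<And>y. y \<in> Y \<Longrightarrow> \<rho> \<le> P y" using assms CP(2) by (auto simp: \<rho>_def)
  have "c * (s - y)\<^sup>2 \<le> F s - F y" if "y \<in> Y" "\<bar>s - y\<bar> \<le> \<rho>" for y s
  proof -
    have "c * (s - y)\<^sup>2 \<le> C y * (s - y)\<^sup>2" using c that by (intro mult_right_mono) auto
    also have "\<dots> \<le> F s" using CP(3)[of y s] \<rho>(2) that by force
    finally show ?thesis using FY that by simp
  qed
  moreover have "\<bar>g t\<bar> \<le> B + 1" for t using g(2)[of t] by simp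
  moreover have "0 < B + 1" using g(2)[of 0] by simp
  ultimately show ?thesis using g(1) c(1) \<rho>(1) unfolding g(3)[symmetric]
    by (intro exI[of _ g] exI[of _ "B + 1"] exI[of _ c] exI[of _ \<rho>]) auto
qed

section \<open>Gradient and Hessian of the loss\<close>

text \<open>The partial derivative with respect to parameter \<open>p\<close> of the negative log
  density at the sample \<open>x\<close>.\<close>

definition score :: "nat \<Rightarrow> nat \<Rightarrow> (nat \<Rightarrow> real) \<Rightarrow> nat \<times> nat \<Rightarrow> par \<Rightarrow> (nat \<Rightarrow> real) \<Rightarrow> real" where
  "score d n w p \<mu> x = - (resp d n w (fst p) \<mu> x * (x (snd p) - \<mu> p))"

text \<open>Differentiates \<open>score\<close> for \<open>q\<close> once more with respect to
  parameter \<open>p\<close>: the first summand comes from the factor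
  \<open>x (snd q) - \<mu> q\<close>, the second from the posterior probability.\<close>

definition score2 :: "nat \<Rightarrow> nat \<Rightarrow> (nat \<Rightarrow> real) \<Rightarrow> nat \<times> nat \<Rightarrow> nat \<times> nat \<Rightarrow> par \<Rightarrow> (nat \<Rightarrow> real) \<Rightarrow> real" where
  "score2 d n w p q \<mu> x =
     (if p = q then resp d n w (fst q) \<mu> x else 0)
     - resp d n w (fst q) \<mu> x * ((if fst p = fst q then 1 else 0) - resp d n w (fst p) \<mu> x)
       * (x (snd p) - \<mu> p) * (x (snd q) - \<mu> q)"

lemma score2_sym: "score2 d n w p q \<mu> x = score2 d n w q p \<mu> x"
  by (auto simp: score2_def algebra_simps)

lemma mixture_cong_params:
  assumes "\<And>p. p \<in> params d n \<Longrightarrow> \<mu> p = \<nu> p"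
  shows "mixture d n w (curry \<mu>) x = mixture d n w (curry \<nu>) x"
  unfolding mixture_def gauss_exp using assms by (intro sum.cong refl arg_cong2[where f = times]) (auto intro!: sum.cong)

context gauss_model
begin

text \<open>Minus the differential entropy of the teacher, the constant by which the loss differs
  from the expected negative log-likelihood.\<close>

definition teacher_ll :: real where
  "teacher_ll = (\<integral>x. ln (mixture d m ps cs x) \<partial>P)"

lemma ln_truth_integrable: "integrable P (\<lambda>x. ln (mixture d m ps cs x))"
proof -
  \<comment> \<open>The teacher viewed as a student of itself, with \<open>m\<close>
    components.\<close>
  interpret T: gauss_model d m m ps cs ps by unfold_locales (rule ps)+
  have "curry (\<lambda>(i, k). cs i k) = cs" by (auto simp: curry_def)
  then show ?thesis using T.stat_integrable[OF stat.ln, of "\<lambda>(i, k). cs i k"] by simp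
qed

lemma prob_P: "prob_space P"
  by (rule mixture_measure_prob[OF ps])

lemma mean_const: "mean (\<lambda>\<mu> y b x. r) \<mu> y b = r"
proof -
  interpret prob_space P by (rule prob_P)
  show ?thesis by (simp add: mean_def prob_space)
qed

abbreviation "L \<equiv> loss d n m ps cs w"

lemma loss_eq: "L \<mu> = mean (\<lambda>\<mu> y b x. teacher_ll - ln (mixture d n w (curry \<mu>) x)) \<mu> y b"
proof -
  have i: "integrable P (\<lambda>x. ln (mixture d n w (curry \<mu>) x))" by (rule stat_integrable[OF stat.ln])
  have "L \<mu> = (\<integral>x. ln (mixture d m ps cs x) - ln (mixture d n w (curry \<mu>) x) \<partial>P)"
    unfolding loss_def using mixture_pos[OF ps, of d cs] mix_pos by (simp add: ln_divide_pos)
  also have "\<dots> = teacher_ll - (\<integral>x. ln (mixture d n w (curry \<mu>) x) \<partial>P)"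
    by (simp add: teacher_ll_def i ln_truth_integrable)
  also have "\<dots> = mean (\<lambda>\<mu> y b x. teacher_ll) \<mu> y b - (\<integral>x. ln (mixture d n w (curry \<mu>) x) \<partial>P)"
    by (simp add: mean_const)
  also have "\<dots> = mean (\<lambda>\<mu> y b x. teacher_ll - ln (mixture d n w (curry \<mu>) x)) \<mu> y b"
    unfolding mean_def using i stat_integrable[OF stat.const[of d n w teacher_ll]] by simp
  finally show ?thesis .
qed

lemma sum_params: "(\<Sum>p\<in>params d n. h p) = (\<Sum>i<n. \<Sum>k<d. h (i, k))"
  by (simp add: sum.cartesian_product)

lemma stat_score: "p \<in> params d n \<Longrightarrow> stat d n w (\<lambda>\<mu> y b x. score d n w p \<mu> x)"
  unfolding score_def by (intro stat_uminus stat.mult stat_diff stat.resp stat.sample stat.mu) auto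

lemma stat_score2: "p \<in> params d n \<Longrightarrow> q \<in> params d n \<Longrightarrow> stat d n w (\<lambda>\<mu> y b x. score2 d n w p q \<mu> x)"
  unfolding score2_def
  by (cases "p = q"; simp only: if_True if_False simp_thms)
     (intro stat_diff stat.mult stat.resp stat.sample stat.mu stat.const; auto)+

lemma flow_deriv_loss:
  "flow_deriv (\<lambda>\<mu> y b x. teacher_ll - ln (mixture d n w (curry \<mu>) x)) (\<lambda>\<mu> y b x. \<Sum>p\<in>params d n. y p * score d n w p \<mu> x)"
proof -
  have "(\<lambda>\<mu> y b x. \<Sum>p\<in>params d n. y p * score d n w p \<mu> x)
      = (\<lambda>\<mu> y (b::par) x. 0 - (\<Sum>j<n. resp d n w j \<mu> x * lin d j \<mu> y x))"
    by (intro ext) (simp add: sum_params score_def lin_def sum_distrib_left sum_negf mult.left_commute)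
  then show ?thesis using flow_deriv_diff[OF flow_deriv_const[of teacher_ll] flow_deriv_ln] by simp
qed

lemma flow_deriv_score:
  assumes q: "q \<in> params d n"
  shows "flow_deriv (\<lambda>\<mu> y b x. score d n w q \<mu> x) (\<lambda>\<mu> y b x. \<Sum>p\<in>params d n. y p * score2 d n w p q \<mu> x)"
proof -
  obtain j l where q': "q = (j, l)" "j < n" "l < d" using q by auto
  \<comment> \<open>Brings the contraction of \<open>score2\<close> with \<open>y\<close> into the
    shape delivered by the product rule and \<open>flow_deriv_resp\<close>.\<close>
  have e: "(\<Sum>p\<in>params d n. y p * score2 d n w p q \<mu> x)
     = - (resp d n w j \<mu> x * (lin d j \<mu> y x - (\<Sum>i<n. resp d n w i \<mu> x * lin d i \<mu> y x)) * (x l - \<mu> q)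
         + (0 - y q) * resp d n w j \<mu> x)" for \<mu> y :: par and x
  proof -
    have 1: "(\<Sum>p\<in>params d n. y p * (if p = q then resp d n w j \<mu> x else 0)) = y q * resp d n w j \<mu> x"
      using q by (simp add: if_distrib cong: if_cong)
    have 2: "(\<Sum>p\<in>params d n. y p * ((if fst p = j then 1 else 0) - resp d n w (fst p) \<mu> x) * (x (snd p) - \<mu> p))
        = lin d j \<mu> y x - (\<Sum>i<n. resp d n w i \<mu> x * lin d i \<mu> y x)"
    proof -
      have "(\<Sum>p\<in>params d n. y p * ((if fst p = j then 1 else 0) - resp d n w (fst p) \<mu> x) * (x (snd p) - \<mu> p))
        = (\<Sum>i<n. ((if i = j then 1 else 0) - resp d n w i \<mu> x) * lin d i \<mu> y x)"
        unfolding sum_params by (simp add: lin_def sum_distrib_left mult_ac)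
      also have "\<dots> = (\<Sum>i<n. (if i = j then lin d i \<mu> y x else 0)) - (\<Sum>i<n. resp d n w i \<mu> x * lin d i \<mu> y x)"
        unfolding sum_subtractf[symmetric] by (intro sum.cong refl) (simp add: left_diff_distrib)
      finally show ?thesis using q'(2) by simp
    qed
    have "(\<Sum>p\<in>params d n. y p * score2 d n w p q \<mu> x)
      = (\<Sum>p\<in>params d n. y p * (if p = q then resp d n w j \<mu> x else 0)
         - resp d n w j \<mu> x * (x l - \<mu> q) * (y p * ((if fst p = j then 1 else 0) - resp d n w (fst p) \<mu> x) * (x (snd p) - \<mu> p)))"
    proof (intro sum.cong refl)
      fix p
      have "v * (A - r * (B - s) * X * Y) = v * A - r * Y * (v * (B - s) * X)" for v A B r s X Y :: real
        by (simp add: algebra_simps)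
      then show "y p * score2 d n w p q \<mu> x = y p * (if p = q then resp d n w j \<mu> x else 0)
         - resp d n w j \<mu> x * (x l - \<mu> q) * (y p * ((if fst p = j then 1 else 0) - resp d n w (fst p) \<mu> x) * (x (snd p) - \<mu> p))"
        by (simp only: score2_def q'(1) fst_conv snd_conv)
    qed
    also have "\<dots> = y q * resp d n w j \<mu> x - resp d n w j \<mu> x * (x l - \<mu> q) *
        (lin d j \<mu> y x - (\<Sum>i<n. resp d n w i \<mu> x * lin d i \<mu> y x))"
      unfolding sum_subtractf sum_distrib_left[symmetric] 1 2 ..
    finally show ?thesis by (simp add: algebra_simps)
  qed
  have "flow_deriv (\<lambda>\<mu> y b x. - (resp d n w j \<mu> x * (x l - \<mu> q)))
    (\<lambda>\<mu> y b x. - (resp d n w j \<mu> x * (lin d j \<mu> y x - (\<Sum>i<n. resp d n w i \<mu> x * lin d i \<mu> y x)) * (x l - \<mu> q)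
         + (0 - y q) * resp d n w j \<mu> x))"
    by (intro flow_deriv_uminus flow_deriv_mult flow_deriv_resp flow_deriv_diff flow_deriv_sample flow_deriv_mu q q')
  moreover have "(\<lambda>\<mu> y (b::par) x. \<Sum>p\<in>params d n. y p * score2 d n w p q \<mu> x)
    = (\<lambda>\<mu> y b x. - (resp d n w j \<mu> x * (lin d j \<mu> y x - (\<Sum>i<n. resp d n w i \<mu> x * lin d i \<mu> y x)) * (x l - \<mu> q)
         + (0 - y q) * resp d n w j \<mu> x))"
    by (intro ext) (rule e)
  moreover have "(\<lambda>\<mu> (y::par) (b::par) x. score d n w q \<mu> x) = (\<lambda>\<mu> y b x. - (resp d n w j \<mu> x * (x l - \<mu> q)))"
    by (simp add: score_def q'(1))
  ultimately show ?thesis by (simp only:)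
qed

section \<open>Gradient and Hessian of the loss as expectations\<close>

definition grad_L :: "par \<Rightarrow> par" where
  "grad_L \<mu> p = (\<integral>x. score d n w p \<mu> x \<partial>P)"

definition hess_L :: "nat \<times> nat \<Rightarrow> nat \<times> nat \<Rightarrow> par \<Rightarrow> real" where
  "hess_L p q \<mu> = (\<integral>x. score2 d n w p q \<mu> x \<partial>P)"

lemma hess_L_sym: "hess_L p q \<mu> = hess_L q p \<mu>"
proof -
  have "score2 d n w p q \<mu> = score2 d n w q p \<mu>" by (rule ext) (rule score2_sym)
  then show ?thesis by (simp add: hess_L_def)
qed

lemma mean_score: "mean (\<lambda>\<mu> y b x. \<Sum>p\<in>params d n. y p * score d n w p \<mu> x) \<mu> y b = ip (params d n) y (grad_L \<mu>)"
proof -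
  have "mean (\<lambda>\<mu> y b x. \<Sum>p\<in>params d n. y p * score d n w p \<mu> x) \<mu> y b
      = mean (\<lambda>\<mu> y' b x. \<Sum>p\<in>params d n. y p * score d n w p \<mu> x) \<mu> y b" by (simp add: mean_def)
  also have "\<dots> = (\<Sum>p\<in>params d n. y p * mean (\<lambda>\<mu> y b x. score d n w p \<mu> x) \<mu> y b)"
    by (rule mean_sum) (auto intro: stat_score)
  finally show ?thesis by (simp add: ip_def mean_def grad_L_def)
qed

lemma mean_score2:
  assumes q: "q \<in> params d n"
  shows "mean (\<lambda>\<mu> y b x. \<Sum>p\<in>params d n. y p * score2 d n w p q \<mu> x) \<mu> y b = (\<Sum>p\<in>params d n. y p * hess_L p q \<mu>)"
proof -
  have "mean (\<lambda>\<mu> y b x. \<Sum>p\<in>params d n. y p * score2 d n w p q \<mu> x) \<mu> y b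
      = mean (\<lambda>\<mu> y' b x. \<Sum>p\<in>params d n. y p * score2 d n w p q \<mu> x) \<mu> y b" by (simp add: mean_def)
  also have "\<dots> = (\<Sum>p\<in>params d n. y p * mean (\<lambda>\<mu> y b x. score2 d n w p q \<mu> x) \<mu> y b)"
    using q by (intro mean_sum) (auto intro: stat_score2)
  finally show ?thesis by (simp add: mean_def hess_L_def)
qed

text \<open>A partial derivative is the derivative along a parabola whose velocity is a unit vector
  and whose acceleration is zero.\<close>

lemma partial_mean:
  assumes "flow_deriv e e'" and F: "\<And>\<mu> y b. F \<mu> = mean e \<mu> y b"
  shows "((\<lambda>t. F (\<mu>(p := t))) has_real_derivative mean e' \<mu> (\<lambda>q. if q = p then 1 else 0) (\<lambda>_. 0)) (at (\<mu> p))"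
    and "partial p F \<mu> = mean e' \<mu> (\<lambda>q. if q = p then 1 else 0) (\<lambda>_. 0)"
proof -
  define a where "a = (\<lambda>q. if q = p then 1 else (0::real))"
  have 1: "((\<lambda>s. mean e (pos \<mu> a (\<lambda>_. 0) s) (vel a (\<lambda>_. 0) s) (\<lambda>_. 0)) has_real_derivative
      mean e' (pos \<mu> a (\<lambda>_. 0) 0) (vel a (\<lambda>_. 0) 0) (\<lambda>_. 0)) (at 0)"
    by (rule mean_deriv[OF assms(1)]) simp
  have "(\<lambda>s. mean e (pos \<mu> a (\<lambda>_. 0) s) (vel a (\<lambda>_. 0) s) (\<lambda>_. 0)) = (\<lambda>s. F (\<mu>(p := \<mu> p + s)))"
    unfolding F[symmetric] by (intro ext arg_cong[where f = F]) (auto simp: pos_def a_def)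
  moreover have "pos \<mu> a (\<lambda>_. 0) 0 = \<mu>" "vel a (\<lambda>_. 0) 0 = a" by (auto simp: pos_def vel_def)
  ultimately have 2: "((\<lambda>s. F (\<mu>(p := \<mu> p + s))) has_real_derivative mean e' \<mu> a (\<lambda>_. 0)) (at 0)" using 1 by simp
  show 3: "((\<lambda>t. F (\<mu>(p := t))) has_real_derivative mean e' \<mu> (\<lambda>q. if q = p then 1 else 0) (\<lambda>_. 0)) (at (\<mu> p))"
    using 2 DERIV_shift[of "\<lambda>t. F (\<mu>(p := t))" _ 0 "\<mu> p"] by (simp add: a_def add.commute)
  show "partial p F \<mu> = mean e' \<mu> (\<lambda>q. if q = p then 1 else 0) (\<lambda>_. 0)"
    unfolding partial_def by (rule DERIV_imp_deriv[OF 3])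
qed

lemma partial_loss: "p \<in> params d n \<Longrightarrow> partial p L \<mu> = grad_L \<mu> p"
proof -
  assume p: "p \<in> params d n"
  have "partial p L \<mu> = ip (params d n) (\<lambda>q. if q = p then 1 else 0) (grad_L \<mu>)"
    by (subst partial_mean(2)[OF flow_deriv_loss loss_eq]) (rule mean_score)
  also have "\<dots> = grad_L \<mu> p" using p by (simp add: ip_def if_distrib if_distribR cong: if_cong)
  finally show ?thesis .
qed

lemma partial_grad: "p \<in> params d n \<Longrightarrow> q \<in> params d n \<Longrightarrow> partial p (partial q L) \<mu> = hess_L p q \<mu>"
proof -
  assume p: "p \<in> params d n" and q: "q \<in> params d n"
  have e: "partial q L \<nu> = mean (\<lambda>\<mu> y b x. score d n w q \<mu> x) \<nu> y b" for \<nu> y b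
    by (simp add: partial_loss[OF q] grad_L_def mean_def)
  have "partial p (partial q L) \<mu> = (\<Sum>r\<in>params d n. (if r = p then 1 else 0) * hess_L r q \<mu>)"
    by (subst partial_mean(2)[OF flow_deriv_score[OF q] e]) (rule mean_score2[OF q])
  also have "\<dots> = hess_L p q \<mu>" using p by (simp add: if_distrib if_distribR cong: if_cong)
  finally show ?thesis .
qed

lemma bdd_L2: "L2_set z (params d n) \<le> R \<Longrightarrow> bdd R z"
  using member_le_L2_set[of "params d n" _ "\<lambda>p. \<bar>z p\<bar>"] by (force simp: bdd_def L2_set_def)

lemma bdd_shift: "bdd R c \<Longrightarrow> L2_set (\<lambda>p. x p - c p) (params d n) \<le> K \<Longrightarrow> bdd (R + K) x"
proof -
  assume c: "bdd R c" and x: "L2_set (\<lambda>p. x p - c p) (params d n) \<le> K"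
  have "bdd K (\<lambda>p. x p - c p)" using x by (rule bdd_L2)
  then show ?thesis using c unfolding bdd_def by (smt (verit))
qed

lemma loss_curves:
  "\<exists>C>0. \<forall>c a b. L2_set (\<lambda>p. c p - x0 p) (params d n) \<le> R \<longrightarrow> L2_set a (params d n) \<le> R \<longrightarrow> L2_set b (params d n) \<le> R \<longrightarrow>
      (\<exists>D. tower C 5 D \<and> D 0 = (\<lambda>s. L (\<lambda>p. c p + s * a p + s\<^sup>2 * b p)) \<and>
        D 1 = (\<lambda>s. ip (params d n) (\<lambda>p. a p + 2 * s * b p) (grad_L (\<lambda>p. c p + s * a p + s\<^sup>2 * b p))) \<and>
        (c = x0 \<longrightarrow> D 2 0 = ip (params d n) a (\<lambda>p. \<Sum>q\<in>params d n. hess_L p q x0 * a q) + 2 * ip (params d n) b (grad_L x0)))"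
proof -
  \<comment> \<open>The product rule for a sum of velocities times scores: the velocity yields
    \<open>2 * b q\<close>, the score yields the Hessian contraction.\<close>
  define e2 where "e2 = (\<lambda>\<mu> (y::par) (b::par) x. \<Sum>q\<in>params d n. 2 * b q * score d n w q \<mu> x + (\<Sum>p\<in>params d n. y p * score2 d n w p q \<mu> x) * y q)"
  have dp2: "flow_deriv (\<lambda>\<mu> y b x. \<Sum>p\<in>params d n. y p * score d n w p \<mu> x) e2"
    unfolding e2_def by (intro flow_deriv_sum flow_deriv_mult flow_deriv_velo flow_deriv_score) auto
  obtain R0 where R0: "bdd R0 x0" using bdd_exists[of x0 x0 x0] by blast
  define R1 where "R1 = max R (R0 + R)"
  obtain C where C: "0 < C" "\<And>c a b. bdd R1 c \<Longrightarrow> bdd R1 a \<Longrightarrow> bdd R1 b \<Longrightarrow> \<exists>D. tower C 5 D \<and>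
    D 0 = (\<lambda>s. mean (\<lambda>\<mu> y b x. teacher_ll - ln (mixture d n w (curry \<mu>) x)) (pos c a b s) (vel a b s) b) \<and>
    D 1 = (\<lambda>s. mean (\<lambda>\<mu> y b x. \<Sum>p\<in>params d n. y p * score d n w p \<mu> x) (pos c a b s) (vel a b s) b) \<and>
    D 2 = (\<lambda>s. mean e2 (pos c a b s) (vel a b s) b)"
    using mean_tower[OF flow_deriv_loss dp2, of R1] by blast
  show ?thesis
  proof (rule exI[of _ C], intro conjI C(1) allI impI)
    fix c a b assume cab: "L2_set (\<lambda>p. c p - x0 p) (params d n) \<le> R" "L2_set a (params d n) \<le> R" "L2_set b (params d n) \<le> R"
    have "bdd R1 c" by (rule bdd_mono[OF bdd_shift[OF R0 cab(1)]]) (simp add: R1_def)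
    moreover have "bdd R1 a" by (rule bdd_mono[OF bdd_L2[OF cab(2)]]) (simp add: R1_def)
    moreover have "bdd R1 b" by (rule bdd_mono[OF bdd_L2[OF cab(3)]]) (simp add: R1_def)
    ultimately have "bdd R1 c" "bdd R1 a" "bdd R1 b" by auto
    from C(2)[OF this] obtain D where D: "tower C 5 D"
      "D 0 = (\<lambda>s. mean (\<lambda>\<mu> y b x. teacher_ll - ln (mixture d n w (curry \<mu>) x)) (pos c a b s) (vel a b s) b)"
      "D 1 = (\<lambda>s. mean (\<lambda>\<mu> y b x. \<Sum>p\<in>params d n. y p * score d n w p \<mu> x) (pos c a b s) (vel a b s) b)"
      "D 2 = (\<lambda>s. mean e2 (pos c a b s) (vel a b s) b)" by blast
    have "D 2 0 = mean e2 c a b" unfolding D(4) by (simp add: pos_def vel_def)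
    also have "mean e2 c a b = (\<Sum>q\<in>params d n. 2 * b q * grad_L c q + (\<Sum>p\<in>params d n. a p * hess_L p q c) * a q)"
    proof -
      have i1: "integrable P (\<lambda>x. score d n w q c x)" if "q \<in> params d n" for q
        using stat_integrable[OF stat_score[OF that]] .
      have i2: "integrable P (\<lambda>x. score2 d n w p q c x)" if "p \<in> params d n" "q \<in> params d n" for p q
        using stat_integrable[OF stat_score2[OF that]] .
      have i3: "integrable P (\<lambda>x. (\<Sum>p\<in>params d n. a p * score2 d n w p q c x))" if "q \<in> params d n" for q
        using that by (intro Bochner_Integration.integrable_sum integrable_mult_right i2)
      have "mean e2 c a b = (\<Sum>q\<in>params d n. \<integral>x. 2 * b q * score d n w q c x + (\<Sum>p\<in>params d n. a p * score2 d n w p q c x) * a q \<partial>P)"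
        unfolding mean_def e2_def
        by (rule Bochner_Integration.integral_sum)
           (intro Bochner_Integration.integrable_add integrable_mult_right integrable_mult_left i1 i3)
      also have "\<dots> = (\<Sum>q\<in>params d n. 2 * b q * grad_L c q + (\<Sum>p\<in>params d n. a p * hess_L p q c) * a q)"
      proof (intro sum.cong refl)
        fix q assume q: "q \<in> params d n"
        have "(\<integral>x. (\<Sum>p\<in>params d n. a p * score2 d n w p q c x) \<partial>P) = (\<Sum>p\<in>params d n. a p * hess_L p q c)"
          using mean_score2[OF q, of c a b] by (simp add: mean_def)
        then show "(\<integral>x. 2 * b q * score d n w q c x + (\<Sum>p\<in>params d n. a p * score2 d n w p q c x) * a q \<partial>P)
            = 2 * b q * grad_L c q + (\<Sum>p\<in>params d n. a p * hess_L p q c) * a q"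
          using i1[OF q] i3[OF q] by (simp add: grad_L_def)
      qed
      finally show ?thesis .
    qed
    also have "\<dots> = ip (params d n) a (\<lambda>p. \<Sum>q\<in>params d n. hess_L p q c * a q) + 2 * ip (params d n) b (grad_L c)"
    proof -
      have "(\<Sum>q\<in>params d n. (\<Sum>p\<in>params d n. a p * hess_L p q c) * a q) = ip (params d n) a (\<lambda>p. \<Sum>q\<in>params d n. hess_L p q c * a q)"
        unfolding ip_def sum_distrib_left sum_distrib_right by (subst sum.swap) (simp add: mult.assoc)
      moreover have "(\<Sum>q\<in>params d n. 2 * b q * grad_L c q) = 2 * ip (params d n) b (grad_L c)"
        by (simp add: ip_def sum_distrib_left mult.assoc)
      ultimately show ?thesis by (simp only: sum.distrib)
    qed
    finally have D20: "D 2 0 = ip (params d n) a (\<lambda>p. \<Sum>q\<in>params d n. hess_L p q c * a q) + 2 * ip (params d n) b (grad_L c)" .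
    show "\<exists>D. tower C 5 D \<and> D 0 = (\<lambda>s. L (\<lambda>p. c p + s * a p + s\<^sup>2 * b p)) \<and>
        D 1 = (\<lambda>s. ip (params d n) (\<lambda>p. a p + 2 * s * b p) (grad_L (\<lambda>p. c p + s * a p + s\<^sup>2 * b p))) \<and>
        (c = x0 \<longrightarrow> D 2 0 = ip (params d n) a (\<lambda>p. \<Sum>q\<in>params d n. hess_L p q x0 * a q) + 2 * ip (params d n) b (grad_L x0))"
    proof (rule exI[of _ D], intro conjI impI D(1))
      show "D 0 = (\<lambda>s. L (\<lambda>p. c p + s * a p + s\<^sup>2 * b p))"
        unfolding D(2) loss_eq[symmetric] pos_def ..
      show "D 1 = (\<lambda>s. ip (params d n) (\<lambda>p. a p + 2 * s * b p) (grad_L (\<lambda>p. c p + s * a p + s\<^sup>2 * b p)))"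
        unfolding D(3) mean_score pos_def vel_def ..
      show "D 2 0 = ip (params d n) a (\<lambda>p. \<Sum>q\<in>params d n. hess_L p q x0 * a q) + 2 * ip (params d n) b (grad_L x0)"
        if "c = x0" using D20 that by simp
    qed
  qed
qed

section \<open>Lipschitz and Taylor bounds for the gradient\<close>

lemma grad_deriv:
  assumes q: "q \<in> params d n" and s: "\<bar>s\<bar> \<le> 1"
  shows "((\<lambda>s. grad_L (\<lambda>p. c p + s * a p) q) has_real_derivative
    (\<Sum>p\<in>params d n. a p * hess_L p q (\<lambda>p. c p + s * a p))) (at s)"
proof -
  have "((\<lambda>s. mean (\<lambda>\<mu> y b x. score d n w q \<mu> x) (pos c a (\<lambda>_. 0) s) (vel a (\<lambda>_. 0) s) (\<lambda>_. 0)) has_real_derivative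
    mean (\<lambda>\<mu> y b x. \<Sum>p\<in>params d n. y p * score2 d n w p q \<mu> x) (pos c a (\<lambda>_. 0) s) (vel a (\<lambda>_. 0) s) (\<lambda>_. 0)) (at s)"
    by (rule mean_deriv[OF flow_deriv_score[OF q] s])
  then show ?thesis unfolding mean_score2[OF q] by (simp add: pos_def vel_def mean_def grad_L_def)
qed

lemma hess_bound: "\<exists>C>0. \<forall>p\<in>params d n. \<forall>q\<in>params d n. \<forall>\<mu>. bdd R \<mu> \<longrightarrow> \<bar>hess_L p q \<mu>\<bar> \<le> C"
proof -
  have "\<exists>C>0. \<forall>\<mu>. bdd R \<mu> \<longrightarrow> \<bar>hess_L p q \<mu>\<bar> \<le> C" if pq: "p \<in> params d n" "q \<in> params d n" for p q
  proof -
    obtain C where "0 < C" "\<And>\<mu> y b. bdd R \<mu> \<Longrightarrow> bdd R y \<Longrightarrow> bdd R b \<Longrightarrow> \<bar>mean (\<lambda>\<mu> y b x. score2 d n w p q \<mu> x) \<mu> y b\<bar> \<le> C"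
      using mean_bound[OF stat_score2[OF pq], of R] by blast
    then show ?thesis unfolding mean_def hess_L_def by blast
  qed
  then obtain C where C: "\<And>p q. p \<in> params d n \<Longrightarrow> q \<in> params d n \<Longrightarrow> 0 < C p q"
    "\<And>p q \<mu>. p \<in> params d n \<Longrightarrow> q \<in> params d n \<Longrightarrow> bdd R \<mu> \<Longrightarrow> \<bar>hess_L p q \<mu>\<bar> \<le> C p q" by metis
  define K where "K = 1 + (\<Sum>p\<in>params d n. \<Sum>q\<in>params d n. C p q)"
  have nn: "0 \<le> (\<Sum>q\<in>params d n. C p q)" if "p \<in> params d n" for p
    using C(1)[OF that] by (intro sum_nonneg) (auto intro: less_imp_le)
  have "C p q \<le> K" if pq: "p \<in> params d n" "q \<in> params d n" for p q
  proof -
    have "C p q \<le> (\<Sum>q\<in>params d n. C p q)" using pq C(1)[OF pq(1)] by (intro member_le_sum) (auto intro: less_imp_le)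
    also have "\<dots> \<le> (\<Sum>p\<in>params d n. \<Sum>q\<in>params d n. C p q)"
      using pq(1) nn by (intro member_le_sum) auto
    finally show ?thesis by (simp add: K_def)
  qed
  moreover have "0 < K" unfolding K_def by (intro add_pos_nonneg sum_nonneg nn) auto
  ultimately show ?thesis using C(2) by (intro exI[of _ K]) (meson order_trans)
qed

lemma grad_lipschitz:
  "\<exists>C>0. \<forall>x y. L2_set (\<lambda>p. x p - x0 p) (params d n) \<le> 1 \<longrightarrow> L2_set (\<lambda>p. y p - x0 p) (params d n) \<le> 1 \<longrightarrow>
      L2_set (\<lambda>p. grad_L x p - grad_L y p) (params d n) \<le> C * L2_set (\<lambda>p. x p - y p) (params d n)"
proof -
  let ?N = "\<lambda>z. L2_set z (params d n)"
  obtain R0 where R0: "bdd R0 x0" using bdd_exists[of x0 x0 x0] by blast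
  obtain C where C: "0 < C" "\<And>p q \<mu>. p \<in> params d n \<Longrightarrow> q \<in> params d n \<Longrightarrow> bdd (R0 + 1) \<mu> \<Longrightarrow> \<bar>hess_L p q \<mu>\<bar> \<le> C"
    using hess_bound[of "R0 + 1"] by blast
  \<comment> \<open>Used twice, for the sum in each coordinate and for the passage from coordinates
    to the norm; the summand 1 keeps it positive over an empty index set.\<close>
  define k where "k = 1 + real (card (params d n))"
  have k: "0 < k" "real (card (params d n)) \<le> k" by (auto simp: k_def intro: add_pos_nonneg)
  show ?thesis
  proof (rule exI[of _ "k * (k * C)"], intro conjI allI impI)
    show "0 < k * (k * C)" using k C by simp
    fix x y assume xy: "?N (\<lambda>p. x p - x0 p) \<le> 1" "?N (\<lambda>p. y p - x0 p) \<le> 1"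
    define a where "a = (\<lambda>p. x p - y p)"
    have coord: "\<bar>grad_L x q - grad_L y q\<bar> \<le> k * C * ?N a" if q: "q \<in> params d n" for q
    proof -
      have "\<exists>t>0. t < 1 \<and> grad_L (\<lambda>p. y p + 1 * a p) q - grad_L (\<lambda>p. y p + 0 * a p) q =
          (1 - 0) * (\<Sum>p\<in>params d n. a p * hess_L p q (\<lambda>p. y p + t * a p))"
        by (rule MVT2) (auto intro!: grad_deriv[OF q])
      then obtain t where t: "0 < t" "t < 1"
        "grad_L x q - grad_L y q = (\<Sum>p\<in>params d n. a p * hess_L p q (\<lambda>p. y p + t * a p))"
        by (auto simp: a_def)
      have "?N (\<lambda>p. (y p + t * a p) - x0 p) = ?N (\<lambda>p. (1 - t) * (y p - x0 p) + t * (x p - x0 p))"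
        by (simp add: a_def algebra_simps)
      also have "\<dots> \<le> ?N (\<lambda>p. (1 - t) * (y p - x0 p)) + ?N (\<lambda>p. t * (x p - x0 p))" by (rule L2_set_triangle_ineq)
      also have "\<dots> = (1 - t) * ?N (\<lambda>p. y p - x0 p) + t * ?N (\<lambda>p. x p - x0 p)"
        unfolding L2_set_scale using t by simp
      also have "\<dots> \<le> (1 - t) * 1 + t * 1" using t xy by (intro add_mono mult_left_mono) auto
      finally have b: "bdd (R0 + 1) (\<lambda>p. y p + t * a p)" by (intro bdd_shift[OF R0]) simp
      have "\<bar>grad_L x q - grad_L y q\<bar> \<le> (\<Sum>p\<in>params d n. \<bar>a p * hess_L p q (\<lambda>p. y p + t * a p)\<bar>)"
        unfolding t(3) by (rule sum_abs)
      also have "\<dots> \<le> (\<Sum>p\<in>params d n. ?N a * C)"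
      proof (rule sum_mono)
        fix p assume p: "p \<in> params d n"
        have "\<bar>a p\<bar> \<le> ?N a" using bdd_L2[of a "?N a"] p by (auto simp: bdd_def)
        then show "\<bar>a p * hess_L p q (\<lambda>p. y p + t * a p)\<bar> \<le> ?N a * C"
          unfolding abs_mult using C(2)[OF p q b] by (intro mult_mono) auto
      qed
      also have "\<dots> = real (card (params d n)) * (C * ?N a)" by simp
      also have "\<dots> \<le> k * (C * ?N a)" using k C(1) by (intro mult_right_mono) auto
      finally show ?thesis by (simp add: mult.assoc)
    qed
    have "?N (\<lambda>p. grad_L x p - grad_L y p) \<le> (\<Sum>p\<in>params d n. \<bar>grad_L x p - grad_L y p\<bar>)" by (rule L2_set_le_sum_abs)
    also have "\<dots> \<le> (\<Sum>p\<in>params d n. k * C * ?N a)" by (intro sum_mono coord)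
    also have "\<dots> = real (card (params d n)) * (k * C * ?N a)" by simp
    also have "\<dots> \<le> k * (k * C * ?N a)" using k C(1) by (intro mult_right_mono) auto
    finally show "?N (\<lambda>p. grad_L x p - grad_L y p) \<le> k * (k * C) * ?N (\<lambda>p. x p - y p)" by (simp add: a_def mult.assoc)
  qed
qed

lemma grad_cong: "(\<And>p. p \<in> params d n \<Longrightarrow> x p = y p) \<Longrightarrow> q \<in> params d n \<Longrightarrow> grad_L x q = grad_L y q"
proof -
  assume a: "\<And>p. p \<in> params d n \<Longrightarrow> x p = y p" and q: "q \<in> params d n"
  have "score d n w q x = score d n w q y"
  proof
    fix t
    have "gauss d (curry x (fst q)) t = gauss d (curry y (fst q)) t"
      unfolding gauss_exp using a q by (auto intro!: sum.cong)
    then show "score d n w q x t = score d n w q y t"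
      using mixture_cong_params[of n d x y w t] a q by (simp add: score_def resp_def)
  qed
  then show ?thesis by (simp add: grad_L_def)
qed

text \<open>Each coordinate is expanded to second order along the ray in the unit direction of
  \<open>z\<close>, with |z| as parameter, so that one tower constant serves all directions.\<close>

lemma grad_taylor:
  assumes z0: "\<And>q. q \<in> params d n \<Longrightarrow> grad_L x0 q = 0"
  shows "\<exists>C>0. \<forall>z. L2_set z (params d n) \<le> 1 \<longrightarrow>
      L2_set (\<lambda>p. grad_L (\<lambda>p. x0 p + z p) p - (\<Sum>q\<in>params d n. hess_L p q x0 * z q)) (params d n)
        \<le> C * (L2_set z (params d n))\<^sup>2"
proof -
  let ?N = "\<lambda>z. L2_set z (params d n)"
  obtain R0 where R0: "bdd R0 x0" using bdd_exists[of x0 x0 x0] by blast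
  define R where "R = max R0 1"
  have "\<exists>C>0. \<forall>z. 0 < ?N z \<longrightarrow> ?N z \<le> 1 \<longrightarrow>
      \<bar>grad_L (\<lambda>p. x0 p + z p) q - (\<Sum>p\<in>params d n. hess_L q p x0 * z p)\<bar> \<le> C * (?N z)\<^sup>2" if q: "q \<in> params d n" for q
  proof -
    obtain e2 where e2: "flow_deriv (\<lambda>\<mu> y b x. \<Sum>p\<in>params d n. y p * score2 d n w p q \<mu> x) e2"
      using stat_flow_deriv flow_deriv_score[OF q] unfolding flow_deriv_def by blast
    obtain C where C: "0 < C" "\<And>c a b. bdd R c \<Longrightarrow> bdd R a \<Longrightarrow> bdd R b \<Longrightarrow> \<exists>D. tower C 5 D \<and>
      D 0 = (\<lambda>s. mean (\<lambda>\<mu> y b x. score d n w q \<mu> x) (pos c a b s) (vel a b s) b) \<and>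
      D 1 = (\<lambda>s. mean (\<lambda>\<mu> y b x. \<Sum>p\<in>params d n. y p * score2 d n w p q \<mu> x) (pos c a b s) (vel a b s) b)"
      using mean_tower[OF flow_deriv_score[OF q] e2, of R] by blast
    have "\<bar>grad_L (\<lambda>p. x0 p + z p) q - (\<Sum>p\<in>params d n. hess_L q p x0 * z p)\<bar> \<le> C * (?N z)\<^sup>2"
      if z: "0 < ?N z" "?N z \<le> 1" for z
    proof -
      define s where "s = ?N z"
      define a where "a = (\<lambda>p. (1 / s) * z p)"
      have s: "0 < s" "s \<le> 1" using z by (auto simp: s_def)
      have "?N a = 1" unfolding a_def L2_set_scale using s by (simp add: s_def)
      then have "bdd R a" "bdd R x0" "bdd R (\<lambda>_. 0)"
        using bdd_L2[of a 1] R0 bdd_L2[of "\<lambda>_. 0" 1] by (auto simp: R_def L2_set_0' intro: bdd_mono)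
      from C(2)[OF this(2,1,3)] obtain D where D: "tower C 5 D"
        "D 0 = (\<lambda>s. mean (\<lambda>\<mu> y b x. score d n w q \<mu> x) (pos x0 a (\<lambda>_. 0) s) (vel a (\<lambda>_. 0) s) (\<lambda>_. 0))"
        "D 1 = (\<lambda>s. mean (\<lambda>\<mu> y b x. \<Sum>p\<in>params d n. y p * score2 d n w p q \<mu> x) (pos x0 a (\<lambda>_. 0) s) (vel a (\<lambda>_. 0) s) (\<lambda>_. 0))"
        by blast
      have D0: "D 0 t = grad_L (\<lambda>p. x0 p + t * a p) q" for t
        unfolding D(2) by (simp add: mean_def grad_L_def pos_def)
      have D1: "D 1 0 = (\<Sum>p\<in>params d n. a p * hess_L p q x0)"
        unfolding D(3) mean_score2[OF q] by (simp add: pos_def vel_def)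
      obtain t where t: "\<bar>t\<bar> \<le> 1" "D 0 s = (\<Sum>m<2. D (0 + m) 0 / fact m * s ^ m) + D (0 + 2) t / fact 2 * s ^ 2"
        by (rule tower_taylor[of C 5 D 0 2 s]) (use D(1) s in auto)
      have "(\<lambda>p. x0 p + s * a p) = (\<lambda>p. x0 p + z p)" using s by (simp add: a_def)
      then have "grad_L (\<lambda>p. x0 p + z p) q = D 0 s" by (simp add: D0)
      also have "\<dots> = D 0 0 + D 1 0 * s + D 2 t / 2 * s\<^sup>2" unfolding t(2) by (simp add: numeral_2_eq_2)
      also have "D 0 0 = 0" using z0[OF q] by (simp add: D0)
      also have "D 1 0 * s = (\<Sum>p\<in>params d n. hess_L q p x0 * z p)"
        unfolding D1 sum_distrib_right using s by (intro sum.cong refl) (simp add: a_def hess_L_sym[of q])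
      finally have "\<bar>grad_L (\<lambda>p. x0 p + z p) q - (\<Sum>p\<in>params d n. hess_L q p x0 * z p)\<bar> = \<bar>D 2 t\<bar> / 2 * s\<^sup>2"
        by (simp add: abs_mult)
      also have "\<dots> \<le> C * s\<^sup>2"
      proof (rule mult_right_mono)
        have "\<bar>D 2 t\<bar> \<le> C" using D(1) t(1) by (auto simp: tower_def)
        then show "\<bar>D 2 t\<bar> / 2 \<le> C" using C(1) by linarith
      qed simp
      finally show ?thesis by (simp add: s_def)
    qed
    then show ?thesis using C(1) by blast
  qed
  then have "\<forall>q\<in>params d n. \<exists>C. 0 < C \<and> (\<forall>z. 0 < ?N z \<longrightarrow> ?N z \<le> 1 \<longrightarrow>
      \<bar>grad_L (\<lambda>p. x0 p + z p) q - (\<Sum>p\<in>params d n. hess_L q p x0 * z p)\<bar> \<le> C * (?N z)\<^sup>2)"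
    by (intro ballI) simp
  from bchoice[OF this] obtain C where C': "\<forall>q\<in>params d n. 0 < C q \<and> (\<forall>z. 0 < ?N z \<longrightarrow> ?N z \<le> 1 \<longrightarrow>
      \<bar>grad_L (\<lambda>p. x0 p + z p) q - (\<Sum>p\<in>params d n. hess_L q p x0 * z p)\<bar> \<le> C q * (?N z)\<^sup>2)" ..
  have C: "0 < C q" "0 < ?N z \<Longrightarrow> ?N z \<le> 1 \<Longrightarrow>
      \<bar>grad_L (\<lambda>p. x0 p + z p) q - (\<Sum>p\<in>params d n. hess_L q p x0 * z p)\<bar> \<le> C q * (?N z)\<^sup>2"
    if "q \<in> params d n" for q z
    using bspec[OF C' that] by (simp_all only:)
  define K where "K = 1 + (\<Sum>q\<in>params d n. C q)"
  have K: "0 < K" unfolding K_def using C(1) by (intro add_pos_nonneg sum_nonneg) (auto intro: less_imp_le)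
  show ?thesis
  proof (rule exI[of _ K], intro conjI K allI impI)
    fix z assume z: "?N z \<le> 1"
    show "?N (\<lambda>p. grad_L (\<lambda>p. x0 p + z p) p - (\<Sum>q\<in>params d n. hess_L p q x0 * z q)) \<le> K * (?N z)\<^sup>2"
    \<comment> \<open>A \<open>z\<close> of norm 0 vanishes on the index set but may be arbitrary
      elsewhere, whence \<open>grad_cong\<close>.\<close>
    proof (cases "?N z = 0")
      case True
      then have "\<forall>p\<in>params d n. z p = 0" by (subst (asm) L2_set_eq_0_iff) auto
      then have z: "z p = 0" if "p \<in> params d n" for p using that by blast
      have "grad_L (\<lambda>p. x0 p + z p) q = 0" if "q \<in> params d n" for q
        using grad_cong[of "\<lambda>p. x0 p + z p" x0 q] z z0 that by simp
      then show ?thesis using True z by (simp add: L2_set_0')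
    next
      case False
      then have zp: "0 < ?N z" by (simp add: order.strict_iff_order)
      have "?N (\<lambda>p. grad_L (\<lambda>p. x0 p + z p) p - (\<Sum>q\<in>params d n. hess_L p q x0 * z q))
          \<le> (\<Sum>p\<in>params d n. \<bar>grad_L (\<lambda>p. x0 p + z p) p - (\<Sum>q\<in>params d n. hess_L p q x0 * z q)\<bar>)"
        by (rule L2_set_le_sum_abs)
      also have "\<dots> \<le> (\<Sum>p\<in>params d n. C p * (?N z)\<^sup>2)" by (intro sum_mono C(2)[OF _ zp z])
      also have "\<dots> = (K - 1) * (?N z)\<^sup>2" by (simp add: K_def sum_distrib_right)
      also have "\<dots> \<le> K * (?N z)\<^sup>2" by (intro mult_right_mono) auto
      finally show ?thesis .
    qed
  qed
qed

end

section \<open>Growth of the loss and perturbation of the weights\<close>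

text \<open>For \<open>h = - u\<close> with \<open>u > 0\<close> the claim is that
  \<open>1 - u + u^2\<close> times \<open>exp u\<close> is at least 1, and this holds already with
  \<open>exp u\<close> replaced by its Taylor polynomial of degree two.\<close>

lemma exp_le_quadratic: "\<bar>h\<bar> \<le> 1 \<Longrightarrow> exp (h::real) \<le> 1 + h + h\<^sup>2"
proof -
  assume h: "\<bar>h\<bar> \<le> 1"
  show ?thesis
  proof (cases "0 \<le> h")
    case True
    then show ?thesis using h by (intro exp_bound) auto
  next
    case False
    define u where "u = - h"
    have u: "0 < u" "u \<le> 1" using False h by (auto simp: u_def)
    have "1 \<le> (1 - u + u\<^sup>2) * (1 + u + u\<^sup>2 / 2)"
    proof -
      have "(1 - u + u\<^sup>2) * (1 + u + u\<^sup>2 / 2) = 1 + (u\<^sup>2 / 2 + u ^ 3 / 2 + u ^ 4 / 2)"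
        by (simp add: field_simps eval_nat_numeral)
      then show ?thesis using u by simp
    qed
    also have "\<dots> \<le> (1 - u + u\<^sup>2) * exp u"
      using u exp_lower_Taylor_quadratic[of u] by (intro mult_left_mono) auto
    finally have "exp (- u) \<le> 1 - u + u\<^sup>2" by (simp add: exp_minus inverse_eq_divide pos_divide_le_eq)
    then show ?thesis by (simp add: u_def)
  qed
qed

lemma mixture_mult_bounded_integrable:
  assumes v: "simplex_pos n v" and [measurable]: "g \<in> borel_measurable (Leb d)" and g: "\<And>x. \<bar>g x\<bar> \<le> B"
  shows "integrable (Leb d) (\<lambda>x. mixture d n v c x * g x)"
proof (rule Bochner_Integration.integrable_bound)
  show "integrable (Leb d) (\<lambda>x. B * mixture d n v c x)" by (intro integrable_mult_right mixture_integral v)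
  show "AE x in Leb d. norm (mixture d n v c x * g x) \<le> norm (B * mixture d n v c x)"
  proof (rule AE_I2)
    fix x
    have "\<bar>g x\<bar> \<le> \<bar>B\<bar>" using g[of x] by linarith
    then have "mixture d n v c x * \<bar>g x\<bar> \<le> mixture d n v c x * \<bar>B\<bar>"
      using mixture_pos[OF v, of d c x] by (intro mult_left_mono) auto
    then show "norm (mixture d n v c x * g x) \<le> norm (B * mixture d n v c x)"
      using mixture_pos[OF v, of d c x] by (simp add: abs_mult mult.commute)
  qed
qed measurable

context gauss_model
begin

text \<open>Change of measure: under the teacher law, weighting by a density ratio integrates
  against the other mixture.\<close>

lemma ratio_integral:
  assumes v: "simplex_pos k v" and [measurable]: "g \<in> borel_measurable (Leb d)" and g: "\<And>x. \<bar>g x\<bar> \<le> B"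
  shows "integrable P (\<lambda>x. mixture d k v c x / mixture d m ps cs x * g x)"
    and "(\<integral>x. mixture d k v c x / mixture d m ps cs x * g x \<partial>P) = (\<integral>x. mixture d k v c x * g x \<partial>Leb d)"
proof -
  have ms: "(\<lambda>x. mixture d k v c x / mixture d m ps cs x * g x) \<in> borel_measurable (Leb d)" by measurable
  have e: "mixture d m ps cs x * (mixture d k v c x / mixture d m ps cs x * g x) = mixture d k v c x * g x" for x
    using mixture_pos[OF ps, of d cs x] by simp
  note I = mixture_measure_integrable[OF ps ms, of cs, unfolded e]
  show "integrable P (\<lambda>x. mixture d k v c x / mixture d m ps cs x * g x)"
    using I(1) mixture_mult_bounded_integrable[OF v assms(2) g] by simp
  show "(\<integral>x. mixture d k v c x / mixture d m ps cs x * g x \<partial>P) = (\<integral>x. mixture d k v c x * g x \<partial>Leb d)"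
    by (rule I(2))
qed

text \<open>With \<open>h = t \<psi>\<close> the elementary bound \<open>ln r \<le> r e\<^sup>h - 1 - h\<close> turns a bounded test function into a
  lower bound for the Kullback-Leibler divergence.\<close>

lemma loss_lower:
  assumes [measurable]: "g \<in> borel_measurable (Leb d)" and g: "\<And>x. \<bar>g x\<bar> \<le> B" and t: "0 \<le> t" "t * B \<le> 1"
  shows "t * ((\<integral>x. mixture d m ps cs x * g x \<partial>Leb d) - (\<integral>x. mixture d n w (curry \<mu>) x * g x \<partial>Leb d)) - t\<^sup>2 * B\<^sup>2 \<le> L \<mu>"
proof -
  interpret prob_space P by (rule prob_P)
  define R where "R = (\<lambda>x. mixture d n w (curry \<mu>) x / mixture d m ps cs x)"
  have R0: "0 < R x" for x unfolding R_def by (intro divide_pos_pos mix_pos mixture_pos[OF ps])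
  have B: "0 \<le> B" using g[of undefined] by linarith
  have iR: "integrable P (\<lambda>x. R x * 1)" "(\<integral>x. R x * 1 \<partial>P) = 1"
    using ratio_integral[OF w, of "\<lambda>_. 1" 1 "curry \<mu>"] mixture_integral[OF w, of d "curry \<mu>"] by (auto simp: R_def)
  note iRg = ratio_integral[OF w assms(1) g, of "curry \<mu>", folded R_def]
  have iRg': "integrable P (\<lambda>x. R x * g x)" "(\<integral>x. R x * g x \<partial>P) = (\<integral>x. mixture d n w (curry \<mu>) x * g x \<partial>Leb d)"
    using iRg by (auto simp: R_def)
  have ig: "integrable P g" "(\<integral>x. g x \<partial>P) = (\<integral>x. mixture d m ps cs x * g x \<partial>Leb d)"
  proof -
    have e: "mixture d m ps cs x / mixture d m ps cs x = 1" for x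
      using mixture_pos[OF ps, of d cs x] by (simp add: less_imp_neq[symmetric])
    show "integrable P g" "(\<integral>x. g x \<partial>P) = (\<integral>x. mixture d m ps cs x * g x \<partial>Leb d)"
      using ratio_integral[OF ps assms(1) g, of cs] unfolding e by simp_all
  qed
  \<comment> \<open>The logarithm on the right is \<open>- ln (R x)\<close>. Bounding
    \<open>exp h\<close> by a quadratic leaves only \<open>R\<close> and \<open>R * g\<close>, whose
    expectations are known.\<close>
  have pt: "1 + t * g x - (R x * 1 + t * (R x * g x) + t\<^sup>2 * B\<^sup>2 * (R x * 1)) \<le> ln (mixture d m ps cs x / mixture d n w (curry \<mu>) x)" for x
  proof -
    define h where "h = t * g x"
    have "\<bar>h\<bar> \<le> t * B" using g[of x] t by (simp add: h_def abs_mult mult_left_mono)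
    then have h: "\<bar>h\<bar> \<le> 1" "\<bar>h\<bar> \<le> t * B" using t by auto
    have "h\<^sup>2 = \<bar>h\<bar>\<^sup>2" by simp
    also have "\<dots> \<le> (t * B)\<^sup>2" using h by (intro power_mono) auto
    finally have h2: "h\<^sup>2 \<le> t\<^sup>2 * B\<^sup>2" by (simp add: power_mult_distrib)
    have "ln (R x * exp h) \<le> R x * exp h - 1" using R0[of x] by (intro ln_le_minus_one) simp
    moreover have "ln (R x * exp h) = ln (R x) + h" using R0[of x] by (simp add: ln_mult_pos)
    moreover have "R x * exp h \<le> R x * (1 + h + t\<^sup>2 * B\<^sup>2)"
      using exp_le_quadratic[OF h(1)] h2 R0[of x] by (intro mult_left_mono) auto
    moreover have "ln (mixture d m ps cs x / mixture d n w (curry \<mu>) x) = - ln (R x)"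
      unfolding R_def using mix_pos[of "curry \<mu>" x] mixture_pos[OF ps, of d cs x] by (simp add: ln_divide_pos)
    ultimately show ?thesis by (simp add: h_def algebra_simps)
  qed
  have iln: "integrable P (\<lambda>x. ln (mixture d m ps cs x / mixture d n w (curry \<mu>) x))"
  proof -
    have "integrable P (\<lambda>x. ln (mixture d m ps cs x) - ln (mixture d n w (curry \<mu>) x))"
      using stat_integrable[OF stat.ln, of \<mu>] ln_truth_integrable by simp
    then show ?thesis using mix_pos mixture_pos[OF ps, of d cs] by (simp add: ln_divide_pos)
  qed
  have "(\<integral>x. 1 + t * g x - (R x * 1 + t * (R x * g x) + t\<^sup>2 * B\<^sup>2 * (R x * 1)) \<partial>P) \<le> L \<mu>"
    unfolding loss_def
    by (intro integral_mono pt iln Bochner_Integration.integrable_diff Bochner_Integration.integrable_add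
        integrable_mult_right ig iR iRg' integrable_const)
  also have "(\<integral>x. 1 + t * g x - (R x * 1 + t * (R x * g x) + t\<^sup>2 * B\<^sup>2 * (R x * 1)) \<partial>P)
      = t * ((\<integral>x. mixture d m ps cs x * g x \<partial>Leb d) - (\<integral>x. mixture d n w (curry \<mu>) x * g x \<partial>Leb d)) - t\<^sup>2 * B\<^sup>2"
    using ig iR iRg' by (simp add: prob_space right_diff_distrib)
  finally show ?thesis .
qed

lemma loss_nonneg: "0 \<le> L \<mu>"
  using loss_lower[of "\<lambda>_. 0" 0 0 \<mu>] by simp

lemma loss_line:
  assumes "\<bar>s\<bar> \<le> 1"
  shows "((\<lambda>s. L (\<lambda>p. c p + s * a p)) has_real_derivative ip (params d n) a (grad_L (\<lambda>p. c p + s * a p))) (at s)"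
  using mean_deriv[OF flow_deriv_loss assms, of c a "\<lambda>_. 0"]
  unfolding mean_score loss_eq[symmetric] by (simp add: pos_def vel_def)

end

locale gauss_truth = gauss_model +
  fixes x0 :: par
  assumes truth: "mixture d m ps cs = mixture d n w (curry x0)"
begin

lemma loss_x0: "L x0 = 0"
  unfolding loss_def truth using mix_pos[of "curry x0"] by (simp add: less_imp_neq[symmetric])

lemma grad_x0: "q \<in> params d n \<Longrightarrow> grad_L x0 q = 0"
proof -
  assume q: "q \<in> params d n"
  have "ip (params d n) a (grad_L x0) = 0" for a
  proof -
    have "((\<lambda>s. L (\<lambda>p. x0 p + s * a p)) has_real_derivative ip (params d n) a (grad_L x0)) (at 0)"
      using loss_line[of 0 x0 a] by simp
    then show ?thesis
      by (rule DERIV_local_min[where d = 1]) (auto simp: loss_x0 loss_nonneg)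
  qed
  from this[of "grad_L x0"] have "L2_set (grad_L x0) (params d n) = 0" by (simp add: ip_self)
  then have "\<forall>p\<in>params d n. grad_L x0 p = 0" by (subst (asm) L2_set_eq_0_iff) auto
  then show ?thesis using q by blast
qed

text \<open>A one-variable function with minima at all coordinates of \<open>x0\<close>, summed over
  the coordinates of the sample, separates student from teacher by a gap of at least b |z|^2. In
  \<open>loss_lower\<close> the gap enters with factor \<open>t\<close> and the cost with
  \<open>t^2\<close>, so the best \<open>t\<close> squares the gap and yields the fourth
  power.\<close>

lemma loss_growth:
  "\<exists>c>0. \<exists>\<rho>>0. \<forall>z. L2_set z (params d n) \<le> \<rho> \<longrightarrow> c * L2_set z (params d n) ^ 4 \<le> L (\<lambda>p. x0 p + z p)"
proof -
  have "finite (x0 ` params d n)" by simp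
  from gauss_local_minima[OF this] obtain g B c \<rho> where g: "g \<in> borel_measurable borel" "0 < B" "\<And>t. \<bar>g t\<bar> \<le> B"
    "0 < c" "0 < \<rho>" "\<And>y s. y \<in> x0 ` params d n \<Longrightarrow> \<bar>s - y\<bar> \<le> \<rho> \<Longrightarrow>
      c * (s - y)\<^sup>2 \<le> (\<integral>t. normal_density s 1 t * g t \<partial>lborel) - (\<integral>t. normal_density y 1 t * g t \<partial>lborel)"
    by blast
  define J where "J = (\<lambda>s. \<integral>t. normal_density s 1 t * g t \<partial>lborel)"
  define \<psi> where "\<psi> = (\<lambda>x::nat \<Rightarrow> real. - (\<Sum>k<d. g (x k)))"
  have [measurable]: "g \<in> borel_measurable borel" by (rule g(1))
  have \<psi>m: "\<psi> \<in> borel_measurable (Leb d)" unfolding \<psi>_def by measurable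
  define K where "K = (1 + real d) * B"
  have K: "0 < K" using g(2) by (simp add: K_def add_pos_nonneg)
  have \<psi>b: "\<bar>\<psi> x\<bar> \<le> K" for x
  proof -
    have "\<bar>\<psi> x\<bar> \<le> (\<Sum>k<d. \<bar>g (x k)\<bar>)" unfolding \<psi>_def by simp
    also have "\<dots> \<le> (\<Sum>k<d. B)" by (intro sum_mono g(3))
    also have "\<dots> \<le> K" using g(2) by (simp add: K_def distrib_right)
    finally show ?thesis .
  qed
  have int: "(\<integral>x. mixture d n w (curry \<mu>) x * \<psi> x \<partial>Leb d) = - (\<Sum>i<n. w i * (\<Sum>k<d. J (\<mu> (i, k))))" for \<mu>
  proof -
    have "(\<integral>x. mixture d n w (curry \<mu>) x * \<psi> x \<partial>Leb d)
        = (\<integral>x. (\<Sum>i<n. \<Sum>k<d. - w i * (gauss d (curry \<mu> i) x * g (x k))) \<partial>Leb d)"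
      unfolding mixture_def \<psi>_def sum_negf[symmetric] sum_product
      by (intro Bochner_Integration.integral_cong refl sum.cong) simp
    also have "\<dots> = (\<Sum>i<n. \<Sum>k<d. - w i * J (\<mu> (i, k)))"
    proof -
      have i: "integrable (Leb d) (\<lambda>x. - w i * (gauss d (curry \<mu> i) x * g (x k)))" if "k < d" for i k
        by (intro integrable_mult_right gauss_integral_coord(1)[OF g(1,3) that])
      have "(\<integral>x. (\<Sum>i<n. \<Sum>k<d. - w i * (gauss d (curry \<mu> i) x * g (x k))) \<partial>Leb d)
          = (\<Sum>i<n. \<integral>x. (\<Sum>k<d. - w i * (gauss d (curry \<mu> i) x * g (x k))) \<partial>Leb d)"
        by (intro Bochner_Integration.integral_sum Bochner_Integration.integrable_sum i) auto
      also have "\<dots> = (\<Sum>i<n. \<Sum>k<d. \<integral>x. - w i * (gauss d (curry \<mu> i) x * g (x k)) \<partial>Leb d)"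
        by (intro sum.cong refl Bochner_Integration.integral_sum i) auto
      also have "\<dots> = (\<Sum>i<n. \<Sum>k<d. - w i * J (\<mu> (i, k)))"
        by (intro sum.cong refl) (simp add: gauss_integral_coord(2)[OF g(1,3)] J_def)
      finally show ?thesis .
    qed
    also have "\<dots> = - (\<Sum>i<n. w i * (\<Sum>k<d. J (\<mu> (i, k))))"
      by (simp add: sum_distrib_left sum_negf)
    finally show ?thesis .
  qed
  define wm where "wm = Min (w ` {..<n})"
  have "wm \<in> w ` {..<n}" unfolding wm_def using n_pos by (intro Min_in) auto
  then have wm: "0 < wm" "\<And>i. i < n \<Longrightarrow> wm \<le> w i" using w_pos by (auto simp: wm_def)
  define b where "b = c * wm"
  have b: "0 < b" using g(4) wm by (simp add: b_def)
  \<comment> \<open>Within \<rho> the minima are controlled; the other two bounds ensure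
    \<open>t * K \<le> 1\<close> for the optimal \<open>t\<close>.\<close>
  define r where "r = min \<rho> (min 1 (2 * K / b))"
  have r: "0 < r" "r \<le> \<rho>" "r \<le> 1" "r \<le> 2 * K / b" using g(5) K b by (auto simp: r_def)
  have "b\<^sup>2 / (4 * K\<^sup>2) * L2_set z (params d n) ^ 4 \<le> L (\<lambda>p. x0 p + z p)" if z: "L2_set z (params d n) \<le> r" for z
  proof -
    define s where "s = L2_set z (params d n)"
    have s: "0 \<le> s" "s \<le> r" using z by (auto simp: s_def)
    define \<mu> where "\<mu> = (\<lambda>p. x0 p + z p)"
    have "b * s\<^sup>2 \<le> (\<integral>x. mixture d m ps cs x * \<psi> x \<partial>Leb d) - (\<integral>x. mixture d n w (curry \<mu>) x * \<psi> x \<partial>Leb d)"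
    proof -
      have "b * s\<^sup>2 = (\<Sum>i<n. wm * (\<Sum>k<d. c * (z (i, k))\<^sup>2))"
        by (simp add: s_def b_def L2_set_def sum_nonneg sum_params sum_distrib_left mult_ac)
      also have "\<dots> \<le> (\<Sum>i<n. w i * (\<Sum>k<d. J (\<mu> (i, k)) - J (x0 (i, k))))"
      proof (intro sum_mono mult_mono)
        fix i k assume ik: "i \<in> {..<n}" "k \<in> {..<d}"
        have "\<bar>z (i, k)\<bar> \<le> s" using bdd_L2[of z s] ik by (auto simp: bdd_def s_def)
        then have "\<bar>\<mu> (i, k) - x0 (i, k)\<bar> \<le> \<rho>" using s r by (simp add: \<mu>_def)
        then show "c * (z (i, k))\<^sup>2 \<le> J (\<mu> (i, k)) - J (x0 (i, k))"
          using g(6)[of "x0 (i, k)" "\<mu> (i, k)"] ik by (auto simp: J_def \<mu>_def)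
      qed (use wm g(4) in \<open>auto intro!: sum_nonneg less_imp_le[OF w_pos]\<close>)
      also have "\<dots> = (\<integral>x. mixture d m ps cs x * \<psi> x \<partial>Leb d) - (\<integral>x. mixture d n w (curry \<mu>) x * \<psi> x \<partial>Leb d)"
        unfolding truth int by (simp add: sum_subtractf right_diff_distrib)
      finally show ?thesis .
    qed
    note gap = this
    \<comment> \<open>The maximiser of \<open>t * (b * s^2) - t^2 * K^2\<close>.\<close>
    define t where "t = b * s\<^sup>2 / (2 * K\<^sup>2)"
    have t0: "0 \<le> t" using b by (simp add: t_def)
    have "s\<^sup>2 \<le> s * 1" unfolding power2_eq_square using s r by (intro mult_left_mono) auto
    then have "s\<^sup>2 \<le> 2 * K / b" using s r by linarith
    then have "b * s\<^sup>2 \<le> 2 * K" using b by (simp add: field_simps)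
    then have tK: "t * K \<le> 1" using K by (simp add: t_def power2_eq_square field_simps)
    have "t * (b * s\<^sup>2) - t\<^sup>2 * K\<^sup>2 \<le> L \<mu>"
      using loss_lower[OF \<psi>m \<psi>b t0 tK, of \<mu>] mult_left_mono[OF gap t0] by linarith
    moreover have "t * (b * s\<^sup>2) - t\<^sup>2 * K\<^sup>2 = b\<^sup>2 / (4 * K\<^sup>2) * s ^ 4"
      using K by (simp add: t_def power2_eq_square eval_nat_numeral field_simps)
    ultimately show ?thesis by (simp add: s_def \<mu>_def)
  qed
  moreover have "0 < b\<^sup>2 / (4 * K\<^sup>2)" using b K by simp
  ultimately show ?thesis using r(1) by blast
qed

section \<open>Effect of the weight mismatch\<close>

lemma mixture_weights:
  assumes v: "\<And>i. i < n \<Longrightarrow> \<bar>v i - w i\<bar> \<le> \<Delta> * w i"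
  shows "\<bar>mixture d n v c x - mixture d n w c x\<bar> \<le> \<Delta> * mixture d n w c x"
proof -
  have "\<bar>mixture d n v c x - mixture d n w c x\<bar> = \<bar>\<Sum>i<n. (v i - w i) * gauss d (c i) x\<bar>"
    by (simp add: mixture_def sum_subtractf left_diff_distrib)
  also have "\<dots> \<le> (\<Sum>i<n. \<bar>(v i - w i) * gauss d (c i) x\<bar>)" by (rule sum_abs)
  also have "\<dots> \<le> (\<Sum>i<n. \<Delta> * w i * gauss d (c i) x)"
    unfolding abs_mult using v gauss_pos[of d] by (intro sum_mono mult_mono) (auto intro: less_imp_le order_trans[OF abs_ge_zero])
  finally show ?thesis by (simp add: mixture_def sum_distrib_left mult.assoc)
qed

text \<open>Numerator and denominator of the posterior each vary by the relative amount \<Delta>,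
  and the new denominator is at least half of the old one; together this gives the factor 4.\<close>

lemma resp_weights:
  assumes v: "\<And>i. i < n \<Longrightarrow> \<bar>v i - w i\<bar> \<le> \<Delta> * w i" and \<Delta>: "0 \<le> \<Delta>" "\<Delta> \<le> 1 / 2" and i: "i < n"
  shows "\<bar>resp d n v i \<mu> x - resp d n w i \<mu> x\<bar> \<le> 4 * \<Delta>"
proof -
  define g where "g = gauss d (curry \<mu> i) x"
  define V where "V = mixture d n v (curry \<mu>) x"
  define W where "W = mixture d n w (curry \<mu>) x"
  have g: "0 < g" and W: "0 < W" by (auto simp: g_def W_def gauss_pos mix_pos)
  have VW: "\<bar>V - W\<bar> \<le> \<Delta> * W" unfolding V_def W_def by (rule mixture_weights[OF v])
  have "\<Delta> * W \<le> 1 / 2 * W" using \<Delta> W by (intro mult_right_mono) auto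
  then have V: "W / 2 \<le> V" using VW by (simp add: abs_le_iff)
  then have V0: "0 < V" using W by linarith
  have wg: "w i * g \<le> W"
  proof -
    have "w i * gauss d (curry \<mu> i) x \<le> mixture d n w (curry \<mu>) x"
      unfolding mixture_def using i
      by (intro member_le_sum) (auto intro!: mult_nonneg_nonneg less_imp_le[OF w_pos] less_imp_le[OF gauss_pos])
    then show ?thesis by (simp add: g_def W_def)
  qed
  have "resp d n v i \<mu> x - resp d n w i \<mu> x = ((v i - w i) * g * W - w i * g * (V - W)) / (V * W)"
    using V0 W by (simp add: resp_def g_def[symmetric] V_def[symmetric] W_def[symmetric] field_simps)
  also have "\<bar>\<dots>\<bar> = \<bar>(v i - w i) * g * W - w i * g * (V - W)\<bar> / (V * W)" using V0 W by (simp add: abs_mult)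
  also have "\<dots> \<le> (2 * \<Delta> * W * W) / (V * W)"
  proof (rule divide_right_mono)
    have "\<bar>(v i - w i) * g * W\<bar> = \<bar>v i - w i\<bar> * (g * W)" using g W by (simp add: abs_mult)
    also have "\<dots> \<le> (\<Delta> * w i) * (g * W)" using v[OF i] g W by (intro mult_right_mono) auto
    finally have "\<bar>(v i - w i) * g * W\<bar> \<le> (w i * g) * (\<Delta> * W)" by (simp only: mult_ac)
    moreover have "\<bar>w i * g * (V - W)\<bar> \<le> (w i * g) * (\<Delta> * W)"
      unfolding abs_mult using VW g w_pos[OF i] by (intro mult_mono) auto
    moreover have "(w i * g) * (\<Delta> * W) \<le> W * (\<Delta> * W)" using wg \<Delta> W by (intro mult_right_mono) auto
    ultimately show "\<bar>(v i - w i) * g * W - w i * g * (V - W)\<bar> \<le> 2 * \<Delta> * W * W"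
      by (simp add: mult_ac)
  qed (use V0 W in simp)
  also have "\<dots> = 2 * \<Delta> * (W / V)" using W by simp
  also have "\<dots> \<le> 2 * \<Delta> * 2" using V V0 \<Delta> by (intro mult_left_mono) (auto simp: divide_le_eq)
  finally show ?thesis by simp
qed

text \<open>The loss error has no term of pure order \<Delta>. At \<Delta> of order |z|^3 such a
  term would swamp the quartic loss; it is absent because at \<open>x0\<close> the relative
  deviation of the densities has mean zero. Away from \<open>x0\<close> the gradient error,
  integrated along the segment, adds \<Delta> times the distance.\<close>

lemma weight_perturbation:
  "\<exists>C>0. \<forall>v \<Delta>. simplex_pos n v \<longrightarrow> 0 \<le> \<Delta> \<longrightarrow> \<Delta> \<le> 1 / 2 \<longrightarrow> (\<forall>i<n. \<bar>v i - w i\<bar> \<le> \<Delta> * w i) \<longrightarrow>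
    (\<forall>x. edist (params d n) x x0 \<le> 1 \<longrightarrow>
      L2_set (\<lambda>p. partial p (loss d n m ps cs v) x - grad_L x p) (params d n) \<le> C * \<Delta> \<and>
      \<bar>loss d n m ps cs v x - L x\<bar> \<le> C * (\<Delta> * edist (params d n) x x0 + \<Delta>\<^sup>2))"
proof -
  let ?N = "\<lambda>z. L2_set z (params d n)"
  obtain R0 where R0: "bdd R0 x0" using bdd_exists[of x0 x0 x0] by blast
  define R where "R = \<bar>R0\<bar> + 1"
  define K where "K = (\<integral>t. (1 + R) * pweight d 1 t \<partial>P)"
  have iK: "integrable P (\<lambda>t. (1 + R) * pweight d 1 t)" by (intro integrable_mult_right mixture_measure_pweight ps)
  have K: "0 \<le> K" unfolding K_def
    by (intro Bochner_Integration.integral_nonneg mult_nonneg_nonneg order_trans[OF zero_le_one pweight_ge_1]) (simp add: R_def)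
  define C where "C = 2 + real (card (params d n)) * (4 * K)"
  have C: "0 < C" "2 \<le> C" "real (card (params d n)) * (4 * K) \<le> C" using K by (auto simp: C_def intro: add_pos_nonneg)
  have main: "?N (\<lambda>p. partial p (loss d n m ps cs v) x - grad_L x p) \<le> C * \<Delta> \<and>
      \<bar>loss d n m ps cs v x - L x\<bar> \<le> C * (\<Delta> * edist (params d n) x x0 + \<Delta>\<^sup>2)"
    if vs: "simplex_pos n v" and \<Delta>: "0 \<le> \<Delta>" "\<Delta> \<le> 1 / 2" and v: "\<And>i. i < n \<Longrightarrow> \<bar>v i - w i\<bar> \<le> \<Delta> * w i"
      and x: "edist (params d n) x x0 \<le> 1" for v \<Delta> x
  proof -
    interpret V: gauss_model d n m ps cs v by unfold_locales (rule ps vs)+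
    have coord: "\<bar>V.grad_L y p - grad_L y p\<bar> \<le> 4 * \<Delta> * K" if y: "bdd R y" and p: "p \<in> params d n" for y p
    proof -
      have p': "fst p < n" "snd p < d" using p by auto
      have i1: "integrable P (\<lambda>t. score d n v p y t)" using V.stat_integrable[OF V.stat_score[OF p]] .
      have i2: "integrable P (\<lambda>t. score d n w p y t)" using stat_integrable[OF stat_score[OF p]] .
      have "\<bar>V.grad_L y p - grad_L y p\<bar> = \<bar>\<integral>t. score d n v p y t - score d n w p y t \<partial>P\<bar>"
        using i1 i2 by (simp add: V.grad_L_def grad_L_def)
      also have "\<dots> \<le> (\<integral>t. \<bar>score d n v p y t - score d n w p y t\<bar> \<partial>P)" by (rule integral_abs_bound)
      also have "\<dots> \<le> (\<integral>t. 4 * \<Delta> * ((1 + R) * pweight d 1 t) \<partial>P)"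
      proof (rule integral_mono)
        show "integrable P (\<lambda>t. \<bar>score d n v p y t - score d n w p y t\<bar>)" using i1 i2 by simp
        show "integrable P (\<lambda>t. 4 * \<Delta> * ((1 + R) * pweight d 1 t))" by (rule integrable_mult_right[OF iK])
        fix t
        have "\<bar>score d n v p y t - score d n w p y t\<bar> = \<bar>resp d n v (fst p) y t - resp d n w (fst p) y t\<bar> * \<bar>t (snd p) - y p\<bar>"
        proof -
          have "score d n v p y t - score d n w p y t = - ((resp d n v (fst p) y t - resp d n w (fst p) y t) * (t (snd p) - y p))"
            by (simp add: score_def left_diff_distrib)
          then show ?thesis by (simp only: abs_minus_cancel abs_mult)
        qed
        also have "\<dots> \<le> (4 * \<Delta>) * ((1 + R) * pweight d 1 t)"
        proof (rule mult_mono)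
          show "\<bar>resp d n v (fst p) y t - resp d n w (fst p) y t\<bar> \<le> 4 * \<Delta>"
            by (rule resp_weights[OF v \<Delta> p'(1)])
          have "\<bar>y p\<bar> \<le> R" using y p by (auto simp: bdd_def)
          then have "\<bar>t (snd p) - y p\<bar> \<le> \<bar>t (snd p)\<bar> + R" by linarith
          also have "\<dots> \<le> (1 + R) * (1 + \<bar>t (snd p)\<bar>)" by (simp add: R_def algebra_simps)
          also have "\<dots> \<le> (1 + R) * pweight d 1 t" using pweight_coord[OF p'(2), of t 1] by (intro mult_left_mono) (auto simp: R_def)
          finally show "\<bar>t (snd p) - y p\<bar> \<le> (1 + R) * pweight d 1 t" .
        qed (use \<Delta> in auto)
        finally show "\<bar>score d n v p y t - score d n w p y t\<bar> \<le> 4 * \<Delta> * ((1 + R) * pweight d 1 t)" .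
      qed
      also have "\<dots> = 4 * \<Delta> * K" unfolding K_def by (rule integral_mult_right_zero)
      finally show ?thesis .
    qed
    have vec: "?N (\<lambda>p. V.grad_L y p - grad_L y p) \<le> C * \<Delta>" if y: "bdd R y" for y
    proof -
      have "?N (\<lambda>p. V.grad_L y p - grad_L y p) \<le> (\<Sum>p\<in>params d n. \<bar>V.grad_L y p - grad_L y p\<bar>)" by (rule L2_set_le_sum_abs)
      also have "\<dots> \<le> (\<Sum>p\<in>params d n. 4 * \<Delta> * K)" by (intro sum_mono coord[OF y])
      also have "\<dots> = (real (card (params d n)) * (4 * K)) * \<Delta>" by simp
      also have "\<dots> \<le> C * \<Delta>" using C \<Delta> by (intro mult_right_mono) auto
      finally show ?thesis .
    qed
    have seg: "bdd R (\<lambda>p. x0 p + s * (x p - x0 p))" if s: "0 \<le> s" "s \<le> 1" for s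
    proof -
      have "?N (\<lambda>p. (x0 p + s * (x p - x0 p)) - x0 p) = s * edist (params d n) x x0"
        using s by (simp add: L2_set_scale edist_def)
      also have "\<dots> \<le> 1" using s x by (intro mult_le_one) auto
      finally have "bdd (R0 + 1) (\<lambda>p. x0 p + s * (x p - x0 p))" by (rule bdd_shift[OF R0])
      then show ?thesis by (rule bdd_mono) (simp add: R_def)
    qed
    have "?N (\<lambda>p. partial p (loss d n m ps cs v) x - grad_L x p) = ?N (\<lambda>p. V.grad_L x p - grad_L x p)"
      by (intro L2_set_cong refl) (simp only: V.partial_loss)
    also have "\<dots> \<le> C * \<Delta>" using vec[OF seg[of 1]] by simp
    finally have 1: "?N (\<lambda>p. partial p (loss d n m ps cs v) x - grad_L x p) \<le> C * \<Delta>" .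
    define a where "a = (\<lambda>p. x p - x0 p)"
    \<comment> \<open>The difference of the two losses along the segment from \<open>x0\<close>; its
      derivative is at most of order \<Delta> times the length, and its initial value is treated
      separately.\<close>
    define h where "h = (\<lambda>s. V.L (\<lambda>p. x0 p + s * a p) - L (\<lambda>p. x0 p + s * a p))"
    define h' where "h' = (\<lambda>s. ip (params d n) a (V.grad_L (\<lambda>p. x0 p + s * a p)) - ip (params d n) a (grad_L (\<lambda>p. x0 p + s * a p)))"
    have "\<exists>s>0. s < 1 \<and> h 1 - h 0 = (1 - 0) * h' s"
    proof (rule MVT2)
      fix s :: real assume "0 \<le> s" "s \<le> 1"
      then have s: "\<bar>s\<bar> \<le> 1" by simp
      show "(h has_real_derivative h' s) (at s)"
        unfolding h_def h'_def by (rule DERIV_diff[OF V.loss_line[OF s] loss_line[OF s]])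
    qed simp
    then obtain s where s': "0 < s" "s < 1" "h 1 - h 0 = h' s" by auto
    have h10: "h 1 = V.L x - L x" "h 0 = V.L x0 - L x0" by (simp_all add: h_def a_def)
    have s: "0 < s" "s < 1" "(V.L x - L x) - V.L x0
        = ip (params d n) a (\<lambda>p. V.grad_L (\<lambda>p. x0 p + s * a p) p - grad_L (\<lambda>p. x0 p + s * a p) p)"
      using s' by (simp_all add: h10 h'_def loss_x0 ip_diff_right)
    have "\<bar>(V.L x - L x) - V.L x0\<bar> \<le> ?N a * ?N (\<lambda>p. V.grad_L (\<lambda>p. x0 p + s * a p) p - grad_L (\<lambda>p. x0 p + s * a p) p)"
      unfolding s(3) by (rule abs_ip_le)
    also have "\<dots> \<le> ?N a * (C * \<Delta>)"
      using vec[OF seg[OF less_imp_le[OF s(1)] less_imp_le[OF s(2)]]] unfolding a_def by (rule mult_left_mono) simp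
    finally have 2: "\<bar>(V.L x - L x) - V.L x0\<bar> \<le> C * (\<Delta> * edist (params d n) x x0)"
      by (simp add: a_def edist_def mult_ac)
    have 3: "\<bar>V.L x0\<bar> \<le> 2 * \<Delta>\<^sup>2"
    proof -
      have ic: "integrable P (\<lambda>t. c)" "(\<integral>t. c \<partial>P) = c" for c :: real
        using stat_integrable[OF stat.const[of d n w c]] mean_const[of c] by (auto simp: mean_def)
      \<comment> \<open>The relative deviation of the densities at the exact fit. Its mean under
        \<open>P\<close> is zero, so adding it to the integrand is free and cancels the linear term
        of \<open>- ln (1 + r t)\<close>.\<close>
      define r where "r = (\<lambda>t. mixture d n v (curry x0) t / mixture d m ps cs t - 1)"
      have r: "\<bar>r t\<bar> \<le> \<Delta>" for t
      proof -
        have "r t = (mixture d n v (curry x0) t - mixture d n w (curry x0) t) / mixture d n w (curry x0) t"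
          using mix_pos[of "curry x0" t] by (simp add: r_def truth diff_divide_distrib)
        then show ?thesis
          using mixture_weights[OF v, of "curry x0" t] mix_pos[of "curry x0" t] by (simp add: abs_divide divide_le_eq)
      qed
      have ir: "integrable P r" "(\<integral>t. r t \<partial>P) = 0"
      proof -
        have i: "integrable P (\<lambda>t. mixture d n v (curry x0) t / mixture d m ps cs t)"
          "(\<integral>t. mixture d n v (curry x0) t / mixture d m ps cs t \<partial>P) = 1"
          using ratio_integral[OF vs, of "\<lambda>_. 1" 1 "curry x0"] mixture_integral[OF vs, of d "curry x0"] by auto
        show "integrable P r" unfolding r_def by (rule Bochner_Integration.integrable_diff[OF i(1) ic(1)])
        have "(\<integral>t. r t \<partial>P) = (\<integral>t. mixture d n v (curry x0) t / mixture d m ps cs t \<partial>P) - (\<integral>t. 1 \<partial>P)"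
          unfolding r_def by (rule Bochner_Integration.integral_diff[OF i(1) ic(1)])
        then show "(\<integral>t. r t \<partial>P) = 0" unfolding i(2) ic(2) by simp
      qed
      have lnr: "ln (mixture d m ps cs t / mixture d n v (curry x0) t) = - ln (1 + r t)" for t
        using mixture_pos[OF vs, of d "curry x0" t] mixture_pos[OF ps, of d cs t] by (simp add: r_def ln_divide_pos)
      have iln: "integrable P (\<lambda>t. ln (mixture d m ps cs t / mixture d n v (curry x0) t))"
      proof -
        have "integrable P (\<lambda>t. ln (mixture d m ps cs t) - ln (mixture d n v (curry x0) t))"
          using V.stat_integrable[OF stat.ln, of x0] ln_truth_integrable by simp
        then show ?thesis using mixture_pos[OF vs, of d "curry x0"] mixture_pos[OF ps, of d cs] by (simp add: ln_divide_pos)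
      qed
      have VL: "V.L x0 = (\<integral>t. ln (mixture d m ps cs t / mixture d n v (curry x0) t) + r t \<partial>P)"
        using iln ir by (simp add: loss_def)
      have "\<bar>V.L x0\<bar> \<le> (\<integral>t. \<bar>ln (mixture d m ps cs t / mixture d n v (curry x0) t) + r t\<bar> \<partial>P)"
        unfolding VL by (rule integral_abs_bound)
      also have "\<dots> \<le> (\<integral>t. 2 * \<Delta>\<^sup>2 \<partial>P)"
      proof (rule integral_mono)
        show "integrable P (\<lambda>t. \<bar>ln (mixture d m ps cs t / mixture d n v (curry x0) t) + r t\<bar>)" using iln ir by simp
        fix t
        have "\<bar>ln (1 + r t) - r t\<bar> \<le> 2 * (r t)\<^sup>2" using r[of t] \<Delta> by (intro abs_ln_one_plus_x_minus_x_bound) simp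
        also have "\<dots> \<le> 2 * \<Delta>\<^sup>2" using power_mono[OF r[of t], of 2] by simp
        finally show "\<bar>ln (mixture d m ps cs t / mixture d n v (curry x0) t) + r t\<bar> \<le> 2 * \<Delta>\<^sup>2"
          unfolding lnr abs_le_iff by linarith
      qed (rule ic)
      finally show ?thesis unfolding ic(2) .
    qed
    have "2 * \<Delta>\<^sup>2 \<le> C * \<Delta>\<^sup>2" using C by (intro mult_right_mono) auto
    then have "\<bar>loss d n m ps cs v x - L x\<bar> \<le> C * (\<Delta> * edist (params d n) x x0 + \<Delta>\<^sup>2)"
      using 2 3 by (simp add: distrib_left abs_le_iff)
    with 1 show ?thesis by blast
  qed
  show ?thesis
    by (rule exI[of _ C], rule conjI[OF C(1)], intro allI impI, rule main) blast+
qed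

lemma smooth_min_grad_loss:
  assumes "x0 \<in> euclid (params d n)"
  shows "smooth_min_grad (params d n) L x0 grad_L (\<lambda>p q. hess_L p q x0)"
proof (rule smooth_min_grad.intro)
  show "smooth_min (params d n) L x0 grad_L (\<lambda>p q. hess_L p q x0)"
    apply (rule smooth_min.intro)
    subgoal by simp
    subgoal by (rule loss_nonneg)
    subgoal by (rule loss_x0)
    subgoal by (rule hess_L_sym)
    subgoal by (rule loss_curves)
    subgoal by (rule grad_lipschitz)
    subgoal by (rule grad_taylor[OF grad_x0])
    subgoal by (rule loss_growth)
    done
  show "smooth_min_grad_axioms (params d n) L x0 grad_L (\<lambda>p q. hess_L p q x0)"
    apply (rule smooth_min_grad_axioms.intro)
    subgoal by (rule assms)
    subgoal by (rule partial_loss[symmetric])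
    subgoal by (rule partial_grad[symmetric])
    done
qed

end

section \<open>Clusters of students\<close>

lemma cluster_sum:
  assumes "partitions n m S"
  shows "(\<Sum>i<n. h i) = (\<Sum>l<m. \<Sum>i\<in>S l. h i)"
proof -
  have u: "(\<Union>l<m. S l) = {..<n}" and dj: "disjoint_family_on S {..<m}" using assms by (auto simp: partitions_def)
  have "finite (S l)" if "l < m" for l using u that by (metis UN_upper finite_lessThan finite_subset lessThan_iff)
  then have "(\<Sum>i\<in>(\<Union>l<m. S l). h i) = (\<Sum>l<m. \<Sum>i\<in>S l. h i)"
    using dj by (intro sum.UNION_disjoint) (auto simp: disjoint_family_on_def)
  then show ?thesis by (simp add: u)
qed

lemma cluster_finite:
  assumes "partitions n m S" "l < m"
  shows "finite (S l)" "S l \<noteq> {}" "i \<in> S l \<Longrightarrow> i < n"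
proof -
  have u: "(\<Union>l<m. S l) = {..<n}" using assms by (auto simp: partitions_def)
  then have "S l \<subseteq> {..<n}" using assms(2) by blast
  then show "finite (S l)" "i \<in> S l \<Longrightarrow> i < n" by (auto intro: finite_subset)
  show "S l \<noteq> {}" using assms by (auto simp: partitions_def)
qed

lemma cluster_mass_pos:
  assumes "partitions n m S" "simplex_pos n w" "l < m"
  shows "0 < cluster_mass S w l"
  unfolding cluster_mass_def using assms cluster_finite[OF assms(1,3)]
  by (intro sum_pos) (auto simp: simplex_pos_def)

lemma gauss_cong: "(\<And>k. k < d \<Longrightarrow> a k = b k) \<Longrightarrow> gauss d a x = gauss d b x"
  by (simp add: gauss_exp)

lemma teacher_as_student:
  assumes S: "partitions n m S" and mu: "\<forall>l<m. \<forall>i\<in>S l. \<forall>k<d. \<mu>t (i, k) = \<mu>s l k"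
    and mass: "\<forall>l<m. (\<Sum>i\<in>S l. w i) = \<pi>s l"
  shows "mixture d m \<pi>s \<mu>s = mixture d n w (curry \<mu>t)"
proof
  fix x
  have "mixture d n w (curry \<mu>t) x = (\<Sum>l<m. \<Sum>i\<in>S l. w i * gauss d (curry \<mu>t i) x)"
    unfolding mixture_def by (rule cluster_sum[OF S])
  also have "\<dots> = (\<Sum>l<m. \<Sum>i\<in>S l. w i * gauss d (\<mu>s l) x)"
    using mu by (intro sum.cong refl arg_cong2[where f = times] gauss_cong) auto
  also have "\<dots> = mixture d m \<pi>s \<mu>s x"
    using mass by (simp add: mixture_def sum_distrib_right[symmetric])
  finally show "mixture d m \<pi>s \<mu>s x = mixture d n w (curry \<mu>t) x" by simp
qed

text \<open>Within a cluster, the student weights are the reference weights times the common factor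
  cluster mass over teacher weight, so every relative deviation is that of the cluster.\<close>

lemma mismatch_weights:
  assumes S: "partitions n m S" and w: "simplex_pos n w" and ps: "simplex_pos m \<pi>s"
    and ref: "has_ref_weights m S \<pi>s w wb" and wb: "simplex_pos n wb"
  shows "0 \<le> mismatch m S \<pi>s w" "i < n \<Longrightarrow> \<bar>w i - wb i\<bar> \<le> mismatch m S \<pi>s w * wb i"
proof -
  have le: "\<bar>cluster_mass S w l - \<pi>s l\<bar> / \<pi>s l \<le> mismatch m S \<pi>s w" if "l < m" for l
    unfolding mismatch_def using that by (intro Max_ge) auto
  have p: "0 < \<pi>s l" if "l < m" for l using ps that by (simp add: simplex_pos_def)
  have "0 < m" using ps by (cases m) (auto simp: simplex_pos_def)
  then have "0 \<le> \<bar>cluster_mass S w 0 - \<pi>s 0\<bar> / \<pi>s 0" using p[of 0] by simp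
  then show "0 \<le> mismatch m S \<pi>s w" using le[OF \<open>0 < m\<close>] by linarith
  assume i: "i < n"
  then have "i \<in> (\<Union>l<m. S l)" using S by (simp add: partitions_def)
  then obtain l where l: "l < m" "i \<in> S l" by blast
  have M: "0 < cluster_mass S w l" by (rule cluster_mass_pos[OF S w l(1)])
  have "w i * \<pi>s l / cluster_mass S w l = wb i" using ref l by (simp add: has_ref_weights_def)
  then have "w i - wb i = wb i * ((cluster_mass S w l - \<pi>s l) / \<pi>s l)"
    using M p[OF l(1)] by (auto simp: field_simps)
  then have "\<bar>w i - wb i\<bar> = wb i * (\<bar>cluster_mass S w l - \<pi>s l\<bar> / \<pi>s l)"
  proof -
    have "0 < wb i" using wb i by (simp add: simplex_pos_def)
    then show ?thesis using p[OF l(1)] \<open>w i - wb i = _\<close> by (simp add: abs_mult abs_divide)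
  qed
  also have "\<dots> \<le> wb i * mismatch m S \<pi>s w"
    using le[OF l(1)] wb i by (intro mult_left_mono) (auto simp: simplex_pos_def intro: less_imp_le)
  finally show "\<bar>w i - wb i\<bar> \<le> mismatch m S \<pi>s w * wb i" by (simp add: mult.commute)
qed

text \<open>The points of a cluster and their weighted mean lie, coordinate by coordinate, within
  \<open>r\<close> of the teacher mean, so they differ by at most \<open>2 * r\<close>. The constant
  is free of the weights and can be fixed before the student; the summand 1 keeps it
  positive.\<close>

lemma spread_bounds:
  assumes S: "partitions n m S" and w: "simplex_pos n w"
    and mu: "\<forall>l<m. \<forall>i\<in>S l. \<forall>k<d. \<mu>t (i, k) = \<mu>s l k"
  shows "0 \<le> spread d m S w y" "spread d m S w y \<le> (4 * real d + 1) * (edist (params d n) y \<mu>t)\<^sup>2"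
proof -
  have w0: "0 < w i" if "l < m" "i \<in> S l" for l i
    using w cluster_finite(3)[OF S that] by (simp add: simplex_pos_def)
  show "0 \<le> spread d m S w y"
    unfolding spread_def by (intro sum_nonneg mult_nonneg_nonneg) (auto intro: less_imp_le[OF w0])
  define r where "r = edist (params d n) y \<mu>t"
  have r: "0 \<le> r" by (simp add: r_def)
  have coord: "\<bar>y (i, k) - cluster_mean S w y l k\<bar> \<le> 2 * r" if l: "l < m" and i: "i \<in> S l" and k: "k < d" for l i k
  proof -
    define M where "M = cluster_mass S w l"
    have M: "0 < M" unfolding M_def by (rule cluster_mass_pos[OF S w l])
    have z: "\<bar>y (j, k) - \<mu>s l k\<bar> \<le> r" if j: "j \<in> S l" for j
      using abs_coord_le_edist[of "params d n" "(j, k)" y \<mu>t] cluster_finite(3)[OF S l j] k mu l j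
      by (simp add: r_def)
    have "cluster_mean S w y l k - \<mu>s l k = (\<Sum>j\<in>S l. w j * (y (j, k) - \<mu>s l k)) / M"
      using M by (simp add: cluster_mean_def M_def[symmetric] right_diff_distrib sum_subtractf
          sum_distrib_right[symmetric] diff_divide_distrib) (simp add: M_def cluster_mass_def)
    also have "\<bar>\<dots>\<bar> = \<bar>\<Sum>j\<in>S l. w j * (y (j, k) - \<mu>s l k)\<bar> / M" using M by simp
    also have "\<dots> \<le> (\<Sum>j\<in>S l. w j * r) / M"
    proof (rule divide_right_mono)
      show "\<bar>\<Sum>j\<in>S l. w j * (y (j, k) - \<mu>s l k)\<bar> \<le> (\<Sum>j\<in>S l. w j * r)"
      proof (rule order_trans[OF sum_abs], rule sum_mono)
        fix j assume j: "j \<in> S l"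
        then show "\<bar>w j * (y (j, k) - \<mu>s l k)\<bar> \<le> w j * r"
          unfolding abs_mult using z[OF j] w0[OF l j] by (intro mult_mono) auto
      qed
    qed (use M in simp)
    also have "\<dots> = r" using M by (simp add: M_def cluster_mass_def sum_distrib_right[symmetric])
    finally show ?thesis using z[OF i] by linarith
  qed
  have ed: "(edist {..<d} (curry y i) (cluster_mean S w y l))\<^sup>2 \<le> real d * (4 * r\<^sup>2)" if l: "l < m" and i: "i \<in> S l" for l i
  proof -
    have "(edist {..<d} (curry y i) (cluster_mean S w y l))\<^sup>2 = (\<Sum>k<d. (y (i, k) - cluster_mean S w y l k)\<^sup>2)"
      by (simp add: edist_def L2_set_def sum_nonneg)
    also have "\<dots> \<le> (\<Sum>k<d. 4 * r\<^sup>2)"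
    proof (rule sum_mono)
      fix k assume "k \<in> {..<d}"
      then have "\<bar>y (i, k) - cluster_mean S w y l k\<bar>\<^sup>2 \<le> (2 * r)\<^sup>2" using coord[OF l i] by (intro power_mono) auto
      then show "(y (i, k) - cluster_mean S w y l k)\<^sup>2 \<le> 4 * r\<^sup>2" by (simp add: power_mult_distrib)
    qed
    finally show ?thesis by simp
  qed
  have "spread d m S w y \<le> (\<Sum>l<m. \<Sum>i\<in>S l. w i * (real d * (4 * r\<^sup>2)))"
    unfolding spread_def by (intro sum_mono mult_left_mono ed) (auto intro: less_imp_le[OF w0])
  also have "\<dots> = (\<Sum>i<n. w i) * (real d * (4 * r\<^sup>2))"
    by (simp only: cluster_sum[OF S, of w] sum_distrib_right)
  also have "\<dots> = (4 * real d) * r\<^sup>2" using w by (simp add: simplex_pos_def)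
  also have "\<dots> \<le> (4 * real d + 1) * r\<^sup>2" by (intro mult_right_mono) auto
  finally show "spread d m S w y \<le> (4 * real d + 1) * (edist (params d n) y \<mu>t)\<^sup>2" by (simp add: r_def)
qed

text \<open>The radius \<open>r\<close> makes precise what the nearness in the description of the
  ravine means, and \<tau>0 is chosen after it. The neighborhood and the constants precede the
  student weights. Finiteness of the hitting time is the assumption that some iterate lies in
  \<open>T \<union> C\<close>, which gives the \<open>LEAST\<close> its meaning.\<close>

theorem corollaryD1:
  shows "\<exists>C0>0. \<forall>d n m \<pi>s \<mu>s Dmax Dmin S \<mu>t \<pi>bar.
    teacher C0 d n m \<pi>s \<mu>s Dmax Dmin \<and>
    partitions n m S \<and>
    \<mu>t \<in> euclid (params d n) \<and>
    (\<forall>l<m. \<forall>i\<in>S l. \<forall>k<d. \<mu>t (i, k) = \<mu>s l k) \<and>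
    simplex_pos n \<pi>bar \<and>
    (\<forall>l<m. (\<Sum>i\<in>S l. \<pi>bar i) = \<pi>s l) \<longrightarrow>
    (let I = params d n;
         L = loss d n m \<pi>s \<mu>s
     in \<exists>r0>0. \<forall>r. 0 < r \<and> r \<le> r0 \<longrightarrow>
       (let M = ravine I (L \<pi>bar) \<mu>t r
        in \<exists>\<tau>0>0. \<forall>\<tau>. 0 < \<tau> \<and> \<tau> < \<tau>0 \<longrightarrow>
          (\<exists>W q_amb \<eta>ub \<kappa>0 \<delta>.
             nbhd I \<mu>t W \<and> 0 < q_amb \<and> q_amb < 1 \<and> 0 < \<eta>ub \<and> 1 \<le> \<kappa>0 \<and> 0 < \<delta> \<and>
             (\<forall>\<pi> \<kappa> \<eta> \<mu>.
                simplex_pos n \<pi> \<and> has_ref_weights m S \<pi>s \<pi> \<pi>bar \<and> mismatch m S \<pi>s \<pi> \<le> \<delta> \<and>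
                \<kappa>0 \<le> \<kappa> \<and> 0 < \<eta> \<and> \<eta> < \<eta>ub \<longrightarrow>
                (let T = tube I M (spread d m S \<pi>) \<tau>;
                     C = core I M (spread d m S \<pi>) \<kappa> (mismatch m S \<pi>s \<pi>);
                     traj = (\<lambda>j. (gd_step I (L \<pi>) \<eta> ^^ j) (polyak_step I (L \<pi>) \<mu>));
                     K = (LEAST j. traj j \<in> T \<union> C)
                 in \<mu> \<in> W \<inter> (T - C) \<and> (\<exists>j. traj j \<in> T \<union> C) \<and> (\<forall>j\<le>K. traj j \<in> W) \<longrightarrow>
                    traj K \<in> C \<or> edist I (traj K) \<mu>t \<le> q_amb * edist I \<mu> \<mu>t)))))"
proof (rule exI[of _ "1::real"], rule conjI, simp, intro allI impI, elim conjE)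
  fix d n m \<pi>s \<mu>s Dmax Dmin S \<mu>t \<pi>bar
  assume te: "teacher 1 d n m \<pi>s \<mu>s Dmax Dmin" and S: "partitions n m S" and \<mu>t: "\<mu>t \<in> euclid (params d n)"
    and mu: "\<forall>l<m. \<forall>i\<in>S l. \<forall>k<d. \<mu>t (i, k) = \<mu>s l k" and wb: "simplex_pos n \<pi>bar"
    and mass: "\<forall>l<m. (\<Sum>i\<in>S l. \<pi>bar i) = \<pi>s l"
  have ps: "simplex_pos m \<pi>s" using te by (simp add: teacher_def Let_def)
  interpret gauss_truth d n m \<pi>s \<mu>s \<pi>bar \<mu>t
    by unfold_locales (rule ps wb teacher_as_student[OF S mu mass])+
  obtain Ce where Ce: "0 < Ce" "\<And>v \<Delta> x. simplex_pos n v \<Longrightarrow> 0 \<le> \<Delta> \<Longrightarrow> \<Delta> \<le> 1 / 2 \<Longrightarrow> (\<forall>i<n. \<bar>v i - \<pi>bar i\<bar> \<le> \<Delta> * \<pi>bar i) \<Longrightarrow>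
      edist (params d n) x \<mu>t \<le> 1 \<Longrightarrow>
      L2_set (\<lambda>p. partial p (loss d n m \<pi>s \<mu>s v) x - grad_L x p) (params d n) \<le> Ce * \<Delta> \<and>
      \<bar>loss d n m \<pi>s \<mu>s v x - L x\<bar> \<le> Ce * (\<Delta> * edist (params d n) x \<mu>t + \<Delta>\<^sup>2)"
    using weight_perturbation by blast
  interpret SM: smooth_min_grad "params d n" L \<mu>t grad_L "\<lambda>p q. hess_L p q \<mu>t"
    by (rule smooth_min_grad_loss[OF \<mu>t])
  define CD where "CD = 4 * real d + 1"
  have CD: "0 < CD" by (simp add: CD_def)
  obtain r0 where r0: "0 < r0" "\<forall>r. 0 < r \<and> r \<le> r0 \<longrightarrow> (\<exists>\<tau>0>0. \<forall>\<tau>. 0 < \<tau> \<and> \<tau> < \<tau>0 \<longrightarrow>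
    (\<exists>W q \<eta>ub \<kappa>0. nbhd (params d n) \<mu>t W \<and> 0 < q \<and> q < 1 \<and> 0 < \<eta>ub \<and> 1 \<le> \<kappa>0 \<and> SM.contracts CD Ce r \<tau> W q \<eta>ub \<kappa>0))"
    by (rule exE[OF SM.polyak_gradient_contraction[OF CD Ce(1)]]) (elim conjE, rule that)
  have step: "gd \<in> C \<or> edist (params d n) gd \<mu>t \<le> q * edist (params d n) \<mu> \<mu>t"
    if c: "SM.contracts CD Ce r \<tau> W q \<eta>ub \<kappa>0"
      and \<pi>: "simplex_pos n \<pi>" "has_ref_weights m S \<pi>s \<pi> \<pi>bar" "mismatch m S \<pi>s \<pi> \<le> 1 / 2"
      and \<eta>: "\<kappa>0 \<le> \<kappa>" "0 < \<eta>" "\<eta> < \<eta>ub"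
      and T: "T = tube (params d n) (ravine (params d n) L \<mu>t r) (spread d m S \<pi>) \<tau>"
      and C: "C = core (params d n) (ravine (params d n) L \<mu>t r) (spread d m S \<pi>) \<kappa> (mismatch m S \<pi>s \<pi>)"
      and tr: "tr = (\<lambda>j. (gd_step (params d n) (loss d n m \<pi>s \<mu>s \<pi>) \<eta> ^^ j) (polyak_step (params d n) (loss d n m \<pi>s \<mu>s \<pi>) \<mu>))"
      and K: "K = (LEAST j. tr j \<in> T \<union> C)" "gd = tr K"
      and \<mu>: "\<mu> \<in> W \<inter> (T - C)" "\<forall>j\<le>K. tr j \<in> W"
    for r \<tau> W q \<eta>ub \<kappa>0 \<pi> \<kappa> \<eta> \<mu> T C tr K gd
  proof -
    note mm = mismatch_weights[OF S \<pi>(1) ps \<pi>(2) wb]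
    \<comment> \<open>Before the least hitting time no iterate lies in the core, which is what
      carries the Lyapunov bound up to \<open>K\<close> itself.\<close>
    have "\<forall>j<K. tr j \<notin> C" using not_less_Least[of _ "\<lambda>j. tr j \<in> T \<union> C"] K(1) by blast
    then have "edist (params d n) gd \<mu>t \<le> q * edist (params d n) \<mu> \<mu>t"
      unfolding K(2) tr
      by (intro SM.contractsD[OF c spread_bounds(1)[OF S \<pi>(1) mu] spread_bounds(2)[OF S \<pi>(1) mu, folded CD_def] mm(1)
            Ce(2)[OF \<pi>(1) mm(1) \<pi>(3)] \<eta>])
        (use \<mu> mm(2) in \<open>simp_all add: T C tr\<close>)
    then show ?thesis ..
  qed
  show "let I = params d n;
         L = loss d n m \<pi>s \<mu>s
     in \<exists>r0>0. \<forall>r. 0 < r \<and> r \<le> r0 \<longrightarrow>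
       (let M = ravine I (L \<pi>bar) \<mu>t r
        in \<exists>\<tau>0>0. \<forall>\<tau>. 0 < \<tau> \<and> \<tau> < \<tau>0 \<longrightarrow>
          (\<exists>W q_amb \<eta>ub \<kappa>0 \<delta>.
             nbhd I \<mu>t W \<and> 0 < q_amb \<and> q_amb < 1 \<and> 0 < \<eta>ub \<and> 1 \<le> \<kappa>0 \<and> 0 < \<delta> \<and>
             (\<forall>\<pi> \<kappa> \<eta> \<mu>.
                simplex_pos n \<pi> \<and> has_ref_weights m S \<pi>s \<pi> \<pi>bar \<and> mismatch m S \<pi>s \<pi> \<le> \<delta> \<and>
                \<kappa>0 \<le> \<kappa> \<and> 0 < \<eta> \<and> \<eta> < \<eta>ub \<longrightarrow>
                (let T = tube I M (spread d m S \<pi>) \<tau>;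
                     C = core I M (spread d m S \<pi>) \<kappa> (mismatch m S \<pi>s \<pi>);
                     traj = (\<lambda>j. (gd_step I (L \<pi>) \<eta> ^^ j) (polyak_step I (L \<pi>) \<mu>));
                     K = (LEAST j. traj j \<in> T \<union> C)
                 in \<mu> \<in> W \<inter> (T - C) \<and> (\<exists>j. traj j \<in> T \<union> C) \<and> (\<forall>j\<le>K. traj j \<in> W) \<longrightarrow>
                    traj K \<in> C \<or> edist I (traj K) \<mu>t \<le> q_amb * edist I \<mu> \<mu>t))))"
    unfolding Let_def
    apply (rule exI[of _ r0], rule conjI[OF r0(1)], intro allI impI, elim conjE)
    subgoal premises r for r
    proof -
      obtain \<tau>0 where \<tau>0: "0 < \<tau>0" "\<forall>\<tau>. 0 < \<tau> \<and> \<tau> < \<tau>0 \<longrightarrow>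
        (\<exists>W q \<eta>ub \<kappa>0. nbhd (params d n) \<mu>t W \<and> 0 < q \<and> q < 1 \<and> 0 < \<eta>ub \<and> 1 \<le> \<kappa>0 \<and> SM.contracts CD Ce r \<tau> W q \<eta>ub \<kappa>0)"
        by (rule exE[OF mp[OF spec[OF r0(2)] conjI[OF r]]]) (elim conjE, rule that)
      show ?thesis
        apply (rule exI[of _ \<tau>0], rule conjI[OF \<tau>0(1)], intro allI impI, elim conjE)
        subgoal premises \<tau> for \<tau>
        proof -
          obtain W q \<eta>ub \<kappa>0 where W: "nbhd (params d n) \<mu>t W" "0 < q" "q < 1" "0 < \<eta>ub" "1 \<le> \<kappa>0"
            and c: "SM.contracts CD Ce r \<tau> W q \<eta>ub \<kappa>0" 
            using mp[OF spec[OF \<tau>0(2)] conjI[OF \<tau>]] by (elim exE conjE) (rule that)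
          show ?thesis
            \<comment> \<open>The mismatch bound 1/2 is the range in which
              \<open>weight_perturbation\<close> holds.\<close>
            apply (rule exI[of _ W], rule exI[of _ q], rule exI[of _ \<eta>ub], rule exI[of _ \<kappa>0], rule exI[of _ "1 / 2"])
            apply (intro conjI W allI impI; (elim conjE)?)
             apply simp
            apply (rule step[OF c _ _ _ _ _ _ refl refl refl refl refl]; assumption)
            done
        qed
        done
    qed
    done
qed

end
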